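(* Let $\Sigma=(B,\sigma)$ be a signed graph whose underlying graph $B$ is a block that is neither a single edge nor a circle. Let $e$ be an edge of $B$ and $C$ a circle of $B$ containing $e$. Then $e$ is a battery with circle $C$ (i.e. either $[e,C,-]$ or $[e,C,+]$ holds) if and only if $B$ is $C$-layered, $e$ lies in a handle of $C$, and one of the following holds: (1) the other handle of $C$ (the one not containing $e$) contains a balancing edge of $\Sigma$; in this case $[e,C,-]$ is a negative battery; (2) for every bridge $D$ of $C$ and every path $P$ through $D$, with endpoints $u\neq w$, both circles formed by $P$ together with one of the two $u$–$w$ paths of $C$ are negative; in this case $[e,C,+]$ is a positive battery.
   Context: A signed graph $\Sigma=(G,\sigma)$ is a finite graph $G$ with signature $\sigma:E(G)\to\{+,-\}$. A circle is a connected 2-regular subgraph; its sign is the product of its edge signs. A (sub)graph is balanced if all its circles are positive. Switching by $\zeta:V(G)\to\{+,-\}$ replaces $\sigma(e)$ by $\zeta(u)\sigma(e)\zeta(w)$ for each edge $e$ with endpoints $u,w$. An edge $b$ is a balancing edge of $\Sigma$ if $\Sigma$ can be switched to a signature in which $b$ is the only negative edge. A block is a maximal subgraph without a cutpoint. For a circle $C$, a chord is an edge not in $C$ joining two distinct vertices of $C$; a bridge of $C$ is either a chord of $C$ or a connected component $D$ of $G\setminus V(C)$ together with all edges joining $D$ to $C$; its vertices of attachment are its vertices on $C$; a path through a bridge $D$ is a path in $D$ whose endpoints are two distinct vertices of attachment of $D$. Two chords $c_1,c_2$ of $C$ cross if $C\cup c_1\cup c_2$ is a subdivision of $K_4$.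 The endpoints of chords partition $C$ into paths called segments; a segment is a handle if its two endpoints are joined by a chord. A circle with chords is 2-handled if no two chords cross and there are exactly two handles. If every bridge of $C$ has exactly two vertices of attachment, $C^*$ is obtained from $C$ by adding, for each bridge, one chord joining its two vertices of attachment; segments and handles of $C$ are then those determined by $C^*$. The graph is $C$-layered if every bridge of $C$ has exactly two vertices of attachment and $C^*$ is 2-handled. An edge $e$ is a negative battery with circle $C$, written $[e,C,-]$, if $C$ is a negative circle containing $e$ and is the only negative circle containing $e$; it is a positive battery $[e,C,+]$ if $C$ is a positive circle containing $e$ and is the only positive circle containing $e$. *)

theory Defs
  imports Main
begin

text \<open>
A (finite multi)graph is given by a vertex set V, an edge set E and an
endpoint map en : 'e => 'v * 'v (a loop has equal components; the order of
the pair is irrelevant).  A signature is sigma : 'e => int with values in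
{1,-1}.  Subgraphs are identified with their edge sets (their vertex set
being the set of endpoints of their edges).
\<close>

definition verts :: "('e \<Rightarrow> 'v \<times> 'v) \<Rightarrow> 'e set \<Rightarrow> 'v set" where
  "verts en S = (\<Union>f\<in>S. {fst (en f), snd (en f)})"

definition adj :: "('e \<Rightarrow> 'v \<times> 'v) \<Rightarrow> 'e set \<Rightarrow> ('v \<times> 'v) set" where
  "adj en S = {(fst (en f), snd (en f)) | f. f \<in> S} \<union> {(snd (en f), fst (en f)) | f. f \<in> S}"

definition conn :: "('e \<Rightarrow> 'v \<times> 'v) \<Rightarrow> 'e set \<Rightarrow> bool" where
  "conn en S = (\<forall>x\<in>verts en S. \<forall>y\<in>verts en S. (x, y) \<in> (adj en S)\<^sup>*)"

text \<open>degree in the subgraph S (a loop counts twice)\<close>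
definition deg :: "('e \<Rightarrow> 'v \<times> 'v) \<Rightarrow> 'e set \<Rightarrow> 'v \<Rightarrow> nat" where
  "deg en S v = card {f\<in>S. fst (en f) = v} + card {f\<in>S. snd (en f) = v}"

text \<open>circle: connected 2-regular subgraph\<close>
definition is_circle :: "('e \<Rightarrow> 'v \<times> 'v) \<Rightarrow> 'e set \<Rightarrow> 'e set \<Rightarrow> bool" where
  "is_circle en E S = (S \<subseteq> E \<and> S \<noteq> {} \<and> conn en S \<and> (\<forall>v\<in>verts en S. deg en S v = 2))"

text \<open>P is (the edge set of) a path with distinct endpoints u and w\<close>
definition is_path :: "('e \<Rightarrow> 'v \<times> 'v) \<Rightarrow> 'e set \<Rightarrow> 'v \<Rightarrow> 'v \<Rightarrow> bool" where
  "is_path en P u w = (finite P \<and> P \<noteq> {} \<and> u \<noteq> w \<and> conn en P \<and>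
     u \<in> verts en P \<and> w \<in> verts en P \<and> deg en P u = 1 \<and> deg en P w = 1 \<and>
     (\<forall>v\<in>verts en P - {u, w}. deg en P v = 2))"

text \<open>sign of a subgraph: product of its edge signs\<close>
definition sgn_of :: "('e \<Rightarrow> int) \<Rightarrow> 'e set \<Rightarrow> int" where
  "sgn_of \<sigma> S = (\<Prod>f\<in>S. \<sigma> f)"

definition signed_graph :: "'v set \<Rightarrow> 'e set \<Rightarrow> ('e \<Rightarrow> 'v \<times> 'v) \<Rightarrow> ('e \<Rightarrow> int) \<Rightarrow> bool" where
  "signed_graph V E en \<sigma> = (finite V \<and> finite E \<and>
     (\<forall>f\<in>E. fst (en f) \<in> V \<and> snd (en f) \<in> V) \<and> (\<forall>f\<in>E. \<sigma> f = 1 \<or> \<sigma> f = -1))"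

definition connected_graph :: "'v set \<Rightarrow> 'e set \<Rightarrow> ('e \<Rightarrow> 'v \<times> 'v) \<Rightarrow> bool" where
  "connected_graph V E en = (\<forall>x\<in>V. \<forall>y\<in>V. (x, y) \<in> (adj en E)\<^sup>*)"

text \<open>cutpoint (separating vertex): the edges split into two nonempty parts
  sharing exactly one vertex\<close>
definition has_cutpoint :: "'e set \<Rightarrow> ('e \<Rightarrow> 'v \<times> 'v) \<Rightarrow> bool" where
  "has_cutpoint E en = (\<exists>E1 E2 v. E1 \<union> E2 = E \<and> E1 \<inter> E2 = {} \<and> E1 \<noteq> {} \<and> E2 \<noteq> {} \<and>
     verts en E1 \<inter> verts en E2 = {v})"

definition is_block :: "'v set \<Rightarrow> 'e set \<Rightarrow> ('e \<Rightarrow> 'v \<times> 'v) \<Rightarrow> bool" where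
  "is_block V E en = (connected_graph V E en \<and> \<not> has_cutpoint E en)"

text \<open>b is a balancing edge: some switching makes b the only negative edge\<close>
definition balancing_edge :: "'v set \<Rightarrow> 'e set \<Rightarrow> ('e \<Rightarrow> 'v \<times> 'v) \<Rightarrow> ('e \<Rightarrow> int) \<Rightarrow> 'e \<Rightarrow> bool" where
  "balancing_edge V E en \<sigma> b = (b \<in> E \<and> (\<exists>\<zeta> :: 'v \<Rightarrow> int. (\<forall>v\<in>V. \<zeta> v = 1 \<or> \<zeta> v = -1) \<and>
     (\<forall>f\<in>E. (\<zeta> (fst (en f)) * \<sigma> f * \<zeta> (snd (en f)) = -1) \<longleftrightarrow> f = b)))"

definition neg_battery :: "'e set \<Rightarrow> ('e \<Rightarrow> 'v \<times> 'v) \<Rightarrow> ('e \<Rightarrow> int) \<Rightarrow> 'e \<Rightarrow> 'e set \<Rightarrow> bool" where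
  "neg_battery E en \<sigma> e C = (is_circle en E C \<and> e \<in> C \<and> sgn_of \<sigma> C = -1 \<and>
     (\<forall>C'. is_circle en E C' \<and> e \<in> C' \<and> sgn_of \<sigma> C' = -1 \<longrightarrow> C' = C))"

definition pos_battery :: "'e set \<Rightarrow> ('e \<Rightarrow> 'v \<times> 'v) \<Rightarrow> ('e \<Rightarrow> int) \<Rightarrow> 'e \<Rightarrow> 'e set \<Rightarrow> bool" where
  "pos_battery E en \<sigma> e C = (is_circle en E C \<and> e \<in> C \<and> sgn_of \<sigma> C = 1 \<and>
     (\<forall>C'. is_circle en E C' \<and> e \<in> C' \<and> sgn_of \<sigma> C' = 1 \<longrightarrow> C' = C))"

text \<open>Bridges of a circle C (as edge sets)\<close>
definition is_chord :: "'e set \<Rightarrow> ('e \<Rightarrow> 'v \<times> 'v) \<Rightarrow> 'e set \<Rightarrow> 'e \<Rightarrow> bool" where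
  "is_chord E en C c = (c \<in> E \<and> c \<notin> C \<and> fst (en c) \<noteq> snd (en c) \<and>
     fst (en c) \<in> verts en C \<and> snd (en c) \<in> verts en C)"

text \<open>edges of G minus V(C)\<close>
definition off_edges :: "'e set \<Rightarrow> ('e \<Rightarrow> 'v \<times> 'v) \<Rightarrow> 'e set \<Rightarrow> 'e set" where
  "off_edges E en C = {f\<in>E. fst (en f) \<notin> verts en C \<and> snd (en f) \<notin> verts en C}"

text \<open>K is the vertex set of a connected component of G minus V(C)\<close>
definition is_component_off :: "'v set \<Rightarrow> 'e set \<Rightarrow> ('e \<Rightarrow> 'v \<times> 'v) \<Rightarrow> 'e set \<Rightarrow> 'v set \<Rightarrow> bool" where
  "is_component_off V E en C K = (\<exists>x\<in>V - verts en C.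
     K = {y\<in>V - verts en C. (x, y) \<in> (adj en (off_edges E en C))\<^sup>*})"

text \<open>a bridge is a chord, or a component D of G - V(C) together with all edges
  incident with D (i.e. the edges of D and the edges joining D to C)\<close>
definition bridges :: "'v set \<Rightarrow> 'e set \<Rightarrow> ('e \<Rightarrow> 'v \<times> 'v) \<Rightarrow> 'e set \<Rightarrow> 'e set set" where
  "bridges V E en C = {{c} | c. is_chord E en C c} \<union>
     {{f\<in>E. fst (en f) \<in> K \<or> snd (en f) \<in> K} | K. is_component_off V E en C K}"

text \<open>vertices of attachment of a bridge D\<close>
definition att :: "('e \<Rightarrow> 'v \<times> 'v) \<Rightarrow> 'e set \<Rightarrow> 'e set \<Rightarrow> 'v set" where
  "att en C D = verts en D \<inter> verts en C"

text \<open>The chords of C* are represented by their endpoint pairs, i.e. by the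
  attachment sets of the bridges of C.\<close>
definition star_chords :: "'v set \<Rightarrow> 'e set \<Rightarrow> ('e \<Rightarrow> 'v \<times> 'v) \<Rightarrow> 'e set \<Rightarrow> 'v set set" where
  "star_chords V E en C = att en C ` bridges V E en C"

definition star_chord_ends :: "'v set \<Rightarrow> 'e set \<Rightarrow> ('e \<Rightarrow> 'v \<times> 'v) \<Rightarrow> 'e set \<Rightarrow> 'v set" where
  "star_chord_ends V E en C = \<Union> (star_chords V E en C)"

text \<open>segments: paths of C between chord endpoints with no chord endpoint inside\<close>
definition is_segment :: "'v set \<Rightarrow> 'e set \<Rightarrow> ('e \<Rightarrow> 'v \<times> 'v) \<Rightarrow> 'e set \<Rightarrow> 'e set \<Rightarrow> bool" where
  "is_segment V E en C Q = (Q \<subseteq> C \<and> (\<exists>x y. x \<in> star_chord_ends V E en C \<and> y \<in> star_chord_ends V E en C \<and>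
     is_path en Q x y \<and> (\<forall>v\<in>verts en Q - {x, y}. v \<notin> star_chord_ends V E en C)))"

definition is_handle :: "'v set \<Rightarrow> 'e set \<Rightarrow> ('e \<Rightarrow> 'v \<times> 'v) \<Rightarrow> 'e set \<Rightarrow> 'e set \<Rightarrow> bool" where
  "is_handle V E en C Q = (is_segment V E en C Q \<and>
     (\<exists>x y. is_path en Q x y \<and> {x, y} \<in> star_chords V E en C))"

text \<open>two chords {a,b}, {c,d} of C cross: four distinct endpoints, and c, d lie
  on different a-b paths of C (i.e. C plus the two chords is a subdivision of K4)\<close>
definition chords_cross :: "('e \<Rightarrow> 'v \<times> 'v) \<Rightarrow> 'e set \<Rightarrow> 'v set \<Rightarrow> 'v set \<Rightarrow> bool" where
  "chords_cross en C p1 p2 = (\<exists>a b c d. p1 = {a, b} \<and> p2 = {c, d} \<and> distinct [a, b, c, d] \<and>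
     c \<in> verts en C \<and> d \<in> verts en C \<and>
     (\<forall>Q. Q \<subseteq> C \<and> is_path en Q a b \<longrightarrow> (c \<in> verts en Q \<longleftrightarrow> d \<notin> verts en Q)))"

definition two_handled :: "'v set \<Rightarrow> 'e set \<Rightarrow> ('e \<Rightarrow> 'v \<times> 'v) \<Rightarrow> 'e set \<Rightarrow> bool" where
  "two_handled V E en C = ((\<forall>p1\<in>star_chords V E en C. \<forall>p2\<in>star_chords V E en C.
       \<not> chords_cross en C p1 p2) \<and>
     card {Q. is_handle V E en C Q} = 2)"

definition layered :: "'v set \<Rightarrow> 'e set \<Rightarrow> ('e \<Rightarrow> 'v \<times> 'v) \<Rightarrow> 'e set \<Rightarrow> bool" where
  "layered V E en C = ((\<forall>D\<in>bridges V E en C. card (att en C D) = 2) \<and> two_handled V E en C)"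

end

theory Submission
  imports Defs
begin

text \<open>
  Number the vertices of \<open>C - e\<close> from one end of \<open>e\<close> to the other. A bridge with two
  attachments becomes an interval of positions, and \<open>C\<close> is layered with \<open>e\<close> in a handle iff
  every bridge has two attachments and the intervals form a chain; the handles are then the
  smallest interval and the complement of the largest.

  If the intervals form a chain, a circle through \<open>e\<close> other than \<open>C\<close> makes exactly one detour
  through a bridge: after a jump over an interval it can neither enter the interval, where it
  would be trapped, nor use a larger one, whose left end is already behind it. Hence it misses
  the inner handle, and its sign is the one prescribed for that bridge.

  Conversely, if all circles through \<open>e\<close> other than \<open>C\<close> have the sign opposite to \<open>C\<close>, then a
  detour through a bridge has the opposite sign of the arc it replaces. A tripod in a bridge, or
  two intervals that are not nested, would allow two such reversals in one circle and so restore
  the sign of \<open>C\<close>. For a negative battery, flip the sign of an edge \<open>b\<close> of the inner handle: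
  now all circles through \<open>e\<close> are positive, and by adding ears to \<open>e\<close> one sees that a block
  with this property can be switched to all positive signs. So \<open>b\<close> is a balancing edge.
\<close>

text \<open>The sign hypothesis enters through a single exchange: trading an arc of \<open>C\<close>
  that avoids \<open>e\<close> for a bridge path with the same ends gives another circle through
  \<open>e\<close>, so arc and path have opposite signs. Being relative to the sign of
  \<open>C\<close>, this treats both kinds of batteries at once. Numbering from \<open>e\<close>
  removes the cyclic symmetry: of the two arcs cut off by a chord, the interval is always the one
  without \<open>e\<close>. In the description of the circles through \<open>e\<close> the obstacle
  is that a path may run backwards along \<open>C\<close> and may re-enter it anywhere; the
  inductions therefore carry the positions that are already closed to the path. In the balance
  argument only circles through \<open>e\<close> are known to be positive, so it is not enough that
  an ear closes up to some circle: its ends must be joined to the two ends of \<open>e\<close> by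
  disjoint paths. This property has to be kept for all pairs of vertices while ears are added, which
  is why bridges are studied for an arbitrary edge set \<open>F\<close> and not only for
  \<open>C\<close>.\<close>

section \<open>Incidence, degrees and connectivity of edge sets\<close>

definition joins :: "('e \<Rightarrow> 'v \<times> 'v) \<Rightarrow> 'e \<Rightarrow> 'v \<Rightarrow> 'v \<Rightarrow> bool" where
  "joins en f u v \<longleftrightarrow> en f = (u, v) \<or> en f = (v, u)"

lemma joins_sym: "joins en f u v \<Longrightarrow> joins en f v u"
  by (auto simp: joins_def)

lemma joins_ends: "joins en f (fst (en f)) (snd (en f))"
  by (simp add: joins_def)

lemma joins_unique: "joins en f u v \<Longrightarrow> joins en f x y \<Longrightarrow> x = u \<and> y = v \<or> x = v \<and> y = u"
  by (auto simp: joins_def)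

lemma verts_empty [simp]: "verts en {} = {}"
  and verts_Un: "verts en (P \<union> Q) = verts en P \<union> verts en Q"
  and verts_mono: "P \<subseteq> Q \<Longrightarrow> verts en P \<subseteq> verts en Q"
  by (auto simp: verts_def)

lemma verts_insert: "joins en f u v \<Longrightarrow> verts en (insert f P) = insert u (insert v (verts en P))"
  by (auto simp: verts_def joins_def)

lemma in_vertsI: "f \<in> S \<Longrightarrow> joins en f u v \<Longrightarrow> u \<in> verts en S"
  by (force simp: verts_def joins_def)

lemma in_vertsE:
  assumes "u \<in> verts en S" obtains f v where "f \<in> S" "joins en f u v"
  using assms by (force simp: verts_def joins_def prod_eq_iff)

lemma adj_iff: "(x, y) \<in> adj en S \<longleftrightarrow> (\<exists>f\<in>S. joins en f x y)"
  by (force simp: adj_def joins_def prod_eq_iff)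

lemma adj_mono: "S \<subseteq> T \<Longrightarrow> adj en S \<subseteq> adj en T"
  by (auto simp: adj_def)

lemma adj_rtrancl_mono: "S \<subseteq> T \<Longrightarrow> (x, y) \<in> (adj en S)\<^sup>* \<Longrightarrow> (x, y) \<in> (adj en T)\<^sup>*"
  using rtrancl_mono[OF adj_mono] by blast

lemma adj_rtrancl_sym: "(x, y) \<in> (adj en S)\<^sup>* \<Longrightarrow> (y, x) \<in> (adj en S)\<^sup>*"
proof -
  have "sym (adj en S)" by (auto simp: sym_def adj_iff intro: joins_sym)
  then show "(x, y) \<in> (adj en S)\<^sup>* \<Longrightarrow> (y, x) \<in> (adj en S)\<^sup>*"
    by (meson sym_rtrancl symE)
qed

lemma verts_closed:
  assumes "(x, y) \<in> (adj en S)\<^sup>*" "x \<in> A" "\<And>f u v. f \<in> S \<Longrightarrow> joins en f u v \<Longrightarrow> u \<in> A \<Longrightarrow> v \<in> A"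
  shows "y \<in> A"
  using assms(1,2) by (induction) (auto simp: adj_iff intro: assms(3))

lemma deg_insert:
  assumes "finite P" "f \<notin> P" "joins en f u v"
  shows "deg en (insert f P) x = deg en P x + (if x = u then 1 else 0) + (if x = v then 1 else 0)"
proof -
  have ins: "card {g \<in> insert f P. h g = x} = card {g \<in> P. h g = x} + (if h f = x then 1 else 0)" for h :: "'a \<Rightarrow> 'b"
  proof (cases "h f = x")
    case True
    then have "{g \<in> insert f P. h g = x} = insert f {g \<in> P. h g = x}" by auto
    then show ?thesis using assms(1,2) True by simp
  next
    case False
    then have "{g \<in> insert f P. h g = x} = {g \<in> P. h g = x}" by auto
    then show ?thesis using False by simp
  qed
  have "fst (en f) = u \<and> snd (en f) = v \<or> fst (en f) = v \<and> snd (en f) = u"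
    using assms(3) by (auto simp: joins_def)
  then show ?thesis unfolding deg_def ins[of "\<lambda>g. fst (en g)"] ins[of "\<lambda>g. snd (en g)"] by auto
qed

lemma deg_notin: "x \<notin> verts en P \<Longrightarrow> deg en P x = 0"
proof -
  assume "x \<notin> verts en P"
  then have "{g \<in> P. fst (en g) = x} = {}" "{g \<in> P. snd (en g) = x} = {}"
    by (auto simp: verts_def)
  then show ?thesis unfolding deg_def by (simp only: card.empty)
qed

lemma deg_mono: "finite S \<Longrightarrow> Q \<subseteq> S \<Longrightarrow> deg en Q x \<le> deg en S x"
  unfolding deg_def by (intro add_mono card_mono) auto

lemma deg_less:
  assumes "finite S" "Q \<subseteq> S" "f \<in> S" "f \<notin> Q" "joins en f x y"
  shows "deg en Q x < deg en S x"
proof -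
  have "deg en (insert f Q) x \<le> deg en S x" using assms by (intro deg_mono) auto
  moreover have "finite Q" using assms finite_subset by blast
  ultimately show ?thesis using deg_insert[of Q f en x y x] assms by auto
qed

text \<open>An edge of \<open>S\<close> outside \<open>Q\<close> at a vertex of \<open>Q\<close>
  would make the degree there strictly larger in \<open>S\<close>. So \<open>Q\<close> absorbs every
  edge that touches it, and connectivity carries this to all of \<open>S\<close>. In this way paths
  and circles given by degrees are identified with explicitly constructed ones.\<close>

lemma conn_rigid:
  assumes "finite S" "conn en S" "Q \<subseteq> S" "Q \<noteq> {}" "\<And>v. v \<in> verts en Q \<Longrightarrow> deg en S v \<le> deg en Q v"
  shows "Q = S"
proof -
  have no: "f \<in> Q" if "f \<in> S" "joins en f u v" "u \<in> verts en Q" for f u v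
    using deg_less[OF assms(1,3) that(1) _ that(2)] assms(5)[OF that(3)] by fastforce
  obtain g where "g \<in> Q" using assms(4) by auto
  then have g: "fst (en g) \<in> verts en Q" by (auto simp: verts_def)
  have "f \<in> Q" if "f \<in> S" for f
  proof -
    have "fst (en f) \<in> verts en S" "fst (en g) \<in> verts en S"
      using in_vertsI[OF that joins_ends] g verts_mono[OF assms(3), of en] by blast+
    then have "(fst (en g), fst (en f)) \<in> (adj en S)\<^sup>*" using assms(2) by (auto simp: conn_def)
    then have "fst (en f) \<in> verts en Q"
      by (rule verts_closed[OF _ g]) (meson in_vertsI joins_sym no)
    then show ?thesis using no[OF that joins_ends] by simp
  qed
  then show ?thesis using assms(3) by auto
qed

section \<open>Simple paths\<close>

text \<open>
  \<open>pth en u P X w\<close>: a path from \<open>u\<close> to \<open>w\<close> with edge set \<open>P\<close> and vertex set \<open>X\<close>. Unlike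
  \<^const>\<open>is_path\<close> it admits the path of length 0, whose vertex is not recorded by its edge set.
\<close>

inductive pth :: "('e \<Rightarrow> 'v \<times> 'v) \<Rightarrow> 'v \<Rightarrow> 'e set \<Rightarrow> 'v set \<Rightarrow> 'v \<Rightarrow> bool" for en where
  nil: "pth en u {} {u} u"
| step: "joins en f u v \<Longrightarrow> pth en v P X w \<Longrightarrow> u \<notin> X \<Longrightarrow> pth en u (insert f P) (insert u X) w"

lemma pth_ends: "pth en u P X w \<Longrightarrow> u \<in> X \<and> w \<in> X"
  by (induction rule: pth.induct) auto

lemma pth_finite: "pth en u P X w \<Longrightarrow> finite P \<and> finite X"
  by (induction rule: pth.induct) auto

lemma pth_vset: "pth en u P X w \<Longrightarrow> X = insert u (verts en P)"
  by (induction rule: pth.induct) (auto simp: verts_insert)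

lemma pth_verts_sub: "pth en u P X w \<Longrightarrow> verts en P \<subseteq> X"
  using pth_vset by fastforce

lemma pth_eq_iff: "pth en u P X w \<Longrightarrow> P = {} \<longleftrightarrow> u = w"
  by (induction rule: pth.induct) (auto dest: pth_ends)

lemma pth_verts: "pth en u P X w \<Longrightarrow> u \<noteq> w \<Longrightarrow> verts en P = X"
  by (induction rule: pth.cases) (auto simp: verts_insert dest: pth_vset)

lemma pth_no_loop: "pth en u P X w \<Longrightarrow> f \<in> P \<Longrightarrow> fst (en f) \<noteq> snd (en f)"
  by (induction rule: pth.induct) (auto simp: joins_def dest: pth_ends)

lemma pth_edge_ends: "pth en u P X w \<Longrightarrow> f \<in> P \<Longrightarrow> joins en f x y \<Longrightarrow> x \<in> X \<and> y \<in> X"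
  using pth_verts_sub in_vertsI joins_sym by (metis subsetD)

lemma pth_disjoint:
  assumes "pth en u P X w" "pth en u' P' X' w'" "X \<inter> X' \<subseteq> {x}"
  shows "P \<inter> P' = {}"
proof -
  have False if "f \<in> P" "f \<in> P'" for f
    using pth_edge_ends[OF assms(1) that(1) joins_ends] pth_edge_ends[OF assms(2) that(2) joins_ends]
      pth_no_loop[OF assms(1) that(1)] assms(3) by auto
  then show ?thesis by auto
qed

lemma pth_append:
  "pth en u P X x \<Longrightarrow> pth en x P' X' w \<Longrightarrow> X \<inter> X' \<subseteq> {x} \<Longrightarrow> pth en u (P \<union> P') (X \<union> X') w"
proof (induction rule: pth.induct)
  case (nil u)
  then show ?case using pth_ends[OF nil(1)] by (simp add: insert_absorb)
next
  case (step f u v P X w')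
  have "u \<notin> X'" using step pth_ends by fastforce
  then show ?case using step pth.step[of en f u v "P \<union> P'" "X \<union> X'" w] by auto
qed

lemma pth_single: "joins en f u v \<Longrightarrow> u \<noteq> v \<Longrightarrow> pth en u {f} {u, v} v"
  using pth.step[OF _ pth.nil] by fastforce

lemma pth_rev: "pth en u P X w \<Longrightarrow> pth en w P X u"
proof (induction rule: pth.induct)
  case (nil u)
  then show ?case by (rule pth.nil)
next
  case (step f u v P X w)
  have "pth en v {f} {v, u} u" using step joins_sym pth_ends pth_single by metis
  from pth_append[OF step.IH this] step(3) have "pth en w (P \<union> {f}) (X \<union> {v, u}) u" by auto
  moreover have "X \<union> {v, u} = insert u X" using pth_ends[OF step(2)] by auto
  ultimately show ?case by simp
qed

lemma pth_first:
  assumes "pth en u P X w" "X \<inter> A \<noteq> {}"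
  obtains x P1 X1 P2 X2 where "pth en u P1 X1 x" "pth en x P2 X2 w" "P = P1 \<union> P2" "X = X1 \<union> X2"
    "X1 \<inter> X2 = {x}" "X1 \<inter> A = {x}"
proof -
  from assms have "\<exists>x P1 X1 P2 X2. pth en u P1 X1 x \<and> pth en x P2 X2 w \<and> P = P1 \<union> P2 \<and> X = X1 \<union> X2 \<and>
    X1 \<inter> X2 = {x} \<and> X1 \<inter> A = {x}"
  proof (induction rule: pth.induct)
    case (nil u)
    then have "u \<in> A" by auto
    then show ?case using pth.nil[of en u]
      by (intro exI[of _ u] exI[of _ "{}"] exI[of _ "{u}"]) auto
  next
    case (step f u v P X w)
    show ?case
    proof (cases "u \<in> A")
      case True
      then show ?thesis using pth.nil[of en u] pth.step[OF step(1-3)]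
        by (intro exI[of _ u] exI[of _ "{}"] exI[of _ "{u}"] exI[of _ "insert f P"] exI[of _ "insert u X"]) auto
    next
      case False
      then obtain x P1 X1 P2 X2 where *: "pth en v P1 X1 x" "pth en x P2 X2 w" "P = P1 \<union> P2" "X = X1 \<union> X2"
        "X1 \<inter> X2 = {x}" "X1 \<inter> A = {x}" using step.IH step.prems by blast
      have "pth en u (insert f P1) (insert u X1) x" using pth.step[OF step(1) *(1)] step(3) * by auto
      moreover have "insert f P = insert f P1 \<union> P2" "insert u X = insert u X1 \<union> X2"
        "insert u X1 \<inter> X2 = {x}" "insert u X1 \<inter> A = {x}" using *(3-6) step(3) False by auto
      ultimately show ?thesis using *(2) by metis
    qed
  qed
  then show ?thesis by (elim exE conjE) (rule that)
qed

lemma pth_split: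
  assumes "pth en u P X w" "x \<in> X"
  obtains P1 X1 P2 X2 where "pth en u P1 X1 x" "pth en x P2 X2 w" "P = P1 \<union> P2" "X = X1 \<union> X2"
    "X1 \<inter> X2 = {x}"
  using pth_first[OF assms(1), of "{x}"] assms(2) by (metis Int_empty_right Int_insert_right insertI1 insert_not_empty singletonD)

lemma pth_split_edge:
  assumes "pth en u P X w" "f \<in> P"
  obtains x y P1 X1 P2 X2 where "joins en f x y" "pth en u P1 X1 x" "pth en y P2 X2 w"
    "P = insert f (P1 \<union> P2)" "f \<notin> P1 \<union> P2" "X = X1 \<union> X2" "X1 \<inter> X2 = {}"
proof -
  from assms have "\<exists>x y P1 X1 P2 X2. joins en f x y \<and> pth en u P1 X1 x \<and> pth en y P2 X2 w \<and>
    P = insert f (P1 \<union> P2) \<and> f \<notin> P1 \<union> P2 \<and> X = X1 \<union> X2 \<and> X1 \<inter> X2 = {}"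
  proof (induction rule: pth.induct)
    case (step g u v P X w)
    have g: "g \<notin> P" using pth_edge_ends[OF step(2) _ step(1)] step(3) by auto
    show ?case
    proof (cases "f = g")
      case True
      then show ?thesis using step(1-3) g pth.nil[of en u]
        by (intro exI[of _ u] exI[of _ v] exI[of _ "{}"] exI[of _ "{u}"] exI[of _ P] exI[of _ X]) auto
    next
      case False
      then obtain x y P1 X1 P2 X2 where *: "joins en f x y" "pth en v P1 X1 x" "pth en y P2 X2 w"
        "P = insert f (P1 \<union> P2)" "f \<notin> P1 \<union> P2" "X = X1 \<union> X2" "X1 \<inter> X2 = {}" using step.IH step.prems by blast
      have "pth en u (insert g P1) (insert u X1) x" using pth.step[OF step(1) *(2)] step(3) * by auto
      moreover have "insert g P = insert f (insert g P1 \<union> P2)" "f \<notin> insert g P1 \<union> P2"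
        "insert u X = insert u X1 \<union> X2" "insert u X1 \<inter> X2 = {}" using *(4-7) step(3) False by auto
      ultimately show ?thesis using *(1,3) by metis
    qed
  qed simp
  then show ?thesis by (elim exE conjE) (rule that)
qed

lemma pth_exists:
  assumes "(x, y) \<in> (adj en S)\<^sup>*"
  obtains P X where "P \<subseteq> S" "pth en x P X y"
proof -
  from assms have "\<exists>P X. P \<subseteq> S \<and> pth en x P X y"
  proof (induction rule: converse_rtrancl_induct)
    case base
    then show ?case using pth.nil[of en y] by blast
  next
    case (step x z)
    then obtain f P X where *: "f \<in> S" "joins en f x z" "P \<subseteq> S" "pth en z P X y" by (auto simp: adj_iff)
    \<comment> \<open>If the new vertex is already on the path, the tail starting there is itself a
      path from it to \<open>y\<close>; this cuts out the detour of the walk.\<close>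
    show ?case
    proof (cases "x \<in> X")
      case True
      then show ?thesis using pth_split[OF *(4)] *(3) by (metis le_sup_iff)
    next
      case False
      then show ?thesis using pth.step[OF *(2,4)] * by (metis insert_subset)
    qed
  qed
  then show ?thesis by (elim exE conjE) (rule that)
qed

lemma pth_reach: "pth en u P X w \<Longrightarrow> x \<in> X \<Longrightarrow> (u, x) \<in> (adj en P)\<^sup>*"
proof (induction rule: pth.induct)
  case (step f u v P X w)
  have "(u, v) \<in> adj en (insert f P)" using step(1) by (auto simp: adj_iff)
  moreover have "x \<in> X \<Longrightarrow> (v, x) \<in> (adj en (insert f P))\<^sup>*"
    using step.IH by (rule adj_rtrancl_mono[rotated]) auto
  ultimately show ?case using step(5) by (metis converse_rtrancl_into_rtrancl insertE rtrancl.rtrancl_refl)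
qed auto

lemma pth_conn: assumes "pth en u P X w" shows "conn en P"
  unfolding conn_def using pth_reach[OF assms] pth_verts_sub[OF assms]
  by (meson adj_rtrancl_sym rtrancl_trans subsetD)

lemma pth_deg:
  "pth en u P X w \<Longrightarrow> x \<in> X \<Longrightarrow>
    deg en P x = (if u = w then 0 else if x = u \<or> x = w then 1 else 2)"
proof (induction rule: pth.induct)
  case (nil u)
  then show ?case by (auto simp: deg_notin)
next
  case (step f u v P X w)
  have f: "f \<notin> P" using pth_edge_ends[OF step(2) _ step(1)] step(3) by auto
  have "u \<notin> verts en P" using pth_verts_sub[OF step(2)] step(3) by auto
  then have "deg en P u = 0" by (rule deg_notin)
  moreover have "u \<noteq> w" "u \<noteq> v" "finite P" using step pth_ends pth_finite by fastforce+
  moreover have "v = w \<Longrightarrow> X = {v}" using pth_vset[OF step(2)] pth_eq_iff[OF step(2)] by auto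
  ultimately show ?case using deg_insert[OF _ f step(1), of x] step by auto
qed

section \<open>Paths and circles given by their degrees\<close>

lemma is_path_if_pth:
  assumes "pth en u P X w" "u \<noteq> w"
  shows "is_path en P u w"
  using pth_deg[OF assms(1)] pth_ends[OF assms(1)] pth_verts[OF assms] pth_finite[OF assms(1)]
    pth_conn[OF assms(1)] pth_eq_iff[OF assms(1)] assms(2)
  unfolding is_path_def by auto

lemma is_path_sym: "is_path en P u w \<Longrightarrow> is_path en P w u"
  unfolding is_path_def by (auto simp: insert_commute)

text \<open>Any simple path from \<open>u\<close> to \<open>w\<close> inside \<open>P\<close>
  already exhausts the degrees of \<open>P\<close> at its vertices, so by rigidity it is all of
  \<open>P\<close>.\<close>

lemma pth_if_is_path:
  assumes "is_path en P u w"
  shows "pth en u P (verts en P) w"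
proof -
  have "(u, w) \<in> (adj en P)\<^sup>*" using assms by (auto simp: is_path_def conn_def)
  then obtain Q X where Q: "Q \<subseteq> P" "pth en u Q X w" by (rule pth_exists)
  have uw: "u \<noteq> w" "finite P" "conn en P" using assms by (auto simp: is_path_def)
  have "Q = P"
  proof (rule conn_rigid[OF uw(2,3) Q(1)])
    show "Q \<noteq> {}" using pth_eq_iff[OF Q(2)] uw by auto
    fix v assume "v \<in> verts en Q"
    then have "v \<in> X" "v \<in> verts en P" using Q pth_verts_sub verts_mono by fastforce+
    then show "deg en P v \<le> deg en Q v" using pth_deg[OF Q(2)] assms uw by (auto simp: is_path_def)
  qed
  then show ?thesis using Q pth_verts uw by metis
qed

lemma is_circle_if_pth:
  assumes "pth en u P X w" "u \<noteq> w" "joins en e u w" "e \<notin> P" "insert e P \<subseteq> E"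
  shows "is_circle en E (insert e P)"
proof -
  have X: "verts en P = X" "u \<in> X" "w \<in> X" using pth_verts[OF assms(1,2)] pth_ends[OF assms(1)] by auto
  then have v: "verts en (insert e P) = verts en P" using verts_insert[OF assms(3), of P] by auto
  have "conn en (insert e P)"
    using pth_conn[OF assms(1)] unfolding conn_def v by (meson adj_rtrancl_mono subset_insertI)
  moreover have "deg en (insert e P) x = 2" if "x \<in> X" for x
    using deg_insert[OF _ assms(4,3), of x] pth_deg[OF assms(1) that] pth_finite[OF assms(1)] assms(2) by auto
  ultimately show ?thesis using assms v X unfolding is_circle_def by auto
qed

text \<open>A longest path in \<open>Z - {e}\<close> that ends in \<open>u\<close> must start in
  \<open>w\<close>: elsewhere degree 2 supplies one more edge, and its far end is new because it
  would otherwise have degree at least 3. Rigidity then shows that the path and \<open>e\<close>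
  fill \<open>Z\<close>.\<close>

lemma pth_if_is_circle:
  assumes "is_circle en E Z" "finite E" "e \<in> Z" "joins en e u w" "u \<noteq> w"
  obtains P X where "pth en u P X w" "Z = insert e P" "e \<notin> P"
proof -
  have Z: "Z \<subseteq> E" "finite Z" "conn en Z" "\<And>v. v \<in> verts en Z \<Longrightarrow> deg en Z v = 2"
    using assms(1) finite_subset[OF _ assms(2), of Z] by (simp_all add: is_circle_def)
  define n where "n = Max {card P | P X x. P \<subseteq> Z - {e} \<and> pth en x P X u}"
  have fin: "finite {card P | P X x. P \<subseteq> Z - {e} \<and> pth en x P X u}"
    by (rule finite_subset[of _ "card ` Pow Z"]) (use Z in auto)
  have "card ({}::'a set) \<in> {card P | P X x. P \<subseteq> Z - {e} \<and> pth en x P X u}"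
    using pth.nil[of en u] by blast
  then have "n \<in> {card P | P X x. P \<subseteq> Z - {e} \<and> pth en x P X u}"
    unfolding n_def by (intro Max_in[OF fin]) blast
  then obtain P X x where P: "P \<subseteq> Z - {e}" "pth en x P X u" "card P = n" by auto
  have mx: "card P' \<le> n" if "P' \<subseteq> Z - {e}" "pth en x' P' X' u" for P' X' x'
    unfolding n_def by (rule Max_ge[OF fin]) (use that in blast)
  have fP: "finite P" using pth_finite[OF P(2)] by simp
  have e: "e \<notin> P" using P by auto
  have "x = w"
  proof (rule ccontr)
    assume xw: "x \<noteq> w"
    have xZ: "x \<in> verts en Z"
      using assms(3,4) P(1) pth_vset[OF P(2)] pth_eq_iff[OF P(2)] pth_verts[OF P(2)] pth_ends[OF P(2)] verts_mono[of P Z en]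
      by (metis Diff_insert_absorb Diff_subset empty_subsetI in_vertsI insert_absorb subset_Diff_insert subset_iff)
    let ?P = "insert e P"
    have "deg en ?P x < 2"
      using deg_insert[OF fP e assms(4), of x] pth_deg[OF P(2), of x] pth_ends[OF P(2)] xw assms(5) by auto
    then have lt: "deg en ?P x < deg en Z x" using Z(4)[OF xZ] by simp
    have "\<exists>g\<in>Z - ?P. \<exists>y. joins en g x y"
    proof (rule ccontr)
      assume no: "\<not> ?thesis"
      have "{f \<in> Z. fst (en f) = x} = {f \<in> ?P. fst (en f) = x}"
        "{f \<in> Z. snd (en f) = x} = {f \<in> ?P. snd (en f) = x}"
        using no P assms(3) joins_ends[of en] joins_sym by fast+
      then show False using lt unfolding deg_def by simp
    qed
    then obtain g y where g: "g \<in> Z" "g \<notin> ?P" "joins en g x y" by auto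
    have "y \<notin> X"
    proof
      assume y: "y \<in> X"
      have sub: "insert g ?P \<subseteq> Z" using g P assms(3) by auto
      have yZ: "y \<in> verts en Z" using g in_vertsI joins_sym by metis
      have "deg en (insert g ?P) y \<le> 2" using deg_mono[OF Z(2) sub] Z(4)[OF yZ] by metis
      \<comment> \<open>If the path has length 0, then \<open>g\<close> would be a loop at
        \<open>u\<close>, and a loop counts twice in the degree.\<close>
      moreover have "x = u \<Longrightarrow> y = u" using pth_vset[OF P(2)] pth_eq_iff[OF P(2)] y by auto
      ultimately have "deg en (insert g ?P) y \<ge> 3"
        using deg_insert[OF _ g(2,3), of y] deg_insert[OF fP e assms(4), of y] pth_deg[OF P(2) y] fP
          xw assms(5) lt Z(4)[OF xZ] deg_mono[OF Z(2) sub, of en y] Z(4)[OF yZ] by (auto split: if_splits)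
      then show False using \<open>deg en (insert g ?P) y \<le> 2\<close> by simp
    qed
    then have "pth en y (insert g P) (insert y X) u" using pth.step[OF joins_sym[OF g(3)] P(2)] by auto
    from mx[OF _ this] show False using g P fP by auto
  qed
  then have pw: "pth en u P X w" using pth_rev P by metis
  have "insert e P = Z"
  proof (rule conn_rigid[OF Z(2,3)])
    show "insert e P \<subseteq> Z" "insert e P \<noteq> {}" using P assms by auto
    fix v assume v: "v \<in> verts en (insert e P)"
    then have "v \<in> X" using pth_verts_sub[OF pw] pth_ends[OF pw] by (auto simp: verts_insert[OF assms(4)])
    moreover have "v \<in> verts en Z" using v P assms(3) verts_mono[of "insert e P" Z en] by auto
    ultimately show "deg en Z v \<le> deg en (insert e P) v"
      using deg_insert[OF fP e assms(4), of v] pth_deg[OF pw, of v] Z(4)[of v] assms(5) by auto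
  qed
  then show ?thesis using that pw e by metis
qed

section \<open>Bridges of a subgraph of a block\<close>

text \<open>\<open>noloop\<close> is a separate assumption because a graph whose only edge is a loop
  has no cutpoint in the sense of \<open>has_cutpoint\<close>; it is recovered in
  \<open>block_no_loop\<close>.\<close>

locale block =
  fixes V :: "'v set" and E :: "'e set" and en :: "'e \<Rightarrow> 'v \<times> 'v"
  assumes fin: "finite E"
    and inc: "\<And>f u v. f \<in> E \<Longrightarrow> joins en f u v \<Longrightarrow> u \<in> V"
    and connected: "\<And>x y. x \<in> V \<Longrightarrow> y \<in> V \<Longrightarrow> (x, y) \<in> (adj en E)\<^sup>*"
    and nocut: "\<not> has_cutpoint E en"
    and noloop: "\<And>f. f \<in> E \<Longrightarrow> fst (en f) \<noteq> snd (en f)"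
begin

lemma joins_neq: "f \<in> E \<Longrightarrow> joins en f u v \<Longrightarrow> u \<noteq> v"
  using noloop by (force simp: joins_def)

lemma verts_V: "S \<subseteq> E \<Longrightarrow> verts en S \<subseteq> V"
  using inc by (metis in_vertsE subset_iff)

text \<open>Connectivity provides one common vertex, the absence of a cutpoint a second one. Inside
  the locale, \<open>nocut\<close> acts only through this lemma.\<close>

lemma two_common_vertices:
  assumes "E1 \<union> E2 = E" "E1 \<inter> E2 = {}" "E1 \<noteq> {}" "E2 \<noteq> {}"
  obtains x y where "x \<noteq> y" "x \<in> verts en E1 \<inter> verts en E2" "y \<in> verts en E1 \<inter> verts en E2"
proof -
  obtain f g where fg: "f \<in> E1" "g \<in> E2" using assms by auto
  have "verts en E1 \<inter> verts en E2 \<noteq> {}"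
  proof
    assume dis: "verts en E1 \<inter> verts en E2 = {}"
    have "fst (en f) \<in> V" "fst (en g) \<in> V" using fg assms(1) inc[OF _ joins_ends] by blast+
    then have "(fst (en f), fst (en g)) \<in> (adj en E)\<^sup>*" by (rule connected)
    moreover have "fst (en f) \<in> verts en E1" "fst (en g) \<in> verts en E2" using fg in_vertsI[OF _ joins_ends] by metis+
    moreover have "v \<in> verts en E1" if h: "h \<in> E" "joins en h u v" "u \<in> verts en E1" for h u v
    proof -
      have "h \<notin> E2" using h dis in_vertsI by fastforce
      then show ?thesis using h assms(1) in_vertsI joins_sym by (metis UnE)
    qed
    ultimately have "fst (en g) \<in> verts en E1" using verts_closed by metis
    then show False using dis \<open>fst (en g) \<in> verts en E2\<close> by auto
  qed
  then obtain x where x: "x \<in> verts en E1 \<inter> verts en E2" by auto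
  have "verts en E1 \<inter> verts en E2 \<noteq> {x}" using nocut assms unfolding has_cutpoint_def by blast
  then show ?thesis using x that by blast
qed

section \<open>Components off an edge set \<open>F\<close>\<close>

context
  fixes F K assumes K: "is_component_off V E en F K"
begin

lemma comp_off: "K \<subseteq> V" "K \<inter> verts en F = {}" "K \<noteq> {}"
  using K unfolding is_component_off_def by auto

lemma comp_reach: assumes "u \<in> K" "v \<in> K" shows "(u, v) \<in> (adj en (off_edges E en F))\<^sup>*"
proof -
  obtain x where "K = {y\<in>V - verts en F. (x, y) \<in> (adj en (off_edges E en F))\<^sup>*}"
    using K unfolding is_component_off_def by blast
  then have "(x, u) \<in> (adj en (off_edges E en F))\<^sup>*" "(x, v) \<in> (adj en (off_edges E en F))\<^sup>*"
    using assms by auto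
  then show ?thesis by (meson adj_rtrancl_sym rtrancl_trans)
qed

lemma comp_closed:
  assumes "f \<in> E" "joins en f u v" "u \<in> K" "v \<notin> verts en F" shows "v \<in> K"
proof -
  have u: "u \<notin> verts en F" using comp_off assms by auto
  have "f \<in> off_edges E en F" using assms u unfolding off_edges_def joins_def by auto
  then have "(u, v) \<in> adj en (off_edges E en F)" using assms by (auto simp: adj_iff)
  moreover have "v \<in> V" using inc assms joins_sym by metis
  ultimately show ?thesis using K assms unfolding is_component_off_def by (auto intro: rtrancl_into_rtrancl)
qed

lemma comp_path:
  assumes "u \<in> K" "v \<in> K"
  obtains P X where "pth en u P X v" "X \<subseteq> K" "P \<subseteq> E"
proof -
  obtain P X where P: "P \<subseteq> off_edges E en F" "pth en u P X v" using pth_exists[OF comp_reach[OF assms]] .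
  have "x \<in> K" if "x \<in> X" for x
  proof (rule verts_closed[OF pth_reach[OF P(2) that] assms(1)])
    fix f y z assume f: "f \<in> P" "joins en f y z" "y \<in> K"
    then have "f \<in> E" "z \<notin> verts en F" using P(1) by (auto simp: off_edges_def joins_def)
    then show "z \<in> K" using comp_closed f by blast
  qed
  then have "X \<subseteq> K" "P \<subseteq> E" using P(1) by (auto simp: off_edges_def)
  then show ?thesis using that P(2) by blast
qed

text \<open>As long as the path avoids \<open>F\<close>, every step stays in the component by
  \<open>comp_closed\<close>; only the last vertex lies on \<open>F\<close>.\<close>

lemma comp_initial:
  assumes "pth en u R X x" "u \<in> K" "X \<inter> verts en F = {x}" "R \<subseteq> E"
  shows "X - {x} \<subseteq> K" "R \<subseteq> {f \<in> E. fst (en f) \<in> K \<or> snd (en f) \<in> K}"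
proof -
  have "X - {x} \<subseteq> K \<and> R \<subseteq> {f \<in> E. fst (en f) \<in> K \<or> snd (en f) \<in> K}"
    using assms
  proof (induction rule: pth.induct)
    case (step f u v P X w)
    have uF: "u \<notin> verts en F" "u \<notin> {w}" using comp_off step pth_ends by fastforce+
    have f: "f \<in> {f \<in> E. fst (en f) \<in> K \<or> snd (en f) \<in> K}" using step by (auto simp: joins_def)
    show ?case
    proof (cases "v \<in> verts en F")
      case True
      then have "v = w" using step pth_ends[OF step(2)] by auto
      then have "P = {}" "X = {v}" using pth_eq_iff[OF step(2)] pth_vset[OF step(2)] by auto
      then show ?thesis using f step \<open>v = w\<close> by auto
    next
      case False
      then have "v \<in> K" using comp_closed step by blast
      moreover have "X \<inter> verts en F = {w}" using step uF by auto
      ultimately show ?thesis using step f by auto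
    qed
  qed auto
  then show "X - {x} \<subseteq> K" "R \<subseteq> {f \<in> E. fst (en f) \<in> K \<or> snd (en f) \<in> K}" by auto
qed

lemma comp_att_edge:
  assumes "x \<in> att en F {f \<in> E. fst (en f) \<in> K \<or> snd (en f) \<in> K}"
  obtains g k where "g \<in> E" "joins en g x k" "k \<in> K"
proof -
  have "x \<in> verts en {f \<in> E. fst (en f) \<in> K \<or> snd (en f) \<in> K}" using assms by (simp add: att_def)
  then obtain g k where g: "g \<in> {f \<in> E. fst (en f) \<in> K \<or> snd (en f) \<in> K}" "joins en g x k"
    by (rule in_vertsE)
  have "x \<notin> K" using assms comp_off by (auto simp: att_def)
  then have "g \<in> E" "k \<in> K" using g by (auto simp: joins_def)
  then show ?thesis using that g(2) by blast
qed

end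

section \<open>Bridges of \<open>F\<close> and their vertices of attachment\<close>

lemma bridge_cases [consumes 1, case_names chord comp]:
  assumes "D \<in> bridges V E en F"
  obtains c where "D = {c}" "is_chord E en F c"
  | K where "is_component_off V E en F K" "D = {f \<in> E. fst (en f) \<in> K \<or> snd (en f) \<in> K}"
  using assms unfolding bridges_def by auto

lemma att_chord: "is_chord E en F c \<Longrightarrow> att en F {c} = {fst (en c), snd (en c)}"
  by (auto simp: att_def is_chord_def verts_def)

lemma bridge_sub: "D \<in> bridges V E en F \<Longrightarrow> D \<subseteq> E"
  by (auto elim!: bridge_cases simp: is_chord_def)

lemma bridge_disjoint: "D \<in> bridges V E en F \<Longrightarrow> D \<inter> F = {}"
proof (induction rule: bridge_cases)
  case (comp K)
  have False if "f \<in> F" "f \<in> D" for f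
  proof -
    have "fst (en f) \<in> verts en F" "snd (en f) \<in> verts en F" using that by (auto simp: verts_def)
    then show False using comp that comp_off(2)[OF comp(1)] by auto
  qed
  then show ?case by auto
qed (auto simp: is_chord_def)

text \<open>An edge with both ends on \<open>F\<close> is a chord, as loops are excluded; otherwise
  an end off \<open>F\<close> generates the component whose bridge contains the edge.\<close>

lemma edge_in_bridge:
  assumes "f \<in> E" "f \<notin> F"
  obtains D where "D \<in> bridges V E en F" "f \<in> D"
proof (cases "fst (en f) \<in> verts en F \<and> snd (en f) \<in> verts en F")
  case True
  then have "is_chord E en F f" using assms noloop by (auto simp: is_chord_def)
  then show ?thesis using that[of "{f}"] by (auto simp: bridges_def)
next
  case False
  then obtain x y where x: "joins en f x y" "x \<notin> verts en F"
    by (metis joins_ends joins_sym)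
  define K where "K = {y\<in>V - verts en F. (x, y) \<in> (adj en (off_edges E en F))\<^sup>*}"
  have xV: "x \<in> V" using inc assms x by blast
  have "is_component_off V E en F K" unfolding is_component_off_def K_def using x xV by blast
  moreover have "x \<in> K" using xV x unfolding K_def by auto
  ultimately have "{f \<in> E. fst (en f) \<in> K \<or> snd (en f) \<in> K} \<in> bridges V E en F"
      "f \<in> {f \<in> E. fst (en f) \<in> K \<or> snd (en f) \<in> K}"
    using assms x by (auto simp: bridges_def joins_def)
  then show ?thesis by (rule that)
qed

text \<open>A vertex off \<open>F\<close> determines its component and hence the only bridge in
  which it can occur.\<close>

lemma bridges_meet:
  assumes "D \<in> bridges V E en F" "D' \<in> bridges V E en F" "D \<noteq> D'"
  shows "verts en D \<inter> verts en D' \<subseteq> verts en F"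
proof -
  have *: "\<exists>K. is_component_off V E en F K \<and> D = {f \<in> E. fst (en f) \<in> K \<or> snd (en f) \<in> K} \<and> x \<in> K"
    if x: "x \<in> verts en D" "x \<notin> verts en F" "D \<in> bridges V E en F" for x D
    using x(3)
  proof (cases rule: bridge_cases)
    case (chord c)
    then show ?thesis using x by (auto simp: is_chord_def verts_def)
  next
    case (comp K)
    obtain g y where "g \<in> D" "joins en g x y" using in_vertsE[OF x(1)] .
    then have "x \<in> K" using comp(2) comp_closed[OF comp(1), of g y x] x(2) joins_sym
      unfolding joins_def by auto
    then show ?thesis using comp by auto
  qed
  have False if x: "x \<in> verts en D" "x \<in> verts en D'" "x \<notin> verts en F" for x
  proof -
    obtain K K' where K: "is_component_off V E en F K" "D = {f \<in> E. fst (en f) \<in> K \<or> snd (en f) \<in> K}" "x \<in> K"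
       and K': "is_component_off V E en F K'" "D' = {f \<in> E. fst (en f) \<in> K' \<or> snd (en f) \<in> K'}" "x \<in> K'"
      using *[OF x(1,3) assms(1)] *[OF x(2,3) assms(2)] by blast
    have "z \<in> V - verts en F \<Longrightarrow> (x, z) \<in> (adj en (off_edges E en F))\<^sup>* \<Longrightarrow> z \<in> K \<and> z \<in> K'" for z
      using K(1,3) K'(1,3) unfolding is_component_off_def by (auto intro: rtrancl_trans)
    then have "K = K'" using comp_reach[OF K(1) K(3)] comp_reach[OF K'(1) K'(3)] comp_off[OF K(1)] comp_off[OF K'(1)] by blast
    then show False using K K' assms(3) by auto
  qed
  then show ?thesis by auto
qed

text \<open>For a component, split the edges into \<open>D\<close> and the rest. All edges at a
  vertex of the component lie in \<open>D\<close>, so the two vertices that the parts share by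
  \<open>two_common_vertices\<close> are on \<open>F\<close>.\<close>

lemma bridge_two_att:
  assumes "F \<subseteq> E" "F \<noteq> {}" "D \<in> bridges V E en F"
  obtains x y where "x \<noteq> y" "x \<in> att en F D" "y \<in> att en F D"
  using assms(3)
proof (cases rule: bridge_cases)
  case (chord c)
  then have "fst (en c) \<noteq> snd (en c)" by (simp add: is_chord_def)
  then show ?thesis using that att_chord[OF chord(2)] chord by auto
next
  case (comp K)
  obtain k where k: "k \<in> K" using comp_off[OF comp(1)] by auto
  obtain g where g: "g \<in> F" using assms by auto
  have z: "fst (en g) \<in> verts en F" "fst (en g) \<in> V"
    using g in_vertsI[OF g joins_ends] verts_V assms by blast+
  \<comment> \<open>The bridge of an isolated vertex would have no edges; connectivity to
    \<open>F\<close> rules this out.\<close>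
  have "(k, fst (en g)) \<in> (adj en E)\<^sup>*" using connected z k comp_off[OF comp(1)] by blast
  moreover have "k \<noteq> fst (en g)" using z k comp_off[OF comp(1)] by blast
  ultimately obtain y where "(k, y) \<in> adj en E" by (meson converse_rtranclE)
  then have "D \<noteq> {}" using k comp(2) by (auto simp: adj_iff joins_def)
  moreover have "F \<subseteq> E - D" using bridge_disjoint[OF assms(3)] assms by auto
  ultimately obtain x y where xy: "x \<noteq> y" "x \<in> verts en D \<inter> verts en (E - D)" "y \<in> verts en D \<inter> verts en (E - D)"
    using two_common_vertices[of D "E - D"] bridge_sub[OF assms(3)] assms(2) by blast
  have "z \<in> att en F D" if zz: "z \<in> verts en D \<inter> verts en (E - D)" for z
  proof -
    obtain h w where h: "h \<in> D" "joins en h z w" using zz in_vertsE by (metis IntD1)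
    obtain h' w' where h': "h' \<in> E - D" "joins en h' z w'" using zz in_vertsE by (metis IntD2)
    have "z \<notin> K" using h' comp(2) by (auto simp: joins_def)
    then have "w \<in> K" using h comp(2) by (auto simp: joins_def)
    then have "z \<in> verts en F" using comp_closed[OF comp(1) _ joins_sym[OF h(2)]] \<open>z \<notin> K\<close> h comp(2) by auto
    then show ?thesis using zz by (auto simp: att_def)
  qed
  then show ?thesis using that xy by blast
qed

lemma bridge_path:
  assumes "D \<in> bridges V E en F" "x \<in> att en F D" "y \<in> att en F D" "x \<noteq> y"
  obtains P X where "pth en x P X y" "P \<subseteq> D" "X \<inter> verts en F = {x, y}"
  using assms(1)
proof (cases rule: bridge_cases)
  case (chord c)
  have xy: "{x, y} = {fst (en c), snd (en c)}" using assms att_chord[OF chord(2)] chord(1) by auto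
  then have "joins en c x y" by (auto simp: joins_def doubleton_eq_iff prod_eq_iff)
  then show ?thesis using that[OF pth_single[OF _ assms(4)]] chord assms(2,3) by (auto simp: att_def)
next
  case (comp K)
  obtain g k where g: "g \<in> E" "joins en g x k" "k \<in> K" using comp_att_edge[OF comp(1)] assms(2) comp(2) by metis
  obtain h l where h: "h \<in> E" "joins en h y l" "l \<in> K" using comp_att_edge[OF comp(1)] assms(3) comp(2) by metis
  obtain P X where P: "pth en k P X l" "X \<subseteq> K" "P \<subseteq> E" using comp_path[OF comp(1) g(3) h(3)] .
  have nK: "x \<notin> K" "y \<notin> K" "x \<in> verts en F" "y \<in> verts en F"
    using assms(2,3) comp_off[OF comp(1)] by (auto simp: att_def)
  have 1: "pth en x (insert g P) (insert x X) l" using pth.step[OF g(2) P(1)] P nK by auto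
  have 2: "pth en l {h} {l, y} y" using pth_single[OF joins_sym[OF h(2)]] h nK by auto
  have 3: "pth en x (insert g P \<union> {h}) (insert x X \<union> {l, y}) y"
    by (rule pth_append[OF 1 2]) (use P nK assms(4) in auto)
  have PD: "P \<subseteq> D"
  proof
    fix f assume "f \<in> P"
    then show "f \<in> D" using pth_edge_ends[OF P(1) _ joins_ends] P comp(2) by auto
  qed
  show ?thesis
  proof (rule that[OF 3])
    show "insert g P \<union> {h} \<subseteq> D" using PD g h comp(2) by (auto simp: joins_def)
    show "(insert x X \<union> {l, y}) \<inter> verts en F = {x, y}" using P(2) h(3) comp_off[OF comp(1)] nK by auto
  qed
qed

text \<open>Join \<open>x\<close> to \<open>z\<close> through the bridge, enter the component from
  \<open>y\<close>, and stop at the first vertex of that path; this vertex is the centre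
  \<open>k\<close>.\<close>

lemma bridge_tripod:
  assumes "D \<in> bridges V E en F" "x \<in> att en F D" "y \<in> att en F D" "z \<in> att en F D" "distinct [x, y, z]"
  obtains k A XA B XB G XG where "k \<notin> verts en F" "pth en x A XA k" "pth en y B XB k" "pth en z G XG k"
    "A \<union> B \<union> G \<subseteq> D" "XA \<inter> XB = {k}" "XA \<inter> XG = {k}" "XB \<inter> XG = {k}"
    "XA \<inter> verts en F = {x}" "XB \<inter> verts en F = {y}" "XG \<inter> verts en F = {z}"
  using assms(1)
proof (cases rule: bridge_cases)
  case (chord c)
  have "{x, y, z} \<subseteq> {fst (en c), snd (en c)}" using assms att_chord[OF chord(2)] chord(1) by auto
  then have False using assms(5) by auto
  then show ?thesis ..
next
  case (comp K)
  note off = comp_off[OF comp(1)]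
  obtain P X where P: "pth en x P X z" "P \<subseteq> D" "X \<inter> verts en F = {x, z}"
    using bridge_path[OF assms(1,2,4)] assms(5) by auto
  obtain g m where g: "g \<in> E" "joins en g y m" "m \<in> K" using comp_att_edge[OF comp(1)] assms(3) comp(2) by metis
  \<comment> \<open>Every edge of the bridge has an end in \<open>K\<close>, so the path from
    \<open>x\<close> to \<open>z\<close> passes through the component.\<close>
  have "\<exists>l. l \<in> X \<and> l \<in> K"
  proof -
    have "P \<noteq> {}" using pth_eq_iff[OF P(1)] assms(5) by auto
    then obtain f where f: "f \<in> P" by auto
    then have "fst (en f) \<in> X" "snd (en f) \<in> X" using pth_edge_ends[OF P(1) _ joins_ends] by auto
    moreover have "fst (en f) \<in> K \<or> snd (en f) \<in> K" using f P(2) comp(2) by auto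
    ultimately show ?thesis by auto
  qed
  then obtain l where l: "l \<in> X" "l \<in> K" by auto
  obtain N Y where N: "pth en m N Y l" "Y \<subseteq> K" "N \<subseteq> E" using comp_path[OF comp(1) g(3) l(2)] .
  have "Y \<inter> X \<noteq> {}" using l pth_ends[OF N(1)] by auto
  then obtain k N1 Y1 where k: "pth en m N1 Y1 k" "N1 \<subseteq> N" "Y1 \<subseteq> Y" "Y1 \<inter> X = {k}"
    using pth_first[OF N(1), of X] by (metis Un_upper1)
  have kX: "k \<in> X" "k \<in> K" using k N by auto
  have y: "y \<in> verts en F" "y \<notin> K" "y \<notin> X" "x \<in> verts en F" "z \<in> verts en F"
    using assms(2-5) off P(3) by (auto simp: att_def)
  have B: "pth en y (insert g N1) (insert y Y1) k" using pth.step[OF g(2) k(1)] k N y by auto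
  obtain P1 X1 P2 X2 where s: "pth en x P1 X1 k" "pth en k P2 X2 z" "P = P1 \<union> P2" "X = X1 \<union> X2" "X1 \<inter> X2 = {k}"
    using pth_split[OF P(1) kX(1)] .
  show ?thesis
  proof (rule that[OF _ s(1) B pth_rev[OF s(2)]])
    show "k \<notin> verts en F" using kX off by auto
    have "f \<in> D" if "f \<in> N1" for f
      using pth_edge_ends[OF k(1) that joins_ends] k N comp(2) that by auto
    then show "P1 \<union> insert g N1 \<union> P2 \<subseteq> D" using P(2) s(3) g comp(2) by (auto simp: joins_def)
    show "X1 \<inter> X2 = {k}" by fact
    show "X1 \<inter> insert y Y1 = {k}" "insert y Y1 \<inter> X2 = {k}"
      using k(4) s(4) y pth_ends[OF s(1)] pth_ends[OF s(2)] by auto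
    show "insert y Y1 \<inter> verts en F = {y}" using k N off y by auto
    have "k \<notin> verts en F" using kX off by auto
    then have "z \<notin> X1" "x \<notin> X2" using s(5) y(4,5) pth_ends[OF s(1)] pth_ends[OF s(2)] by (metis IntI singletonD)+
    moreover have "X1 \<inter> verts en F \<subseteq> {x, z}" "X2 \<inter> verts en F \<subseteq> {x, z}"
      unfolding P(3)[symmetric] s(4) by auto
    moreover have "x \<in> X1 \<inter> verts en F" "z \<in> X2 \<inter> verts en F"
      using pth_ends[OF s(1)] pth_ends[OF s(2)] y(4,5) by auto
    ultimately show "X1 \<inter> verts en F = {x}" "X2 \<inter> verts en F = {z}" by fast+
  qed
qed

text \<open>Once the path has left \<open>F\<close> along \<open>f\<close>, it stays in the bridge
  of \<open>f\<close> until its first return to \<open>F\<close>. The hypotheses repeat the pieces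
  of \<open>pth.step\<close>, so that the lemma applies after a case distinction on the first
  edge.\<close>

lemma bridge_exit:
  assumes "pth en u R X t" "R \<subseteq> E" "u \<in> verts en F" "t \<in> verts en F" "joins en f u v"
    "f \<in> E" "f \<notin> F" "X = insert u Y" "R = insert f S" "pth en v S Y t" "u \<notin> Y"
  obtains D x R1 X1 R2 X2 where "D \<in> bridges V E en F" "pth en u R1 X1 x" "pth en x R2 X2 t" "R = R1 \<union> R2"
    "X = X1 \<union> X2" "X1 \<inter> X2 = {x}" "X1 \<inter> verts en F = {u, x}" "R1 \<subseteq> D" "u \<noteq> x"
proof -
  obtain D where D: "D \<in> bridges V E en F" "f \<in> D" using edge_in_bridge[OF assms(6,7)] .
  have "Y \<inter> verts en F \<noteq> {}" using pth_ends[OF assms(10)] assms(4) by auto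
  then obtain x S1 Y1 S2 Y2 where s: "pth en v S1 Y1 x" "pth en x S2 Y2 t" "S = S1 \<union> S2" "Y = Y1 \<union> Y2"
      "Y1 \<inter> Y2 = {x}" "Y1 \<inter> verts en F = {x}"
    using pth_first[OF assms(10)] by metis
  have p: "pth en u (insert f S1) (insert u Y1) x" using pth.step[OF assms(5) s(1)] assms(11) s(4) by auto
  have SD: "S1 \<subseteq> D"
    using D(1)
  proof (cases rule: bridge_cases)
    case (chord c)
    then have "v \<in> verts en F" using D assms(5) by (auto simp: is_chord_def joins_def)
    then have "v = x" using s(6) pth_ends[OF s(1)] by auto
    then show ?thesis using pth_eq_iff[OF s(1)] by auto
  next
    case (comp K)
    have "u \<notin> K" using assms(3) comp_off[OF comp(1)] by auto
    then have v: "v \<in> K" using comp(2) D(2) assms(5) by (auto simp: joins_def)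
    have "S1 \<subseteq> E" using assms(2,9) s(3) by blast
    from comp_initial(2)[OF comp(1) s(1) v s(6) this] show ?thesis using comp(2) by simp
  qed
  show ?thesis
  proof (rule that[OF D(1) p s(2)])
    show "R = insert f S1 \<union> S2" "X = insert u Y1 \<union> Y2" using assms(8,9) s by auto
    show "insert u Y1 \<inter> Y2 = {x}" using s assms(11) by auto
    show "insert u Y1 \<inter> verts en F = {u, x}" using s(6) assms(3) by auto
    show "insert f S1 \<subseteq> D" using SD D by auto
    show "u \<noteq> x" using assms(11) s(4) pth_ends[OF s(1)] by auto
  qed
qed

end

section \<open>Balance of a block from the circles through one edge\<close>

text \<open>A switching function that witnesses the balance of \<open>F\<close>. Unlike in
  \<open>balancing_edge\<close>, the values are 1 or -1 on the whole type, so that membership in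
  \<open>V\<close> need not be carried along.\<close>

definition good_edges :: "('e \<Rightarrow> 'v \<times> 'v) \<Rightarrow> ('e \<Rightarrow> int) \<Rightarrow> ('v \<Rightarrow> int) \<Rightarrow> 'e set \<Rightarrow> bool" where
  "good_edges en \<sigma> \<zeta> F \<longleftrightarrow> (\<forall>v. \<zeta> v = 1 \<or> \<zeta> v = -1) \<and> (\<forall>f\<in>F. \<zeta> (fst (en f)) * \<sigma> f * \<zeta> (snd (en f)) = 1)"

lemma joins_components:
  "joins en f u v \<Longrightarrow> fst (en f) = u \<and> snd (en f) = v \<or> fst (en f) = v \<and> snd (en f) = u"
  by (auto simp: joins_def)

lemma good_edges_mono: "good_edges en \<sigma> \<zeta> F \<Longrightarrow> P \<subseteq> F \<Longrightarrow> good_edges en \<sigma> \<zeta> P"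
  by (auto simp: good_edges_def)

lemma good_edges_joins:
  assumes "good_edges en \<sigma> \<zeta> F" "f \<in> F" "joins en f u v"
  shows "\<sigma> f = \<zeta> u * \<zeta> v"
proof -
  have "\<zeta> u * \<sigma> f * \<zeta> v = 1" using assms by (auto simp: good_edges_def joins_def mult.commute mult.left_commute)
  moreover have "\<zeta> u = 1 \<or> \<zeta> u = -1" "\<zeta> v = 1 \<or> \<zeta> v = -1" using assms by (auto simp: good_edges_def)
  ultimately show ?thesis by auto
qed

lemma sgn_of_insert: "finite P \<Longrightarrow> f \<notin> P \<Longrightarrow> sgn_of \<sigma> (insert f P) = \<sigma> f * sgn_of \<sigma> P"
  by (simp add: sgn_of_def)

lemma sgn_of_Un: "finite P \<Longrightarrow> finite Q \<Longrightarrow> P \<inter> Q = {} \<Longrightarrow> sgn_of \<sigma> (P \<union> Q) = sgn_of \<sigma> P * sgn_of \<sigma> Q"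
  by (simp add: sgn_of_def prod.union_disjoint)

lemma sgn_of_unit: "(\<And>f. f \<in> S \<Longrightarrow> \<sigma> f = 1 \<or> \<sigma> f = -1) \<Longrightarrow> sgn_of \<sigma> S = 1 \<or> sgn_of \<sigma> S = (-1::int)"
proof (induction S rule: infinite_finite_induct)
  case (insert f S)
  then have "\<sigma> f = 1 \<or> \<sigma> f = -1" by blast
  moreover have "sgn_of \<sigma> S = 1 \<or> sgn_of \<sigma> S = -1" using insert by blast
  ultimately show ?case using insert(1,2) by (auto simp: sgn_of_insert)
qed (auto simp: sgn_of_def)

lemma pth_step_notin: "joins en f u v \<Longrightarrow> pth en v P X w \<Longrightarrow> u \<notin> X \<Longrightarrow> f \<notin> P"
  using pth_edge_ends by metis

text \<open>The product telescopes: the values of \<zeta> at inner vertices occur twice.\<close>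

lemma pth_sgn:
  assumes "pth en u P X w" "good_edges en \<sigma> \<zeta> P"
  shows "sgn_of \<sigma> P = \<zeta> u * \<zeta> w"
  using assms
proof (induction rule: pth.induct)
  case (nil u)
  have "\<zeta> u = 1 \<or> \<zeta> u = -1" using nil by (auto simp: good_edges_def)
  then show ?case by (auto simp: sgn_of_def)
next
  case (step f u v P X w)
  have "good_edges en \<sigma> \<zeta> P" using step by (auto simp: good_edges_def)
  moreover have "\<sigma> f = \<zeta> u * \<zeta> v" using good_edges_joins[OF step.prems _ step(1)] by auto
  moreover have "finite P" "f \<notin> P" using pth_finite[OF step(2)] pth_step_notin[OF step(1-3)] by auto
  moreover have "\<zeta> v = 1 \<or> \<zeta> v = -1" using step by (auto simp: good_edges_def)
  ultimately show ?case using step.IH by (auto simp: sgn_of_insert)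
qed

text \<open>Starting from the prescribed value at \<open>w\<close>, each edge forces the value at
  the vertex before it. The value at \<open>u\<close> is an outcome of this and has to be compared
  with \<zeta> by other means.\<close>

lemma pth_switch:
  assumes "pth en u P X w" "\<And>v. \<zeta> v = 1 \<or> \<zeta> v = (-1::int)" "\<And>f. f \<in> P \<Longrightarrow> \<sigma> f = 1 \<or> \<sigma> f = -1"
  obtains \<zeta>' where "good_edges en \<sigma> \<zeta>' P" "\<And>v. v \<notin> X \<or> v = w \<Longrightarrow> \<zeta>' v = \<zeta> v"
proof -
  from assms have "\<exists>\<zeta>'. good_edges en \<sigma> \<zeta>' P \<and> (\<forall>v. v \<notin> X \<or> v = w \<longrightarrow> \<zeta>' v = \<zeta> v)"
  proof (induction rule: pth.induct)
    case (nil u)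
    then show ?case by (intro exI[of _ \<zeta>]) (auto simp: good_edges_def)
  next
    case (step f u v P X w)
    then obtain \<zeta>' where z: "good_edges en \<sigma> \<zeta>' P" "\<forall>v. v \<notin> X \<or> v = w \<longrightarrow> \<zeta>' v = \<zeta> v" by blast
    let ?z = "\<zeta>'(u := \<sigma> f * \<zeta>' v)"
    have uv: "u \<noteq> v" "u \<noteq> w" using step(3) pth_ends[OF step(2)] by auto
    have pm: "\<zeta>' x = 1 \<or> \<zeta>' x = -1" for x using z(1) by (auto simp: good_edges_def)
    have sf: "\<sigma> f = 1 \<or> \<sigma> f = -1" using step by auto
    have "good_edges en \<sigma> ?z (insert f P)"
      unfolding good_edges_def
    proof (intro conjI allI ballI)
      fix x show "?z x = 1 \<or> ?z x = -1" using pm[of x] pm[of v] sf by auto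
    next
      fix g assume g: "g \<in> insert f P"
      show "?z (fst (en g)) * \<sigma> g * ?z (snd (en g)) = 1"
      proof (cases "g = f")
        case True
        then show ?thesis using joins_components[OF step(1)] uv pm[of v] sf by auto
      next
        case False
        then have "g \<in> P" using g by auto
        then have "fst (en g) \<noteq> u" "snd (en g) \<noteq> u" using pth_edge_ends[OF step(2) _ joins_ends] step(3) by auto
        then show ?thesis using z(1) \<open>g \<in> P\<close> by (auto simp: good_edges_def)
      qed
    qed
    moreover have "\<forall>x. x \<notin> insert u X \<or> x = w \<longrightarrow> ?z x = \<zeta> x" using z(2) uv by auto
    ultimately show ?case by blast
  qed
  then show ?thesis using that by blast
qed

section \<open>Subgraphs grown from a root edge by ears\<close>

locale rooted_block = block V E en for V :: "'v set" and E :: "'e set" and en :: "'e \<Rightarrow> 'v \<times> 'v" +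
  fixes e :: 'e and s t :: 'v
  assumes eE: "e \<in> E" and st: "joins en e s t"
begin

text \<open>
  \<open>link F x y\<close> says that every path from \<open>x\<close> to \<open>y\<close> that meets \<open>F\<close> only in its ends
  closes up to a circle through \<open>e\<close>. This is what survives the attachment of an ear.
\<close>

definition link :: "'e set \<Rightarrow> 'v \<Rightarrow> 'v \<Rightarrow> bool" where
  "link F x y \<longleftrightarrow> (\<exists>P X Q Y. P \<union> Q \<subseteq> F - {e} \<and> X \<inter> Y = {} \<and> pth en s P X x \<and> pth en y Q Y t)"

text \<open>The two disjoint arms ending in \<open>p\<close> and \<open>q\<close> lie in
  \<open>F\<close>, and the legs \<open>A\<close> and \<open>B\<close> leave \<open>F\<close>
  immediately, so arms and legs meet only in \<open>p\<close> and \<open>q\<close>.\<close>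

lemma link_extend:
  assumes "link F p q" "pth en p A X x" "pth en q B Y y" "X \<inter> verts en F = {p}" "Y \<inter> verts en F = {q}"
    "X \<inter> Y = {}" "A \<union> B \<subseteq> G - {e}" "F \<subseteq> G" "e \<in> F"
  shows "link G x y"
proof -
  obtain P XP Q XQ where l: "P \<union> Q \<subseteq> F - {e}" "XP \<inter> XQ = {}" "pth en s P XP p" "pth en q Q XQ t"
    using assms(1) unfolding link_def by blast
  have stF: "s \<in> verts en F" "t \<in> verts en F" using in_vertsI assms(9) st joins_sym by metis+
  have PF: "P \<subseteq> F" "Q \<subseteq> F" using l(1) by auto
  have XF: "XP \<subseteq> verts en F" "XQ \<subseteq> verts en F"
    using pth_vset[OF l(3)] pth_vset[OF pth_rev[OF l(4)]] stF verts_mono[OF PF(1), of en] verts_mono[OF PF(2), of en] by auto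
  have pq: "p \<in> XP" "q \<in> XQ" using pth_ends[OF l(3)] pth_ends[OF l(4)] by auto
  have i: "XP \<inter> X \<subseteq> {p}" "XQ \<inter> Y \<subseteq> {q}" "XP \<inter> Y \<subseteq> {q}" "XQ \<inter> X \<subseteq> {p}" using XF assms(4,5) by blast+
  have 1: "pth en s (P \<union> A) (XP \<union> X) x" using pth_append[OF l(3) assms(2) i(1)] .
  have 2: "pth en y (B \<union> Q) (Y \<union> XQ) t" using pth_append[OF pth_rev[OF assms(3)] l(4)] i(2) by blast
  have "(XP \<union> X) \<inter> (Y \<union> XQ) = {}" using i(3,4) l(2) pq assms(6) by blast
  moreover have "P \<union> A \<union> (B \<union> Q) \<subseteq> G - {e}" using l(1) assms(7,8) by blast
  ultimately show ?thesis unfolding link_def using 1 2 by blast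
qed

text \<open>Which of two vertices is reached from \<open>s\<close> and which from \<open>t\<close>
  cannot be prescribed, hence the disjunction.\<close>

definition linked :: "'e set \<Rightarrow> bool" where
  "linked F \<longleftrightarrow> (\<forall>x\<in>verts en F. \<forall>y\<in>verts en F. x \<noteq> y \<longrightarrow> link F x y \<or> link F y x)"

text \<open>For each pair of vertices two disjoint legs lead back to two distinct vertices of
  \<open>F\<close>, which are linked by assumption: a vertex of \<open>F\<close> has a leg of length
  0, and an inner vertex of the ear uses the piece of the ear up to \<open>p\<close> or
  \<open>q\<close>.\<close>

lemma linked_ear:
  assumes "linked F" "e \<in> F" "pth en p Q Y q" "Y \<inter> verts en F = {p, q}" "Q \<inter> F = {}" "p \<noteq> q"
  shows "linked (F \<union> Q)"
proof -
  have eQ: "e \<notin> Q" using assms by auto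
  have ext: "link (F \<union> Q) x y \<or> link (F \<union> Q) y x"
    if h: "a \<in> verts en F" "b \<in> verts en F" "pth en a A X x" "pth en b B Z y" "A \<union> B \<subseteq> Q"
      "X \<inter> verts en F = {a}" "Z \<inter> verts en F = {b}" "X \<inter> Z = {}" for a b A X x B Z y
  proof -
    have "a \<noteq> b" using h by auto
    then have "link F a b \<or> link F b a" using assms(1) h(1,2) by (auto simp: linked_def)
    moreover have "A \<union> B \<subseteq> F \<union> Q - {e}" "B \<union> A \<subseteq> F \<union> Q - {e}" using eQ h(5) by auto
    ultimately show ?thesis
      using link_extend[OF _ h(3,4,6,7,8), of "F \<union> Q"] link_extend[OF _ h(4,3,7,6), of "F \<union> Q"] h(8) assms(2)
      by blast
  qed
  have leg: "\<exists>A X. pth en r A X y \<and> A \<subseteq> Q \<and> X \<inter> verts en F = {r} \<and> X \<subseteq> Y"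
    if h: "r = p \<or> r = q" "y \<in> Y" "y \<notin> verts en F" for r y
  proof -
    obtain Q1 Y1 Q2 Y2 where sp: "pth en p Q1 Y1 y" "pth en y Q2 Y2 q" "Q = Q1 \<union> Q2" "Y = Y1 \<union> Y2" "Y1 \<inter> Y2 = {y}"
      using pth_split[OF assms(3) h(2)] .
    have pq: "p \<in> Y1" "q \<in> Y2" "p \<in> verts en F" "q \<in> verts en F" using pth_ends[OF sp(1)] pth_ends[OF sp(2)] assms(4) by auto
    have n: "q \<notin> Y1" "p \<notin> Y2" using pq sp(5) h(3) by (metis IntI singletonD)+
    have "Y1 \<inter> verts en F = {p}"
    proof -
      have "Y1 \<inter> verts en F \<subseteq> {p, q}" unfolding assms(4)[symmetric] sp(4) by auto
      then show ?thesis using n pq by fast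
    qed
    moreover have "Y2 \<inter> verts en F = {q}"
    proof -
      have "Y2 \<inter> verts en F \<subseteq> {p, q}" unfolding assms(4)[symmetric] sp(4) by auto
      then show ?thesis using n pq by fast
    qed
    ultimately show ?thesis using h(1) sp(1) pth_rev[OF sp(2)] sp(3,4) by blast
  qed
  have mixed: "link (F \<union> Q) x y \<or> link (F \<union> Q) y x" if h: "x \<in> verts en F" "y \<in> Y" "y \<notin> verts en F" for x y
  proof -
    \<comment> \<open>The leg of \<open>y\<close> goes to an end of the ear other than
      \<open>x\<close>, which keeps it disjoint from the trivial leg at \<open>x\<close>.\<close>
    obtain r where r: "r = p \<or> r = q" "r \<noteq> x" using assms(6) by blast
    obtain A X where A: "pth en r A X y" "A \<subseteq> Q" "X \<inter> verts en F = {r}" using leg[OF r(1) h(2,3)] by blast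
    have rF: "r \<in> verts en F" using A(3) by auto
    have "x \<notin> X" using A(3) h(1) r(2) by auto
    then show ?thesis using ext[OF h(1) rF pth.nil A(1)] A h(1) by auto
  qed
  have both: "link (F \<union> Q) x y \<or> link (F \<union> Q) y x"
    if h: "x \<in> Y" "y \<in> Y" "x \<notin> verts en F" "y \<notin> verts en F" "x \<noteq> y" for x y
  proof -
    obtain Q1 Y1 Q2 Y2 where sp: "pth en p Q1 Y1 x" "pth en x Q2 Y2 q" "Q = Q1 \<union> Q2" "Y = Y1 \<union> Y2" "Y1 \<inter> Y2 = {x}"
      using pth_split[OF assms(3) h(1)] .
    have pqF: "p \<in> verts en F" "q \<in> verts en F" using assms(4) by auto
    have pq: "p \<in> Y1" "q \<in> Y2" using pth_ends[OF sp(1)] pth_ends[OF sp(2)] by auto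
    have n: "q \<notin> Y1" "p \<notin> Y2" using pq sp(5) h(3) pqF by (metis IntI singletonD)+
    have sub: "Y1 \<inter> verts en F \<subseteq> {p, q}" "Y2 \<inter> verts en F \<subseteq> {p, q}" unfolding assms(4)[symmetric] sp(4) by auto
    then have Y12: "Y1 \<inter> verts en F = {p}" "Y2 \<inter> verts en F = {q}" using n pq pqF by fast+
    \<comment> \<open>The order of \<open>x\<close> and \<open>y\<close> along the ear decides which
      outer pieces serve as legs; the piece between them is dropped.\<close>
    show ?thesis
    proof (cases "y \<in> Y2")
      case True
      obtain R1 Z1 R2 Z2 where sq: "pth en x R1 Z1 y" "pth en y R2 Z2 q" "Q2 = R1 \<union> R2" "Y2 = Z1 \<union> Z2" "Z1 \<inter> Z2 = {y}"
        using pth_split[OF sp(2) True] .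
      have "x \<notin> Z2" using sq(5) h(5) pth_ends[OF sq(1)] by (metis IntI singletonD)
      then have d: "Y1 \<inter> Z2 = {}" using sp(5) sq(4) by fastforce
      have "Z2 \<inter> verts en F = {q}" using sq(4) Y12(2) pth_ends[OF sq(2)] pqF(2) by fast
      from ext[OF pqF sp(1) pth_rev[OF sq(2)] _ Y12(1) this d] show ?thesis using sp(3) sq(3) by blast
    next
      case False
      then have "y \<in> Y1" using h sp by auto
      then obtain R1 Z1 R2 Z2 where sq: "pth en p R1 Z1 y" "pth en y R2 Z2 x" "Q1 = R1 \<union> R2" "Y1 = Z1 \<union> Z2" "Z1 \<inter> Z2 = {y}"
        using pth_split[OF sp(1)] by metis
      have "x \<notin> Z1" using sq(5) h(5) pth_ends[OF sq(2)] by (metis IntI singletonD)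
      then have d: "Z1 \<inter> Y2 = {}" using sp(5) sq(4) by fastforce
      have "Z1 \<inter> verts en F = {p}" using sq(4) Y12(1) pth_ends[OF sq(1)] pqF(1) by fast
      from ext[OF pqF sq(1) pth_rev[OF sp(2)] _ this Y12(2) d] show ?thesis using sp(3) sq(3) by blast
    qed
  qed
  have old: "link (F \<union> Q) x y \<or> link (F \<union> Q) y x" if "x \<in> verts en F" "y \<in> verts en F" "x \<noteq> y" for x y
    using ext[OF that(1,2) pth.nil pth.nil] that by auto
  have vs: "verts en (F \<union> Q) = verts en F \<union> Y" using pth_verts[OF assms(3,6)] by (simp add: verts_Un)
  show ?thesis unfolding linked_def vs
  proof (intro ballI impI)
    fix x y assume "x \<in> verts en F \<union> Y" "y \<in> verts en F \<union> Y" "x \<noteq> y"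
    then show "link (F \<union> Q) x y \<or> link (F \<union> Q) y x"
      using old mixed both by (cases "x \<in> verts en F"; cases "y \<in> verts en F") blast+
  qed
qed

lemma linked_root: "linked {e}"
proof -
  have "verts en {e} = {s, t}" using verts_insert[OF st, of "{}"] by simp
  moreover have "link {e} s t"
    unfolding link_def using pth.nil[of en s] pth.nil[of en t] joins_neq[OF eE st]
    by (intro exI[of _ "{}"] exI[of _ "{s}"] exI[of _ "{t}"]) auto
  ultimately show ?thesis unfolding linked_def by auto
qed

lemma circle_of_link:
  assumes "pth en s P X x" "pth en y Q Y t" "pth en x R Z y" "P \<union> Q \<union> R \<subseteq> E - {e}"
    "X \<inter> Z \<subseteq> {x}" "Z \<inter> Y \<subseteq> {y}" "X \<inter> Y = {}"
  shows "is_circle en E (insert e (P \<union> R \<union> Q))" "e \<notin> P \<union> R \<union> Q"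
proof -
  have "pth en s (P \<union> R) (X \<union> Z) y" using pth_append[OF assms(1,3,5)] .
  then have "pth en s (P \<union> R \<union> Q) (X \<union> Z \<union> Y) t" using pth_append assms(2,6,7) by (metis Int_Un_distrib2 Un_empty_left)
  then show "is_circle en E (insert e (P \<union> R \<union> Q))"
    using is_circle_if_pth[OF _ joins_neq[OF eE st] st] assms(4) eE by (metis Diff_iff Un_assoc Un_commute insert_subset singletonI subset_Diff_insert subset_iff)
  show "e \<notin> P \<union> R \<union> Q" using assms(4) by auto
qed

text \<open>A largest balanced linked subgraph containing \<open>e\<close> is all of
  \<open>E\<close>: otherwise some bridge contains an ear, the link between its ends closes it to a
  circle through \<open>e\<close>, and positivity of that circle lets the switching function extend
  over the ear.\<close>

lemma balanced_if_root_circles_positive: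
  assumes sig: "\<And>f. f \<in> E \<Longrightarrow> \<sigma> f = 1 \<or> \<sigma> f = -1"
    and pos: "\<And>Z. is_circle en E Z \<Longrightarrow> e \<in> Z \<Longrightarrow> sgn_of \<sigma> Z = 1"
  obtains \<zeta> where "good_edges en \<sigma> \<zeta> E"
proof -
  let ?ok = "\<lambda>F. F \<subseteq> E \<and> e \<in> F \<and> linked F \<and> (\<exists>\<zeta>. good_edges en \<sigma> \<zeta> F)"
  have "?ok {e}"
  proof -
    \<comment> \<open>Switching one end of \<open>e\<close> by the sign of \<open>e\<close> makes
      \<open>e\<close> positive.\<close>
    have "good_edges en \<sigma> (\<lambda>v. if v = s then \<sigma> e else 1) {e}"
      using sig[OF eE] joins_components[OF st] joins_neq[OF eE st] by (auto simp: good_edges_def)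
    then show ?thesis using linked_root eE by blast
  qed
  moreover have "\<forall>F. ?ok F \<longrightarrow> card F < Suc (card E)" using card_mono[OF fin] by (simp add: le_imp_less_Suc)
  ultimately obtain F where F: "?ok F" and mx: "\<And>G. ?ok G \<Longrightarrow> card G \<le> card F"
    using ex_has_greatest_nat[of ?ok "{e}" card "Suc (card E)"] by blast
  have "F = E"
  proof (rule ccontr)
    assume "F \<noteq> E"
    then obtain f where f: "f \<in> E" "f \<notin> F" using F by auto
    obtain D where D: "D \<in> bridges V E en F" using edge_in_bridge[OF f] by blast
    obtain p q where pq: "p \<noteq> q" "p \<in> att en F D" "q \<in> att en F D" using bridge_two_att[OF _ _ D] F by blast
    obtain Q Y where Q: "pth en p Q Y q" "Q \<subseteq> D" "Y \<inter> verts en F = {p, q}" using bridge_path[OF D pq(2,3,1)] .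
    have QF: "Q \<inter> F = {}" "Q \<subseteq> E" using bridge_disjoint[OF D] bridge_sub[OF D] Q(2) by auto
    obtain \<zeta> where z: "good_edges en \<sigma> \<zeta> F" using F by blast
    have pm: "\<And>v. \<zeta> v = 1 \<or> \<zeta> v = -1" using z by (auto simp: good_edges_def)
    have sQ: "sgn_of \<sigma> Q = \<zeta> p * \<zeta> q"
    proof -
      \<comment> \<open>Stated for an ordered pair because \<open>link\<close> is directed; the ear
        can be traversed either way.\<close>
      have main: "sgn_of \<sigma> Q = \<zeta> a * \<zeta> b" if h: "link F a b" "pth en a Q Y b" "Y \<inter> verts en F = {a, b}" for a b
      proof -
        obtain P X P' X' where l: "P \<union> P' \<subseteq> F - {e}" "X \<inter> X' = {}" "pth en s P X a" "pth en b P' X' t"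
          using h(1) unfolding link_def by blast
        have PF: "P \<subseteq> F" "P' \<subseteq> F" using l(1) by auto
        have stF: "s \<in> verts en F" "t \<in> verts en F" using in_vertsI F st joins_sym by metis+
        have XF: "X \<subseteq> verts en F" "X' \<subseteq> verts en F"
          using pth_vset[OF l(3)] pth_vset[OF pth_rev[OF l(4)]] stF verts_mono[OF PF(1), of en] verts_mono[OF PF(2), of en] by auto
        have ab: "a \<in> X" "b \<in> X'" using pth_ends[OF l(3)] pth_ends[OF l(4)] by auto
        have "b \<notin> X" "a \<notin> X'" using ab l(2) by auto
        moreover have "Y \<inter> verts en F \<subseteq> {a, b}" using h(3) by simp
        ultimately have i: "X \<inter> Y \<subseteq> {a}" "Y \<inter> X' \<subseteq> {b}" using XF by blast+
        have sub: "P \<union> P' \<union> Q \<subseteq> E - {e}" using l(1) QF F by blast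
        note c = circle_of_link[OF l(3,4) h(2) sub i l(2)]
        have fn: "finite P" "finite P'" "finite Q" using pth_finite[OF l(3)] pth_finite[OF l(4)] pth_finite[OF Q(1)] by auto
        have dj: "P \<inter> Q = {}" "(P \<union> Q) \<inter> P' = {}" using PF QF(1) pth_disjoint[OF l(3,4), of s] l(2) by auto
        have "\<sigma> e * (sgn_of \<sigma> P * sgn_of \<sigma> Q * sgn_of \<sigma> P') = 1"
          using pos[OF c(1)] c(2) fn dj by (simp add: sgn_of_insert sgn_of_Un)
        moreover have "sgn_of \<sigma> P = \<zeta> s * \<zeta> a" "sgn_of \<sigma> P' = \<zeta> b * \<zeta> t"
          using pth_sgn[OF l(3) good_edges_mono[OF z PF(1)]] pth_sgn[OF l(4) good_edges_mono[OF z PF(2)]] by auto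
        moreover have "\<sigma> e = \<zeta> s * \<zeta> t" using good_edges_joins[OF z _ st] F by blast
        ultimately show ?thesis using pm[of s] pm[of t] pm[of a] pm[of b] by auto
      qed
      have "link F p q \<or> link F q p" using F pq by (auto simp: linked_def att_def)
      then show ?thesis using main[of p q] main[of q p] Q(1,3) pth_rev[OF Q(1)] by (auto simp: insert_commute mult.commute)
    qed
    \<comment> \<open>\<open>pth_switch\<close> preserves the value at \<open>q\<close> but not at
      \<open>p\<close>. The sign of the ear computed in \<open>sQ\<close> makes the value at
      \<open>p\<close> agree as well, so nothing changes on \<open>F\<close>.\<close>
    obtain \<zeta>' where z': "good_edges en \<sigma> \<zeta>' Q" "\<And>v. v \<notin> Y \<or> v = q \<Longrightarrow> \<zeta>' v = \<zeta> v"
      using pth_switch[OF Q(1), of \<zeta> \<sigma>] pm sig QF(2) by blast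
    have "sgn_of \<sigma> Q = \<zeta>' p * \<zeta>' q" using pth_sgn[OF Q(1) z'(1)] .
    then have "\<zeta>' p = \<zeta> p" using sQ z'(2)[of q] pm[of q] by auto
    moreover have "v = p \<or> v = q \<or> v \<notin> Y" if "v \<in> verts en F" for v using Q(3) that by auto
    ultimately have agree: "\<zeta>' v = \<zeta> v" if "v \<in> verts en F" for v using z'(2)[of v] that by auto
    have "good_edges en \<sigma> \<zeta>' F"
      unfolding good_edges_def
    proof (intro conjI ballI)
      show "\<forall>v. \<zeta>' v = 1 \<or> \<zeta>' v = - 1" using z'(1) by (auto simp: good_edges_def)
      fix g assume g: "g \<in> F"
      then have "fst (en g) \<in> verts en F" "snd (en g) \<in> verts en F" by (auto simp: verts_def)
      then show "\<zeta>' (fst (en g)) * \<sigma> g * \<zeta>' (snd (en g)) = 1" using agree z g by (auto simp: good_edges_def)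
    qed
    then have "good_edges en \<sigma> \<zeta>' (F \<union> Q)" using z'(1) by (auto simp: good_edges_def)
    moreover have "linked (F \<union> Q)" using linked_ear[OF _ _ Q(1,3) QF(1) pq(1)] F by blast
    ultimately have "card (F \<union> Q) \<le> card F" using mx[of "F \<union> Q"] F QF(2) by blast
    moreover have "Q \<noteq> {}" using pth_eq_iff[OF Q(1)] pq(1) by auto
    moreover have "finite F" "finite Q" using F QF(2) fin finite_subset by blast+
    ultimately show False using QF(1) by (simp add: card_Un_disjoint Int_commute card_eq_0_iff)
  qed
  then show ?thesis using F that by blast
qed

end

section \<open>A circle as an edge closing a numbered path\<close>

lemma pth_enumerate:
  assumes "pth en u P X w"
  obtains vt ed n where "vt 0 = u" "vt n = w" "inj_on vt {..n}"
    "\<And>i. i < n \<Longrightarrow> joins en (ed i) (vt i) (vt (Suc i))" "P = ed ` {..<n}" "X = vt ` {..n}"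
proof -
  from assms have "\<exists>vt ed n. vt 0 = u \<and> vt n = w \<and> inj_on vt {..n} \<and>
    (\<forall>i<n. joins en (ed i) (vt i) (vt (Suc i))) \<and> P = ed ` {..<n} \<and> X = vt ` {..n}"
  proof (induction rule: pth.induct)
    case (nil u)
    show ?case by (intro exI[of _ "\<lambda>_. u"] exI[of _ "\<lambda>_. undefined"] exI[of _ 0]) auto
  next
    case (step f u v P X w)
    then obtain vt ed n where h: "vt 0 = v" "vt n = w" "inj_on vt {..n}"
      "\<forall>i<n. joins en (ed i) (vt i) (vt (Suc i))" "P = ed ` {..<n}" "X = vt ` {..n}" by blast
    let ?vt = "case_nat u vt" and ?ed = "case_nat f ed"
    have "inj_on ?vt {..Suc n}"
      using h(3,6) step(3) unfolding inj_on_def by (auto split: nat.splits)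
    moreover have "\<forall>i<Suc n. joins en (?ed i) (?vt i) (?vt (Suc i))"
      using step(1) h by (auto split: nat.splits)
    moreover have "insert f P = ?ed ` {..<Suc n}"
      unfolding lessThan_Suc_eq_insert_0 h(5) by (simp add: image_image)
    moreover have "insert u X = ?vt ` {..Suc n}"
      unfolding atMost_Suc_eq_insert_0 h(6) by (simp add: image_image)
    ultimately show ?case using h(2) by (intro exI[of _ ?vt] exI[of _ ?ed] exI[of _ "Suc n"]) auto
  qed
  then show ?thesis using that by blast
qed

text \<open>The ends are the only vertices of degree 1.\<close>

lemma is_path_ends_unique:
  assumes "is_path en Q x y" "is_path en Q x' y'"
  shows "{x, y} = {x', y'}"
proof -
  have "x' \<in> {x, y}" "y' \<in> {x, y}" "x' \<noteq> y'"
    using assms unfolding is_path_def by (metis Diff_iff numeral_eq_one_iff semiring_norm(85))+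
  then show ?thesis by auto
qed

text \<open>\<open>C_neq\<close> carries the assumption that the block is not a circle; it
  guarantees a bridge, so that a smallest and a largest interval exist.\<close>

locale circle_frame = block V E en for V :: "'v set" and E :: "'e set" and en :: "'e \<Rightarrow> 'v \<times> 'v" +
  fixes e :: 'e and vt :: "nat \<Rightarrow> 'v" and ed :: "nat \<Rightarrow> 'e" and n :: nat and C :: "'e set"
  assumes n_pos: "0 < n" and inj_vt: "inj_on vt {..n}"
    and ed_joins: "\<And>i. i < n \<Longrightarrow> joins en (ed i) (vt i) (vt (Suc i))"
    and e_joins: "joins en e (vt 0) (vt n)"
    and e_new: "e \<notin> ed ` {..<n}"
    and C_eq: "C = insert e (ed ` {..<n})"
    and C_sub: "C \<subseteq> E" and C_neq: "C \<noteq> E"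
begin

lemma e_in_E: "e \<in> E" using C_sub C_eq by auto

sublocale rooted_block V E en e "vt 0" "vt n"
  by unfold_locales (fact e_in_E, fact e_joins)

lemma vt_eq [simp]: "i \<le> n \<Longrightarrow> j \<le> n \<Longrightarrow> vt i = vt j \<longleftrightarrow> i = j"
  using inj_vt by (auto simp: inj_on_def)

lemma vt_mem: "k \<le> n \<Longrightarrow> K \<subseteq> {..n} \<Longrightarrow> vt k \<in> vt ` K \<longleftrightarrow> k \<in> K"
  using inj_vt inj_on_image_mem_iff[of vt "{..n}" k K] by auto

lemma ed_eq: "i < n \<Longrightarrow> j < n \<Longrightarrow> ed i = ed j \<Longrightarrow> i = j"
  using joins_unique[OF ed_joins[of i], of "vt j" "vt (Suc j)"] ed_joins[of j] by auto

section \<open>The arcs of \<open>C\<close>\<close>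

definition seg :: "nat \<Rightarrow> nat \<Rightarrow> 'e set" where "seg i j = ed ` {i..<j}"

text \<open>The complement in \<open>C\<close> of \<open>seg i j\<close>: for \<open>i < j\<close>
  the arc between the positions \<open>i\<close> and \<open>j\<close> that runs through
  \<open>e\<close>.\<close>

definition cseg :: "nat \<Rightarrow> nat \<Rightarrow> 'e set" where "cseg i j = insert e (seg 0 i \<union> seg j n)"

lemma seg_sub: "j \<le> n \<Longrightarrow> seg i j \<subseteq> C"
  by (auto simp: seg_def C_eq)

lemma e_notin_seg: "j \<le> n \<Longrightarrow> e \<notin> seg i j"
  using e_new by (auto simp: seg_def)

lemma seg_split: "i \<le> j \<Longrightarrow> j \<le> k \<Longrightarrow> seg i k = seg i j \<union> seg j k"
  unfolding seg_def image_Un[symmetric] by (simp add: ivl_disj_un)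

lemma seg_disjoint: "j \<le> k \<Longrightarrow> l \<le> n \<Longrightarrow> seg i j \<inter> seg k l = {}"
proof -
  assume a: "j \<le> k" "l \<le> n"
  have "ed x \<noteq> ed y" if "x < j" "k \<le> y" "y < l" for x y
    using ed_eq[of x y] that a by auto
  then show ?thesis unfolding seg_def by fastforce
qed

lemma seg_Suc: "i < j \<Longrightarrow> seg i j = insert (ed i) (seg (Suc i) j)"
proof -
  assume "i < j"
  then have "{i..<j} = insert i {Suc i..<j}" by auto
  then show ?thesis unfolding seg_def by simp
qed

lemma finite_seg [simp]: "finite (seg i j)" by (simp add: seg_def)

lemma finite_cseg [simp]: "finite (cseg i j)" by (simp add: cseg_def)

lemma C_seg: "C = insert e (seg 0 n)"
  by (auto simp: C_eq seg_def)

lemma C_split: assumes "i \<le> j" "j \<le> n" shows "C = seg i j \<union> cseg i j"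
  unfolding C_seg cseg_def using seg_split[of 0 i n] seg_split[of i j n] assms by auto

lemma seg_cseg_disjoint: assumes "i \<le> j" "j \<le> n" shows "seg i j \<inter> cseg i j = {}"
  unfolding cseg_def using seg_disjoint[of i i j 0] seg_disjoint[of j j n i] assms e_notin_seg[of j i] by auto

lemma ed_in_seg: "k < n \<Longrightarrow> j \<le> n \<Longrightarrow> ed k \<in> seg i j \<longleftrightarrow> i \<le> k \<and> k < j"
proof -
  assume a: "k < n" "j \<le> n"
  have "l = k" if "l < j" "ed l = ed k" for l using ed_eq[of l k] that a by simp
  then show ?thesis unfolding seg_def by (auto simp: image_iff)
qed

lemma pth_seg:
  assumes "i \<le> j" "j \<le> n"
  shows "pth en (vt i) (seg i j) (vt ` {i..j}) (vt j)"
  using assms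
proof (induction rule: dec_induct)
  case base
  then show ?case using pth.nil[of en "vt i"] by (simp add: seg_def)
next
  case (step j)
  have 1: "pth en (vt j) {ed j} {vt j, vt (Suc j)} (vt (Suc j))"
    using pth_single[OF ed_joins[of j]] step by simp
  have "vt (Suc j) \<notin> vt ` {i..j}" using vt_mem[of "Suc j" "{i..j}"] step by auto
  then have "pth en (vt i) (seg i j \<union> {ed j}) (vt ` {i..j} \<union> {vt j, vt (Suc j)}) (vt (Suc j))"
    using step by (intro pth_append[OF _ 1]) auto
  moreover have "seg i j \<union> {ed j} = seg i (Suc j)" using step by (auto simp: seg_def atLeastLessThanSuc)
  moreover have "vt ` {i..j} \<union> {vt j, vt (Suc j)} = vt ` {i..Suc j}" using step by (auto simp: atLeastAtMostSuc_conv)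
  ultimately show ?case by simp
qed

lemma pth_cseg:
  assumes "i < j" "j \<le> n"
  shows "pth en (vt i) (cseg i j) (vt ` ({..i} \<union> {j..n})) (vt j)"
proof -
  have 1: "pth en (vt i) (seg 0 i) (vt ` {0..i}) (vt 0)" using pth_rev[OF pth_seg[of 0 i]] assms by simp
  have 2: "pth en (vt n) (seg j n) (vt ` {j..n}) (vt j)" using pth_rev[OF pth_seg[of j n]] assms by simp
  have "vt 0 \<notin> vt ` {j..n}" using vt_mem[of 0 "{j..n}"] assms by auto
  from pth.step[OF e_joins 2 this]
  have 3: "pth en (vt 0) (insert e (seg j n)) (insert (vt 0) (vt ` {j..n})) (vt j)" .
  have "vt ` {0..i} \<inter> insert (vt 0) (vt ` {j..n}) \<subseteq> {vt 0}" using assms by auto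
  from pth_append[OF 1 3 this]
  have "pth en (vt i) (seg 0 i \<union> insert e (seg j n)) (vt ` {0..i} \<union> insert (vt 0) (vt ` {j..n})) (vt j)" .
  moreover have "seg 0 i \<union> insert e (seg j n) = cseg i j" by (auto simp: cseg_def)
  moreover have "vt ` {0..i} \<union> insert (vt 0) (vt ` {j..n}) = vt ` ({..i} \<union> {j..n})" by auto
  ultimately show ?thesis by simp
qed

lemma verts_C: "verts en C = vt ` {..n}"
proof -
  have "verts en (seg 0 n) = vt ` {0..n}" using pth_verts[OF pth_seg[of 0 n]] n_pos by auto
  then show ?thesis unfolding C_seg using verts_insert[OF e_joins, of "seg 0 n"] by auto
qed

lemma vt_in_C: "i \<le> n \<Longrightarrow> vt i \<in> verts en C" by (auto simp: verts_C)

text \<open>A path inside a line cannot turn around. \<open>min\<close> and \<open>max\<close> cover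
  both directions of travel.\<close>

lemma line_path:
  assumes "pth en (vt i) Q X (vt j)" "Q \<subseteq> seg 0 n" "i \<le> n" "j \<le> n"
  shows "Q = seg (min i j) (max i j) \<and> X = vt ` {min i j..max i j}"
proof -
  have "\<And>i. u = vt i \<Longrightarrow> i \<le> n \<Longrightarrow> w = vt j \<Longrightarrow> Q = seg (min i j) (max i j) \<and> X = vt ` {min i j..max i j}"
    if "pth en u Q X w" "Q \<subseteq> seg 0 n" for u w
    using that
  proof (induction rule: pth.induct)
    case (nil u)
    then have "i = j" using assms(4) by auto
    then show ?case using nil by (simp add: seg_def)
  next
    case (step f u v P X w)
    obtain k where k: "k < n" "f = ed k" using step.prems by (auto simp: seg_def)
    have P: "P \<subseteq> seg 0 n" using step.prems by auto
    have "u = vt k \<and> v = vt (Suc k) \<or> u = vt (Suc k) \<and> v = vt k"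
      using joins_unique[OF ed_joins[OF k(1)]] step(1) k(2) by auto
    then consider "i = k" "v = vt (Suc i)" | "i = Suc k" "v = vt k" using step.prems k by auto
    then show ?case
    proof cases
      case 1
      have IH: "P = seg (min (Suc i) j) (max (Suc i) j)" "X = vt ` {min (Suc i) j..max (Suc i) j}"
        using step.IH[of "Suc i", OF _ _ _ P] 1 k step.prems by auto
      \<comment> \<open>The start is not met again, so the rest of the path lies entirely to its
        right.\<close>
      have "i \<notin> {min (Suc i) j..max (Suc i) j}" using step(3) IH(2) step.prems by blast
      then have ij: "Suc i \<le> j" by auto
      then have "insert u X = vt ` {i..j}" using IH(2) step.prems by (simp add: atLeastAtMost_insertL flip: image_insert)
      then show ?thesis using IH(1) ij seg_Suc[of i j] k 1 by (simp add: min_def max_def)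
    next
      case 2
      have IH: "P = seg (min k j) (max k j)" "X = vt ` {min k j..max k j}"
        using step.IH[of k, OF _ _ _ P] 2 k step.prems by auto
      have "i \<notin> {min k j..max k j}" using step(3) IH(2) step.prems by blast
      then have ij: "j \<le> k" using 2 by auto
      then have "insert u X = vt ` {j..i}" using IH(2) step.prems 2
        by (simp add: min_def max_def atLeastAtMostSuc_conv)
      moreover have "seg j i = insert f P" using IH(1) ij 2 k by (auto simp: seg_def min_def max_def atLeastLessThanSuc)
      ultimately show ?thesis using ij 2 by (simp add: min_def max_def)
    qed
  qed
  then show ?thesis using assms by blast
qed

text \<open>Without \<open>e\<close> the path runs on the line. With \<open>e\<close> it is cut
  there into two paths on the line, and the direction in which \<open>e\<close> is crossed is
  forced.\<close>

lemma paths_in_C: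
  assumes "i < j" "j \<le> n" "Q \<subseteq> C" "is_path en Q (vt i) (vt j)"
  shows "Q = seg i j \<or> Q = cseg i j"
proof -
  have p: "pth en (vt i) Q (verts en Q) (vt j)" using pth_if_is_path[OF assms(4)] .
  show ?thesis
  proof (cases "e \<in> Q")
    case False
    then have "Q \<subseteq> seg 0 n" using assms(3) C_seg by auto
    then show ?thesis using line_path[OF p] assms by (simp add: min_def max_def)
  next
    case True
    obtain x y P1 X1 P2 X2 where s: "joins en e x y" "pth en (vt i) P1 X1 x" "pth en y P2 X2 (vt j)"
      "Q = insert e (P1 \<union> P2)" "e \<notin> P1 \<union> P2" "verts en Q = X1 \<union> X2" "X1 \<inter> X2 = {}"
      using pth_split_edge[OF p True] .
    have P: "P1 \<subseteq> seg 0 n" "P2 \<subseteq> seg 0 n" using s(4,5) assms(3) C_seg by auto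
    have "x = vt 0 \<and> y = vt n \<or> x = vt n \<and> y = vt 0" using joins_unique[OF e_joins s(1)] .
    then show ?thesis
    proof
      assume xy: "x = vt 0 \<and> y = vt n"
      have "P1 = seg 0 i" using line_path[of i P1 X1 0] s(2) P xy assms by (simp add: min_def max_def)
      moreover have "P2 = seg j n" using line_path[of n P2 X2 j] s(3) P xy assms by (simp add: min_def max_def split: if_splits)
      ultimately show ?thesis using s(4) by (simp add: cseg_def)
    next
      \<comment> \<open>Crossing \<open>e\<close> from \<open>vt n\<close> to \<open>vt 0\<close>
        would make both parts cover the positions from \<open>i\<close> to \<open>j\<close>.\<close>
      assume xy: "x = vt n \<and> y = vt 0"
      have "X1 = vt ` {i..n}" using line_path[of i P1 X1 n] s(2) P xy assms by (simp add: min_def max_def split: if_splits)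
      moreover have "X2 = vt ` {0..j}" using line_path[of 0 P2 X2 j] s(3) P xy assms by (simp add: min_def max_def)
      ultimately have "vt i \<in> X1 \<inter> X2" using assms by auto
      then show ?thesis using s(7) by auto
    qed
  qed
qed

lemma is_path_seg: "i < j \<Longrightarrow> j \<le> n \<Longrightarrow> is_path en (seg i j) (vt i) (vt j)"
  by (rule is_path_if_pth[OF pth_seg]) auto

lemma is_path_cseg: "i < j \<Longrightarrow> j \<le> n \<Longrightarrow> is_path en (cseg i j) (vt i) (vt j)"
  by (rule is_path_if_pth[OF pth_cseg]) auto

lemma verts_seg: "i < j \<Longrightarrow> j \<le> n \<Longrightarrow> verts en (seg i j) = vt ` {i..j}"
  by (rule pth_verts[OF pth_seg]) auto

lemma verts_cseg: "i < j \<Longrightarrow> j \<le> n \<Longrightarrow> verts en (cseg i j) = vt ` ({..i} \<union> {j..n})"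
  by (rule pth_verts[OF pth_cseg]) auto

end

section \<open>Layered circles as chains of intervals\<close>

context circle_frame
begin

text \<open>The chords of \<open>C\<^sup>*\<close> as intervals of positions on the path \<open>C - e\<close>.\<close>

definition ivals :: "(nat \<times> nat) set" where
  "ivals = {(i, j). i < j \<and> j \<le> n \<and> {vt i, vt j} \<in> star_chords V E en C}"

definition two_att :: bool where
  "two_att \<longleftrightarrow> (\<forall>D\<in>bridges V E en C. card (att en C D) = 2)"

text \<open>Inclusion is weak: intervals of different bridges may share an end or coincide.\<close>

definition nested :: bool where
  "nested \<longleftrightarrow> (\<forall>i j k l. (i, j) \<in> ivals \<longrightarrow> (k, l) \<in> ivals \<longrightarrow> i \<le> k \<and> l \<le> j \<or> k \<le> i \<and> j \<le> l)"

lemma ivalsD: "(i, j) \<in> ivals \<Longrightarrow> i < j \<and> j \<le> n"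
  by (auto simp: ivals_def)

lemma pair_ordered:
  assumes "{x, y} \<subseteq> verts en C" "x \<noteq> y"
  obtains i j where "i < j" "j \<le> n" "{x, y} = {vt i, vt j}"
proof -
  obtain a b where ab: "a \<le> n" "b \<le> n" "x = vt a" "y = vt b" using assms verts_C by auto
  then have "a \<noteq> b" using assms by auto
  then show ?thesis using that[of a b] that[of b a] ab by (cases "a < b") auto
qed

lemma star_chord_ival:
  assumes "two_att" "p \<in> star_chords V E en C"
  obtains i j where "(i, j) \<in> ivals" "p = {vt i, vt j}"
proof -
  obtain D where D: "D \<in> bridges V E en C" "p = att en C D" using assms by (auto simp: star_chords_def)
  have "card p = 2" using D assms by (auto simp: two_att_def)
  then obtain x y where "p = {x, y}" "x \<noteq> y" by (meson card_2_iff)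
  moreover have "p \<subseteq> verts en C" using D by (auto simp: att_def)
  ultimately obtain i j where "i < j" "j \<le> n" "p = {vt i, vt j}" using pair_ordered by metis
  then show ?thesis using that assms by (auto simp: ivals_def)
qed

lemma ivals_nonempty: assumes "two_att" shows "ivals \<noteq> {}"
proof -
  obtain f where "f \<in> E" "f \<notin> C" using C_sub C_neq by auto
  then obtain D where "D \<in> bridges V E en C" using edge_in_bridge by metis
  then have "att en C D \<in> star_chords V E en C" by (auto simp: star_chords_def)
  then show ?thesis using star_chord_ival[OF assms] by blast
qed

lemma chord_end_iff:
  assumes "two_att" "k \<le> n"
  shows "vt k \<in> star_chord_ends V E en C \<longleftrightarrow> (\<exists>l. (k, l) \<in> ivals \<or> (l, k) \<in> ivals)"
proof
  assume "vt k \<in> star_chord_ends V E en C"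
  then obtain p where p: "p \<in> star_chords V E en C" "vt k \<in> p" by (auto simp: star_chord_ends_def)
  obtain i j where ij: "(i, j) \<in> ivals" "p = {vt i, vt j}" using star_chord_ival[OF assms(1) p(1)] .
  then have "k = i \<or> k = j" using p(2) assms(2) ivalsD[OF ij(1)] by auto
  then show "\<exists>l. (k, l) \<in> ivals \<or> (l, k) \<in> ivals" using ij by auto
next
  assume "\<exists>l. (k, l) \<in> ivals \<or> (l, k) \<in> ivals"
  then show "vt k \<in> star_chord_ends V E en C" by (auto simp: star_chord_ends_def ivals_def)
qed

definition endp :: "nat \<Rightarrow> bool" where "endp k \<longleftrightarrow> (\<exists>l. (k, l) \<in> ivals \<or> (l, k) \<in> ivals)"

text \<open>The two pairs of ends in \<open>is_handle\<close>, one for the segment and one for the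
  chord, coincide because a path determines its ends. So a handle is one of the two arcs cut off by
  an interval, with no chord end inside.\<close>

lemma handle_iff:
  assumes "two_att"
  shows "is_handle V E en C Q \<longleftrightarrow> (\<exists>i j. (i, j) \<in> ivals \<and>
    (Q = seg i j \<and> (\<forall>k. i < k \<and> k < j \<longrightarrow> \<not> endp k) \<or>
     Q = cseg i j \<and> (\<forall>k. k < i \<or> j < k \<and> k \<le> n \<longrightarrow> \<not> endp k)))"
    (is "?L \<longleftrightarrow> ?R")
proof
  assume ?L
  then obtain x y x' y' where q: "Q \<subseteq> C" "is_path en Q x y"
      "\<forall>v\<in>verts en Q - {x, y}. v \<notin> star_chord_ends V E en C"
      "is_path en Q x' y'" "{x', y'} \<in> star_chords V E en C"
    unfolding is_handle_def is_segment_def by blast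
  have eq: "{x, y} = {x', y'}" using is_path_ends_unique[OF q(2,4)] .
  then obtain i j where ij: "(i, j) \<in> ivals" "{x, y} = {vt i, vt j}" using star_chord_ival[OF assms q(5)] by metis
  then have "x = vt i \<and> y = vt j \<or> x = vt j \<and> y = vt i" by (auto simp: doubleton_eq_iff)
  then have p: "is_path en Q (vt i) (vt j)" using q(2) is_path_sym by metis
  note d = ivalsD[OF ij(1)]
  have ne: "\<not> endp k" if "vt k \<in> verts en Q" "k \<le> n" "k \<noteq> i" "k \<noteq> j" for k
  proof -
    have "vt k \<in> verts en Q - {x, y}" using that ij(2) d by auto
    then show ?thesis using q(3) chord_end_iff[OF assms that(2)] unfolding endp_def by blast
  qed
  have "Q = seg i j \<or> Q = cseg i j" using paths_in_C[OF _ _ q(1) p] d by auto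
  then show ?R
  proof
    assume Q: "Q = seg i j"
    then have "\<forall>k. i < k \<and> k < j \<longrightarrow> \<not> endp k" using ne verts_seg[of i j] d by auto
    then show ?thesis using Q ij(1) by blast
  next
    assume Q: "Q = cseg i j"
    then have "\<forall>k. k < i \<or> j < k \<and> k \<le> n \<longrightarrow> \<not> endp k" using ne verts_cseg[of i j] d by auto
    then show ?thesis using Q ij(1) by blast
  qed
next
  assume ?R
  then obtain i j where ij: "(i, j) \<in> ivals" and R: "Q = seg i j \<and> (\<forall>k. i < k \<and> k < j \<longrightarrow> \<not> endp k) \<or>
     Q = cseg i j \<and> (\<forall>k. k < i \<or> j < k \<and> k \<le> n \<longrightarrow> \<not> endp k)" by blast
  note d = ivalsD[OF ij]
  have st: "{vt i, vt j} \<in> star_chords V E en C" using ij by (auto simp: ivals_def)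
  have p: "is_path en Q (vt i) (vt j)" using R is_path_seg is_path_cseg d by auto
  have C: "Q \<subseteq> C" using R C_split[of i j] d by auto
  have "v \<notin> star_chord_ends V E en C" if v: "v \<in> verts en Q - {vt i, vt j}" for v
  proof -
    obtain k where k: "k \<le> n" "v = vt k" using v verts_mono[OF C, of en] verts_C by auto
    have "\<not> endp k"
      using R
    proof
      assume Q: "Q = seg i j \<and> (\<forall>k. i < k \<and> k < j \<longrightarrow> \<not> endp k)"
      then have "vt k \<in> vt ` {i..j}" using v k verts_seg d by auto
      then have "k \<in> {i..j}" using vt_mem[OF k(1), of "{i..j}"] d by auto
      then show ?thesis using Q v k by (auto simp: le_less)
    next
      assume Q: "Q = cseg i j \<and> (\<forall>k. k < i \<or> j < k \<and> k \<le> n \<longrightarrow> \<not> endp k)"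
      then have "vt k \<in> vt ` ({..i} \<union> {j..n})" using v k verts_cseg d by auto
      then have "k \<in> {..i} \<union> {j..n}" using vt_mem[OF k(1), of "{..i} \<union> {j..n}"] d by auto
      then show ?thesis using Q v k by (auto simp: le_less)
    qed
    then show ?thesis using chord_end_iff[OF assms k(1)] k(2) unfolding endp_def by auto
  qed
  moreover have "vt i \<in> star_chord_ends V E en C" "vt j \<in> star_chord_ends V E en C"
    using st by (auto simp: star_chord_ends_def)
  ultimately show ?L unfolding is_handle_def is_segment_def using st p C by blast
qed

section \<open>Crossing chords, nested intervals and handles\<close>

lemma cross_intro:
  assumes "i < k" "k < j" "j < l" "l \<le> n"
  shows "chords_cross en C {vt i, vt j} {vt k, vt l}"
proof -
  have "vt k \<in> verts en Q \<longleftrightarrow> vt l \<notin> verts en Q" if "Q \<subseteq> C" "is_path en Q (vt i) (vt j)" for Q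
  proof -
    have "Q = seg i j \<or> Q = cseg i j" using paths_in_C[OF _ _ that] assms by auto
    then show ?thesis using verts_seg[of i j] verts_cseg[of i j] vt_mem[of k "{i..j}"] vt_mem[of l "{i..j}"]
        vt_mem[of k "{..i} \<union> {j..n}"] vt_mem[of l "{..i} \<union> {j..n}"] assms by auto
  qed
  moreover have "distinct [vt i, vt j, vt k, vt l]" using assms by auto
  moreover have "vt k \<in> verts en C" "vt l \<in> verts en C" using vt_in_C assms by auto
  ultimately show ?thesis unfolding chords_cross_def by blast
qed

text \<open>A crossing puts exactly one of \<open>k\<close> and \<open>l\<close> into
  \<open>{i..j}\<close>. With four different ends, nesting puts both inside or both outside.\<close>

lemma nested_not_cross:
  assumes "two_att" "nested" "p \<in> star_chords V E en C" "q \<in> star_chords V E en C"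
  shows "\<not> chords_cross en C p q"
proof
  assume "chords_cross en C p q"
  then obtain a b c d where h: "p = {a, b}" "q = {c, d}" "distinct [a, b, c, d]"
     "\<forall>Q. Q \<subseteq> C \<and> is_path en Q a b \<longrightarrow> (c \<in> verts en Q \<longleftrightarrow> d \<notin> verts en Q)"
    unfolding chords_cross_def by blast
  obtain i j where ij: "(i, j) \<in> ivals" "p = {vt i, vt j}" using star_chord_ival[OF assms(1,3)] .
  obtain k l where kl: "(k, l) \<in> ivals" "q = {vt k, vt l}" using star_chord_ival[OF assms(1,4)] .
  note d = ivalsD[OF ij(1)] ivalsD[OF kl(1)]
  have "{a, b} = {vt i, vt j}" "{c, d} = {vt k, vt l}" using h ij kl by auto
  then have e: "a = vt i \<and> b = vt j \<or> a = vt j \<and> b = vt i" "c = vt k \<and> d = vt l \<or> c = vt l \<and> d = vt k"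
    by (auto simp: doubleton_eq_iff)
  have "is_path en (seg i j) (vt i) (vt j)" using is_path_seg d by auto
  then have "is_path en (seg i j) a b" using e(1) is_path_sym by metis
  then have x: "c \<in> verts en (seg i j) \<longleftrightarrow> d \<notin> verts en (seg i j)" using h(4) seg_sub d by blast
  have "k \<in> {i..j} \<longleftrightarrow> l \<notin> {i..j}"
    using x e(2) verts_seg[of i j] vt_mem[of k "{i..j}"] vt_mem[of l "{i..j}"] d by auto
  moreover have "i \<le> k \<and> l \<le> j \<or> k \<le> i \<and> j \<le> l" using assms(2) ij kl unfolding nested_def by blast
  moreover have "k \<noteq> i" "k \<noteq> j" "l \<noteq> i" "l \<noteq> j" using h(3) e by auto
  ultimately show False using d by auto
qed

text \<open>In a shortest interval within \<open>(a, b)\<close> no chord ends strictly inside: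
  without crossings its other end would also stay in the interval and give a shorter one. Only the
  absence of crossings is assumed, so this serves families that are not nested.\<close>

lemma noncrossing_min_handle:
  assumes "two_att" "\<And>i j k l. (i, j) \<in> ivals \<Longrightarrow> (k, l) \<in> ivals \<Longrightarrow> \<not> (i < k \<and> k < j \<and> j < l)" "(a, b) \<in> ivals"
  obtains i j where "(i, j) \<in> ivals" "a \<le> i" "j \<le> b" "is_handle V E en C (seg i j)"
proof -
  let ?A = "\<lambda>(i, j). (i, j) \<in> ivals \<and> a \<le> i \<and> j \<le> b"
  have "?A (a, b)" using assms(3) by auto
  then obtain p where p: "?A p" "\<And>q. ?A q \<Longrightarrow> snd p - fst p \<le> snd q - fst q"
    using ex_has_least_nat[of ?A "(a, b)" "\<lambda>q. snd q - fst q"] by blast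
  obtain i j where ij: "p = (i, j)" by (cases p)
  have I: "(i, j) \<in> ivals" "a \<le> i" "j \<le> b" using p(1) ij by auto
  have mn: "j - i \<le> l - k" if "(k, l) \<in> ivals" "a \<le> k" "l \<le> b" for k l using p(2)[of "(k, l)"] that ij by auto
  have "\<not> endp k" if k: "i < k" "k < j" for k
  proof
    assume "endp k"
    then obtain l where "(k, l) \<in> ivals \<or> (l, k) \<in> ivals" by (auto simp: endp_def)
    then show False
    proof
      assume l: "(k, l) \<in> ivals"
      then have "l \<le> j" using assms(2)[OF I(1) l] k by auto
      then show False using mn[OF l] ivalsD[OF l] k I by auto
    next
      assume l: "(l, k) \<in> ivals"
      then have "i \<le> l" using assms(2)[OF l I(1)] k by auto
      then show False using mn[OF l] ivalsD[OF l] k I by auto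
    qed
  qed
  then have "is_handle V E en C (seg i j)" using handle_iff[OF assms(1)] I(1) by blast
  then show ?thesis using that I by blast
qed

text \<open>Two intervals that neither cross nor are nested lie side by side. Each contains a handle
  without \<open>e\<close>, and together with \<open>H\<close> these are three.\<close>

lemma nested_if_layered:
  assumes "two_att" "two_handled V E en C" "is_handle V E en C H" "e \<in> H"
  shows "nested"
proof (rule ccontr)
  assume "\<not> nested"
  then obtain a b c d where abcd: "(a, b) \<in> ivals" "(c, d) \<in> ivals" "\<not> (a \<le> c \<and> d \<le> b)" "\<not> (c \<le> a \<and> b \<le> d)"
    unfolding nested_def by blast
  have nc: "\<not> (i < k \<and> k < j \<and> j < l)" if "(i, j) \<in> ivals" "(k, l) \<in> ivals" for i j k l
    using that cross_intro[of i k j l] assms(2) unfolding two_handled_def ivals_def by auto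
  have "\<exists>a b c d. (a, b) \<in> ivals \<and> (c, d) \<in> ivals \<and> b \<le> c"
    using nc[OF abcd(1,2)] nc[OF abcd(2,1)] abcd ivalsD[OF abcd(1)] ivalsD[OF abcd(2)]
    by (metis linorder_not_le order_le_less)
  then obtain a b c d where ab: "(a, b) \<in> ivals" and cd: "(c, d) \<in> ivals" and bc: "b \<le> c" by blast
  obtain i j where ij: "(i, j) \<in> ivals" "a \<le> i" "j \<le> b" "is_handle V E en C (seg i j)"
    using noncrossing_min_handle[OF assms(1) nc ab] .
  obtain k l where kl: "(k, l) \<in> ivals" "c \<le> k" "l \<le> d" "is_handle V E en C (seg k l)"
    using noncrossing_min_handle[OF assms(1) nc cd] .
  note d = ivalsD[OF ij(1)] ivalsD[OF kl(1)]
  \<comment> \<open>Since \<open>j \<le> b\<close>, \<open>b \<le> c\<close> and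
    \<open>c \<le> k\<close>, the first edge of one handle tells it apart from the other.\<close>
  have "ed i \<in> seg i j" "ed i \<notin> seg k l" using ed_in_seg[of i j i] ed_in_seg[of i l k] d ij kl bc by auto
  moreover have "e \<notin> seg i j" "e \<notin> seg k l" using e_notin_seg d by auto
  ultimately have "card {H, seg i j, seg k l} = 3" using assms(4) by (auto simp: card_insert_if)
  moreover have c2: "card {Q. is_handle V E en C Q} = 2" using assms(2) by (simp add: two_handled_def)
  moreover have "finite {Q. is_handle V E en C Q}" using c2 by (metis card.infinite zero_neq_numeral)
  then have "card {H, seg i j, seg k l} \<le> card {Q. is_handle V E en C Q}"
    using assms(3) ij kl by (intro card_mono) auto
  ultimately show False by simp
qed

lemma nested_min:
  assumes "two_att" "nested"
  obtains i j where "(i, j) \<in> ivals" "\<And>k l. (k, l) \<in> ivals \<Longrightarrow> k \<le> i \<and> j \<le> l"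
proof -
  obtain p where p: "p \<in> ivals" "\<And>q. q \<in> ivals \<Longrightarrow> snd p - fst p \<le> snd q - fst q"
    using ivals_nonempty[OF assms(1)] ex_has_least_nat[of "\<lambda>q. q \<in> ivals" _ "\<lambda>q. snd q - fst q"] by blast
  obtain i j where ij: "p = (i, j)" by (cases p)
  have "k \<le> i \<and> j \<le> l" if kl: "(k, l) \<in> ivals" for k l
  proof -
    have "i \<le> k \<and> l \<le> j \<or> k \<le> i \<and> j \<le> l" using assms(2) p(1) ij kl unfolding nested_def by blast
    moreover have "j - i \<le> l - k" using p(2)[OF kl] ij by simp
    ultimately show ?thesis using ivalsD[OF kl] by linarith
  qed
  then show ?thesis using that p ij by blast
qed

lemma nested_max:
  assumes "two_att" "nested"
  obtains i j where "(i, j) \<in> ivals" "\<And>k l. (k, l) \<in> ivals \<Longrightarrow> i \<le> k \<and> l \<le> j"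
proof -
  obtain q0 where q0: "q0 \<in> ivals" using ivals_nonempty[OF assms(1)] by blast
  have "\<forall>q. q \<in> ivals \<longrightarrow> snd q - fst q < Suc n" by (auto simp: ivals_def)
  then obtain p where p: "p \<in> ivals" "\<And>q. q \<in> ivals \<Longrightarrow> snd q - fst q \<le> snd p - fst p"
    using q0 ex_has_greatest_nat[of "\<lambda>q. q \<in> ivals" q0 "\<lambda>q. snd q - fst q" "Suc n"] by blast
  obtain i j where ij: "p = (i, j)" by (cases p)
  have "i \<le> k \<and> l \<le> j" if kl: "(k, l) \<in> ivals" for k l
  proof -
    have "i \<le> k \<and> l \<le> j \<or> k \<le> i \<and> j \<le> l" using assms(2) p(1) ij kl unfolding nested_def by blast
    moreover have "l - k \<le> j - i" using p(2)[OF kl] ij by simp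
    moreover have "i < j" using ivalsD p(1) ij by blast
    ultimately show ?thesis using ivalsD[OF kl] by linarith
  qed
  then show ?thesis using that p ij by blast
qed

text \<open>An interval other than the smallest has an end of the smallest one strictly inside, and
  one other than the largest has an end of the largest one strictly outside. So each kind of arc
  yields exactly one handle.\<close>

lemma nested_handles:
  assumes "two_att" "nested"
    and ij: "(i, j) \<in> ivals" "\<And>k l. (k, l) \<in> ivals \<Longrightarrow> k \<le> i \<and> j \<le> l"
    and kl: "(k, l) \<in> ivals" "\<And>a b. (a, b) \<in> ivals \<Longrightarrow> k \<le> a \<and> b \<le> l"
  shows "{Q. is_handle V E en C Q} = {seg i j, cseg k l}"
proof -
  have inner: "a = i \<and> b = j" if "(a, b) \<in> ivals" "\<forall>k. a < k \<and> k < b \<longrightarrow> \<not> endp k" for a b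
  proof -
    have "endp i" "endp j" using ij(1) by (auto simp: endp_def)
    then have "\<not> (a < i \<and> i < b)" "\<not> (a < j \<and> j < b)" using that(2) by blast+
    then show ?thesis using ij(2)[OF that(1)] ivalsD[OF ij(1)] ivalsD[OF that(1)] by auto
  qed
  have outer: "a = k \<and> b = l" if "(a, b) \<in> ivals" "\<forall>k. k < a \<or> b < k \<and> k \<le> n \<longrightarrow> \<not> endp k" for a b
  proof -
    have "endp k" "endp l" using kl(1) by (auto simp: endp_def)
    then have "\<not> k < a" "\<not> b < l" using that(2) ivalsD[OF kl(1)] by blast+
    then show ?thesis using kl(2)[OF that(1)] by auto
  qed
  have 1: "is_handle V E en C (seg i j)"
  proof -
    have "\<not> endp m" if m: "i < m" "m < j" for m
    proof
      assume "endp m"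
      then obtain o' where "(m, o') \<in> ivals \<or> (o', m) \<in> ivals" by (auto simp: endp_def)
      then show False using ij(2)[of m o'] ij(2)[of o' m] m by auto
    qed
    then show ?thesis using handle_iff[OF assms(1)] ij(1) by blast
  qed
  have 2: "is_handle V E en C (cseg k l)"
  proof -
    have "\<not> endp m" if m: "m < k \<or> l < m \<and> m \<le> n" for m
    proof
      assume "endp m"
      then obtain o' where o: "(m, o') \<in> ivals \<or> (o', m) \<in> ivals" by (auto simp: endp_def)
      then show False using kl(2)[of m o'] kl(2)[of o' m] m ivalsD[of m o'] ivalsD[of o' m] by auto
    qed
    then show ?thesis using handle_iff[OF assms(1)] kl(1) by blast
  qed
  have "Q = seg i j \<or> Q = cseg k l" if Q: "is_handle V E en C Q" for Q
    using Q inner outer unfolding handle_iff[OF assms(1)] by blast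
  then show ?thesis using 1 2 by auto
qed

lemma e_in_cseg: "e \<in> cseg i j" by (simp add: cseg_def)

lemma layered_if_nested:
  assumes "two_att" "nested"
  shows "layered V E en C" "\<exists>H. is_handle V E en C H \<and> e \<in> H"
proof -
  obtain i j where ij: "(i, j) \<in> ivals" "\<And>k l. (k, l) \<in> ivals \<Longrightarrow> k \<le> i \<and> j \<le> l" using nested_min[OF assms] by metis
  obtain k l where kl: "(k, l) \<in> ivals" "\<And>a b. (a, b) \<in> ivals \<Longrightarrow> k \<le> a \<and> b \<le> l" using nested_max[OF assms] by metis
  note h = nested_handles[OF assms ij kl]
  \<comment> \<open>With a single interval the two handles are its two arcs; \<open>e\<close>
    distinguishes them in every case.\<close>
  have "e \<notin> seg i j" using e_notin_seg ivalsD[OF ij(1)] by auto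
  then have "seg i j \<noteq> cseg k l" using e_in_cseg by blast
  then have "card {Q. is_handle V E en C Q} = 2" using h by simp
  then show "layered V E en C" using nested_not_cross[OF assms] assms(1)
    unfolding layered_def two_handled_def two_att_def by blast
  have "is_handle V E en C (cseg k l)" using h by auto
  then show "\<exists>H. is_handle V E en C H \<and> e \<in> H" using e_in_cseg by metis
qed

lemma layered_iff_nested:
  "layered V E en C \<and> (\<exists>H. is_handle V E en C H \<and> e \<in> H) \<longleftrightarrow> two_att \<and> nested"
  using layered_if_nested nested_if_layered unfolding layered_def two_att_def by blast

lemma inner_handle:
  assumes "two_att" "nested" "is_handle V E en C H" "e \<notin> H"
  obtains i j where "H = seg i j" "(i, j) \<in> ivals" "\<And>k l. (k, l) \<in> ivals \<Longrightarrow> k \<le> i \<and> j \<le> l"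
proof -
  obtain i j where ij: "(i, j) \<in> ivals" "\<And>k l. (k, l) \<in> ivals \<Longrightarrow> k \<le> i \<and> j \<le> l" using nested_min[OF assms(1,2)] by metis
  obtain k l where kl: "(k, l) \<in> ivals" "\<And>a b. (a, b) \<in> ivals \<Longrightarrow> k \<le> a \<and> b \<le> l" using nested_max[OF assms(1,2)] by metis
  have "H \<in> {seg i j, cseg k l}" using nested_handles[OF assms(1,2) ij kl] assms(3) by blast
  then have "H = seg i j" using assms(4) e_in_cseg by auto
  then show ?thesis using that ij by blast
qed

end

section \<open>The circles through the closing edge of a layered circle\<close>

context circle_frame
begin

lemma bridge_att_ival:
  assumes "two_att" "D \<in> bridges V E en C" "vt a \<in> att en C D" "vt b \<in> att en C D" "a \<noteq> b" "a \<le> n" "b \<le> n"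
  shows "att en C D = {vt a, vt b}" "(a, b) \<in> ivals \<or> (b, a) \<in> ivals"
proof -
  have "card (att en C D) = 2" using assms by (auto simp: two_att_def)
  then show eq: "att en C D = {vt a, vt b}" using assms(3-7)
    by (metis card_2_iff' doubleton_eq_iff card_2_iff insertE singletonD vt_eq)
  then have "{vt a, vt b} \<in> star_chords V E en C" using assms(2) unfolding star_chords_def by (metis imageI)
  then show "(a, b) \<in> ivals \<or> (b, a) \<in> ivals" using assms(5-7) by (auto simp: ivals_def insert_commute)
qed

text \<open>Cuts off the part of the path up to its next vertex on \<open>C\<close>: one edge of
  \<open>C\<close>, or a passage through one bridge. For a backward step only the position is
  recorded, since no final description of a path contains one. The bound on \<open>card R2\<close>
  drives the inductions below.\<close>

lemma walk_step:
  assumes "two_att" "pth en (vt a) R X (vt n)" "a \<le> n" "R \<subseteq> E - {e}" "a \<noteq> n"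
  obtains b R1 X1 R2 X2 where "b \<le> n" "b \<noteq> a" "pth en (vt a) R1 X1 (vt b)" "pth en (vt b) R2 X2 (vt n)"
    "R = R1 \<union> R2" "X = X1 \<union> X2" "X1 \<inter> X2 = {vt b}" "vt a \<notin> X2" "card R2 < card R"
    "b = Suc a \<and> R1 = {ed a} \<or> Suc b = a \<or>
      ((a, b) \<in> ivals \<or> (b, a) \<in> ivals) \<and> (\<exists>D\<in>bridges V E en C. R1 \<subseteq> D \<and> att en C D = {vt a, vt b})"
proof -
  note result = that
  have fR: "finite R" using pth_finite[OF assms(2)] by simp
  \<comment> \<open>Common end of the three cases: \<open>R1\<close> is nonempty and disjoint from
    \<open>R2\<close>, so the remaining path is shorter.\<close>
  have fin_step: thesis if h: "b \<le> n" "b \<noteq> a" "pth en (vt a) R1 X1 (vt b)" "pth en (vt b) R2 X2 (vt n)"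
    "R = R1 \<union> R2" "X = X1 \<union> X2" "X1 \<inter> X2 = {vt b}"
    "b = Suc a \<and> R1 = {ed a} \<or> Suc b = a \<or>
      ((a, b) \<in> ivals \<or> (b, a) \<in> ivals) \<and> (\<exists>D\<in>bridges V E en C. R1 \<subseteq> D \<and> att en C D = {vt a, vt b})"
    for b R1 X1 R2 X2
  proof -
    have ne: "vt a \<noteq> vt b" using h(1,2) assms(3) by auto
    have "vt a \<in> X1" using pth_ends[OF h(3)] by simp
    then have a: "vt a \<notin> X2" using h(7) ne by (metis IntI singletonD)
    have "R1 \<noteq> {}" using pth_eq_iff[OF h(3)] ne by simp
    moreover have "R1 \<inter> R2 = {}" using pth_disjoint[OF h(3,4)] h(7) by simp
    ultimately have "R2 \<subset> R" using h(5) by auto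
    then have "card R2 < card R" using fR psubset_card_mono by metis
    then show thesis using result[OF h(1-7) a _ h(8)] by blast
  qed
  from assms(2) show thesis
  proof (cases rule: pth.cases)
    case nil
    then have "vt a = vt n" by auto
    then show thesis using assms(3,5) by simp
  next
    case (step f v P Y)
    have fE: "f \<in> E" "f \<noteq> e" using step(1) assms(4) by auto
    have p: "pth en v P Y (vt n)" by fact
    have vY: "v \<in> Y" "vt a \<noteq> v" using pth_ends[OF p] step(5) by auto
    show thesis
    proof (cases "f \<in> C")
      case True
      then obtain k where k: "k < n" "f = ed k" using fE C_eq by auto
      have "vt a = vt k \<and> v = vt (Suc k) \<or> vt a = vt (Suc k) \<and> v = vt k"
        using joins_unique[OF ed_joins[OF k(1)]] step(3) k(2) by auto
      then have b: "a = k \<and> v = vt (Suc a) \<and> Suc a \<le> n \<or> a = Suc k \<and> v = vt k" using k assms(3) by auto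
      have s: "pth en (vt a) {f} {vt a, v} v" using pth_single[OF step(3) vY(2)] .
      have X: "X = {vt a, v} \<union> Y" "{vt a, v} \<inter> Y = {v}" "R = {f} \<union> P" using step(1,2,5) vY by auto
      from b show thesis
      proof
        assume b: "a = k \<and> v = vt (Suc a) \<and> Suc a \<le> n"
        show thesis by (rule fin_step[of "Suc a" "{f}" "{vt a, v}" P Y]) (use b s p X k in auto)
      next
        assume b: "a = Suc k \<and> v = vt k"
        show thesis by (rule fin_step[of k "{f}" "{vt a, v}" P Y]) (use b s p X k in auto)
      qed
    next
      case False
      have RE: "R \<subseteq> E" using assms(4) by auto
      obtain D x R1 X1 R2 X2 where h: "D \<in> bridges V E en C" "pth en (vt a) R1 X1 x" "pth en x R2 X2 (vt n)" "R = R1 \<union> R2"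
        "X = X1 \<union> X2" "X1 \<inter> X2 = {x}" "X1 \<inter> verts en C = {vt a, x}" "R1 \<subseteq> D" "vt a \<noteq> x"
        using bridge_exit[OF assms(2) RE vt_in_C[OF assms(3)] vt_in_C[OF order_refl] step(3) fE(1) False step(2,1) p step(5)] .
      have "x \<in> verts en C" using h(7) by auto
      then obtain b where b: "b \<le> n" "x = vt b" using verts_C by auto
      have ba: "b \<noteq> a" using h(9) b by auto
      have "X1 \<subseteq> verts en D" using pth_verts[OF h(2,9)] verts_mono[OF h(8)] by metis
      then have at: "vt a \<in> att en C D" "vt b \<in> att en C D" using h(7) b(2) unfolding att_def by auto
      note iv = bridge_att_ival[OF assms(1) h(1) at ba[symmetric] assms(3) b(1)]
      show thesis by (rule fin_step[of b R1 X1 R2 X2]) (use b ba h iv in auto)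
    qed
  qed
qed

text \<open>By nesting, an interval with an end strictly between \<open>i\<close> and
  \<open>j\<close> does not leave the range from \<open>i\<close> to \<open>j\<close>, and unit
  steps cannot skip the blocked ends. So the path stays inside and never reaches \<open>n\<close>,
  which is at least \<open>j\<close>.\<close>

lemma walk_trapped:
  assumes "two_att" "nested" "(i, j) \<in> ivals" "pth en (vt a) R X (vt n)" "i < a" "a < j" "vt i \<notin> X" "vt j \<notin> X"
    "R \<subseteq> E - {e}"
  shows False
  using assms(4-9)
proof (induction "card R" arbitrary: a R X rule: less_induct)
  case less
  have jn: "j \<le> n" using ivalsD[OF assms(3)] by simp
  have a: "a \<le> n" "a \<noteq> n" using less.prems jn by auto
  obtain b R1 X1 R2 X2 where w: "b \<le> n" "b \<noteq> a" "pth en (vt a) R1 X1 (vt b)" "pth en (vt b) R2 X2 (vt n)"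
    "R = R1 \<union> R2" "X = X1 \<union> X2" "X1 \<inter> X2 = {vt b}" "vt a \<notin> X2" "card R2 < card R"
    "b = Suc a \<and> R1 = {ed a} \<or> Suc b = a \<or>
      ((a, b) \<in> ivals \<or> (b, a) \<in> ivals) \<and> (\<exists>D\<in>bridges V E en C. R1 \<subseteq> D \<and> att en C D = {vt a, vt b})"
    using walk_step[OF assms(1) less.prems(1) a(1) less.prems(6) a(2)] .
  have "vt b \<in> X" using pth_ends[OF w(4)] w(6) by auto
  then have b: "b \<noteq> i" "b \<noteq> j" using less.prems(4,5) by auto
  have "(a, b) \<in> ivals \<Longrightarrow> i \<le> a \<and> b \<le> j \<or> a \<le> i \<and> j \<le> b" "(b, a) \<in> ivals \<Longrightarrow> i \<le> b \<and> a \<le> j \<or> b \<le> i \<and> j \<le> a"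
    using assms(2,3) unfolding nested_def by blast+
  then have "i < b" "b < j" using w(10) less.prems(2,3) b ivalsD[of a b] ivalsD[of b a] by linarith+
  then show False using less.hyps[OF w(9,4)] less.prems w(5,6) by auto
qed

text \<open>After a jump over \<open>(i, j)\<close> all positions up to \<open>i\<close> are closed.
  From \<open>a \<ge> j\<close> a bridge can lead only to such a position or, when
  \<open>a = j\<close>, into the interior, where \<open>walk_trapped\<close> applies. Hence the path
  follows \<open>C\<close> to its end.\<close>

lemma walk_after_jump:
  assumes "two_att" "nested" "(i, j) \<in> ivals" "pth en (vt a) R X (vt n)" "j \<le> a" "a \<le> n"
    "X \<inter> vt ` {..i} = {}" "X \<inter> vt ` {j..<a} = {}" "R \<subseteq> E - {e}"
  shows "R = seg a n"
  using assms(4-9)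
proof (induction "card R" arbitrary: a R X rule: less_induct)
  case less
  note ij = ivalsD[OF assms(3)]
  show ?case
  proof (cases "a = n")
    case True
    then show ?thesis using pth_eq_iff[OF less.prems(1)] by (simp add: seg_def)
  next
    case False
    obtain b R1 X1 R2 X2 where w: "b \<le> n" "b \<noteq> a" "pth en (vt a) R1 X1 (vt b)" "pth en (vt b) R2 X2 (vt n)"
      "R = R1 \<union> R2" "X = X1 \<union> X2" "X1 \<inter> X2 = {vt b}" "vt a \<notin> X2" "card R2 < card R"
      "b = Suc a \<and> R1 = {ed a} \<or> Suc b = a \<or>
        ((a, b) \<in> ivals \<or> (b, a) \<in> ivals) \<and> (\<exists>D\<in>bridges V E en C. R1 \<subseteq> D \<and> att en C D = {vt a, vt b})"
      using walk_step[OF assms(1) less.prems(1,3,6) False] .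
    have bX: "vt b \<in> X" using pth_ends[OF w(4)] w(6) by auto
    then have b: "\<not> b \<le> i" "\<not> (j \<le> b \<and> b < a)" using less.prems(4,5) by auto
    \<comment> \<open>The interior can be entered only from \<open>j\<close>; then
      \<open>vt j\<close> is already behind and \<open>vt i\<close> is closed.\<close>
    have trap: "\<not> (i < b \<and> b < j)" if "a = j"
      using walk_trapped[OF assms(1-3) w(4)] less.prems(4,6) w(5,6,8) that by auto
    have nest: "(a, b) \<in> ivals \<Longrightarrow> i \<le> a \<and> b \<le> j \<or> a \<le> i \<and> j \<le> b" "(b, a) \<in> ivals \<Longrightarrow> i \<le> b \<and> a \<le> j \<or> b \<le> i \<and> j \<le> a"
      using assms(2,3) unfolding nested_def by blast+
    have "b = Suc a"
      using w(10)
    proof (elim disjE conjE)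
      assume "Suc b = a" then show ?thesis using b trap less.prems(2) by linarith
    next
      assume "(a, b) \<in> ivals" then show ?thesis using nest(1) less.prems(2) ij ivalsD[of a b] by linarith
    next
      assume "(b, a) \<in> ivals" then show ?thesis using nest(2) less.prems(2) b trap ivalsD[of b a] by linarith
    qed
    moreover have "R1 = {ed a}"
      using w(10)
    proof (elim disjE conjE)
      assume "(a, b) \<in> ivals" then show ?thesis using nest(1) less.prems(2) ij ivalsD[of a b] by linarith
    next
      assume "(b, a) \<in> ivals" then show ?thesis using \<open>b = Suc a\<close> ivalsD[of b a] by linarith
    qed (use \<open>b = Suc a\<close> in auto)
    moreover have "R2 = seg b n"
    proof (rule less.hyps[OF w(9,4)])
      show "j \<le> b" "b \<le> n" "R2 \<subseteq> E - {e}" "X2 \<inter> vt ` {..i} = {}"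
        using less.prems w \<open>b = Suc a\<close> by auto
      have "{j..<b} = insert a {j..<a}" using \<open>b = Suc a\<close> less.prems(2) by auto
      then show "X2 \<inter> vt ` {j..<b} = {}" using less.prems(5) w(6,8) by auto
    qed
    ultimately show ?thesis using w(5) seg_Suc[of a n] less.prems(3) False by auto
  qed
qed

text \<open>The invariant is that all positions before \<open>a\<close> are closed. So the path
  moves forward along \<open>C\<close> until its first jump, which goes to the right, and
  \<open>walk_after_jump\<close> determines the rest.\<close>

lemma walk_from:
  assumes "two_att" "nested" "pth en (vt a) R X (vt n)" "a \<le> n" "X \<inter> vt ` {..<a} = {}" "R \<subseteq> E - {e}"
  shows "R = seg a n \<or> (\<exists>D i j P Y. a \<le> i \<and> (i, j) \<in> ivals \<and> D \<in> bridges V E en C \<and> P \<subseteq> D \<and>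
    att en C D = {vt i, vt j} \<and> pth en (vt i) P Y (vt j) \<and> R = seg a i \<union> P \<union> seg j n)"
  using assms(3-6)
proof (induction "card R" arbitrary: a R X rule: less_induct)
  case less
  show ?case
  proof (cases "a = n")
    case True
    then show ?thesis using pth_eq_iff[OF less.prems(1)] by (simp add: seg_def)
  next
    case False
    obtain b R1 X1 R2 X2 where w: "b \<le> n" "b \<noteq> a" "pth en (vt a) R1 X1 (vt b)" "pth en (vt b) R2 X2 (vt n)"
      "R = R1 \<union> R2" "X = X1 \<union> X2" "X1 \<inter> X2 = {vt b}" "vt a \<notin> X2" "card R2 < card R"
      "b = Suc a \<and> R1 = {ed a} \<or> Suc b = a \<or>
        ((a, b) \<in> ivals \<or> (b, a) \<in> ivals) \<and> (\<exists>D\<in>bridges V E en C. R1 \<subseteq> D \<and> att en C D = {vt a, vt b})"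
      using walk_step[OF assms(1) less.prems(1,2,4) False] .
    have bX: "vt b \<in> X" using pth_ends[OF w(4)] w(6) by auto
    then have b: "\<not> b < a" using less.prems(3) by auto
    have "{..a} = insert a {..<a}" by auto
    then have X2: "X2 \<inter> vt ` {..a} = {}" using less.prems(3) w(6,8) by auto
    have R2: "R2 \<subseteq> E - {e}" using less.prems(4) w(5) by auto
    from w(10) show ?thesis
    proof (elim disjE conjE)
      assume s: "b = Suc a" "R1 = {ed a}"
      have "X2 \<inter> vt ` {..<b} = {}" using X2 s by (simp add: lessThan_Suc_atMost)
      from less.hyps[OF w(9,4,1) this R2]
      show ?thesis
      proof
        assume "R2 = seg b n"
        then show ?thesis using w(5) s seg_Suc[of a n] less.prems(2) False by auto
      next
        assume "\<exists>D i j P Y. b \<le> i \<and> (i, j) \<in> ivals \<and> D \<in> bridges V E en C \<and> P \<subseteq> D \<and>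
          att en C D = {vt i, vt j} \<and> pth en (vt i) P Y (vt j) \<and> R2 = seg b i \<union> P \<union> seg j n"
        then obtain D i j P Y where h: "b \<le> i" "(i, j) \<in> ivals" "D \<in> bridges V E en C" "P \<subseteq> D"
          "att en C D = {vt i, vt j}" "pth en (vt i) P Y (vt j)" "R2 = seg b i \<union> P \<union> seg j n" by blast
        have "R = seg a i \<union> P \<union> seg j n" using w(5) h(1,7) s seg_Suc[of a i] by auto
        moreover have "a \<le> i" using h(1) s by simp
        ultimately show ?thesis using h(2-6) by blast
      qed
    next
      assume "Suc b = a" then show ?thesis using b by simp
    next
      assume "(b, a) \<in> ivals" then show ?thesis using b ivalsD[of b a] by simp
    next
      assume s: "(a, b) \<in> ivals" "\<exists>D\<in>bridges V E en C. R1 \<subseteq> D \<and> att en C D = {vt a, vt b}"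
      have "R2 = seg b n" using walk_after_jump[OF assms(1,2) s(1) w(4) order_refl w(1) X2 _ R2] by simp
      then have "R = seg a a \<union> R1 \<union> seg b n" using w(5) by (simp add: seg_def)
      then show ?thesis using s w(3) by blast
    qed
  qed
qed

text \<open>At position 0 the invariant of \<open>walk_from\<close> is vacuous; excluding
  \<open>Z = C\<close> leaves exactly the case of a detour.\<close>

lemma circle_through_root:
  assumes "two_att" "nested" "is_circle en E Z" "e \<in> Z" "Z \<noteq> C"
  obtains D i j P where "(i, j) \<in> ivals" "D \<in> bridges V E en C" "P \<subseteq> D" "att en C D = {vt i, vt j}"
    "is_path en P (vt i) (vt j)" "Z = P \<union> cseg i j"
proof -
  obtain R X where R: "pth en (vt 0) R X (vt n)" "Z = insert e R" "e \<notin> R"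
    using pth_if_is_circle[OF assms(3) fin assms(4) e_joins] n_pos by auto
  have RE: "R \<subseteq> E - {e}" using R assms(3) by (auto simp: is_circle_def)
  have "R \<noteq> seg 0 n" using R(2) assms(5) C_seg by auto
  moreover have "X \<inter> vt ` {..<0} = {}" by simp
  ultimately obtain D i j P Y where h: "(i, j) \<in> ivals" "D \<in> bridges V E en C" "P \<subseteq> D"
    "att en C D = {vt i, vt j}" "pth en (vt i) P Y (vt j)" "R = seg 0 i \<union> P \<union> seg j n"
    using walk_from[OF assms(1,2) R(1) le0 _ RE] by blast
  have "is_path en P (vt i) (vt j)" using is_path_if_pth[OF h(5)] ivalsD[OF h(1)] by simp
  moreover have "Z = P \<union> cseg i j" using R(2) h(6) by (auto simp: cseg_def)
  ultimately show ?thesis using that h by blast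
qed

end

section \<open>Batteries\<close>

lemma Int_pair:
  assumes "A \<subseteq> W" "X \<inter> W = {x, y}"
  shows "y \<notin> A \<Longrightarrow> A \<inter> X \<subseteq> {x}" "x \<notin> A \<Longrightarrow> X \<inter> A \<subseteq> {y}"
proof -
  have "A \<inter> X \<subseteq> {x, y}" unfolding assms(2)[symmetric] using assms(1) by auto
  then show "y \<notin> A \<Longrightarrow> A \<inter> X \<subseteq> {x}" "x \<notin> A \<Longrightarrow> X \<inter> A \<subseteq> {y}" by auto
qed

lemma sgn_of_flip:
  assumes "finite S"
  shows "sgn_of (\<sigma>(b := - \<sigma> b)) S = (if b \<in> S then - sgn_of \<sigma> S else sgn_of \<sigma> S)"
proof -
  have same: "sgn_of (\<sigma>(b := - \<sigma> b)) T = sgn_of \<sigma> T" if "b \<notin> T" for T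
    unfolding sgn_of_def using that by (intro prod.cong) auto
  show ?thesis
  proof (cases "b \<in> S")
    case True
    then obtain T where T: "S = insert b T" "b \<notin> T" by (meson Set.set_insert)
    then show ?thesis using assms same[OF T(2)] by (simp add: sgn_of_insert)
  qed (simp add: same)
qed

locale signed_frame = circle_frame V E en e vt ed n C
  for V :: "'v set" and E :: "'e set" and en :: "'e \<Rightarrow> 'v \<times> 'v" and e vt ed n C +
  fixes \<sigma> :: "'e \<Rightarrow> int"
  assumes sig: "\<And>f. f \<in> E \<Longrightarrow> \<sigma> f = 1 \<or> \<sigma> f = -1"
begin

abbreviation sg :: "'e set \<Rightarrow> int" where "sg \<equiv> sgn_of \<sigma>"

lemma sg_unit: "S \<subseteq> E \<Longrightarrow> sg S = 1 \<or> sg S = -1"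
  using sgn_of_unit[of S \<sigma>] sig by blast

lemma sg_sq: "S \<subseteq> E \<Longrightarrow> sg S * sg S = 1"
  using sg_unit[of S] by auto

lemma sg_C: "i \<le> j \<Longrightarrow> j \<le> n \<Longrightarrow> sg C = sg (seg i j) * sg (cseg i j)"
  using sgn_of_Un[OF finite_seg finite_cseg seg_cseg_disjoint, of i j \<sigma>] C_split by metis

lemma sg_seg_split: "i \<le> j \<Longrightarrow> j \<le> k \<Longrightarrow> k \<le> n \<Longrightarrow> sg (seg i k) = sg (seg i j) * sg (seg j k)"
  using sgn_of_Un[OF finite_seg finite_seg seg_disjoint[of j j k i], of \<sigma>] seg_split[of i j k] by simp

lemma seg_E: "j \<le> n \<Longrightarrow> seg i j \<subseteq> E" using seg_sub C_sub by blast

lemma arc_circle: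
  assumes "i < j" "j \<le> n" "pth en (vt i) P X (vt j)" "P \<subseteq> E" "P \<inter> C = {}" "X \<inter> verts en C = {vt i, vt j}"
  shows "is_circle en E (P \<union> cseg i j)" "e \<in> P \<union> cseg i j" "P \<union> cseg i j \<noteq> C"
    "sg (P \<union> cseg i j) = sg P * sg (cseg i j)"
proof -
  have 1: "pth en (vt 0) (seg 0 i) (vt ` {0..i}) (vt i)" using pth_seg assms by simp
  have 2: "pth en (vt j) (seg j n) (vt ` {j..n}) (vt n)" using pth_seg assms by simp
  have eC: "e \<in> C" using C_eq by auto
  have "seg 0 i \<union> seg j n \<union> P \<subseteq> E - {e}"
    using seg_E[of i 0] seg_E[of n j] e_notin_seg[of i 0] e_notin_seg[of n j] assms eC by auto
  moreover have "vt ` {0..i} \<inter> X \<subseteq> {vt i}"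
  proof -
    have "vt j \<notin> vt ` {0..i}" using vt_mem[of j "{0..i}"] assms by auto
    moreover have "vt ` {0..i} \<subseteq> verts en C" using assms verts_C by auto
    ultimately show ?thesis using Int_pair(1)[OF _ assms(6)] by metis
  qed
  moreover have "X \<inter> vt ` {j..n} \<subseteq> {vt j}"
  proof -
    have "vt i \<notin> vt ` {j..n}" using vt_mem[of i "{j..n}"] assms by auto
    moreover have "vt ` {j..n} \<subseteq> verts en C" using assms verts_C by auto
    ultimately show ?thesis using Int_pair(2)[OF _ assms(6)] by metis
  qed
  moreover have "vt ` {0..i} \<inter> vt ` {j..n} = {}" using assms by auto
  ultimately have "is_circle en E (insert e (seg 0 i \<union> P \<union> seg j n))" by (rule circle_of_link(1)[OF 1 2 assms(3)])
  moreover have "insert e (seg 0 i \<union> P \<union> seg j n) = P \<union> cseg i j" by (auto simp: cseg_def)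
  ultimately show "is_circle en E (P \<union> cseg i j)" by simp
  show "e \<in> P \<union> cseg i j" by (simp add: e_in_cseg)
  have "P \<noteq> {}" using pth_eq_iff[OF assms(3)] assms by auto
  then show "P \<union> cseg i j \<noteq> C" using assms(5) by auto
  have "P \<inter> cseg i j = {}" using assms(5) C_split[of i j] assms(1,2) by auto
  then show "sg (P \<union> cseg i j) = sg P * sg (cseg i j)"
    using sgn_of_Un[OF _ finite_cseg] pth_finite[OF assms(3)] by blast
qed

lemma ival_path:
  assumes "(i, j) \<in> ivals"
  obtains D P X where "D \<in> bridges V E en C" "att en C D = {vt i, vt j}" "pth en (vt i) P X (vt j)" "P \<subseteq> D"
    "X \<inter> verts en C = {vt i, vt j}"
proof -
  obtain D where D: "D \<in> bridges V E en C" "att en C D = {vt i, vt j}"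
    using assms unfolding ivals_def star_chords_def by auto
  have ne: "vt i \<noteq> vt j" using ivalsD[OF assms] by simp
  have at: "vt i \<in> att en C D" "vt j \<in> att en C D" using D(2) by auto
  show ?thesis using bridge_path[OF D(1) at ne] that[OF D] by blast
qed

section \<open>Consequences of a battery, for both signs of \<open>C\<close>\<close>

context
  assumes battery: "\<And>Z. is_circle en E Z \<Longrightarrow> e \<in> Z \<Longrightarrow> Z \<noteq> C \<Longrightarrow> sg Z = - sg C"
begin

text \<open>The basic exchange: \<open>C\<close> and \<open>P \<union> cseg i j\<close> have
  opposite signs and share the factor of \<open>cseg i j\<close>, which cancels.\<close>

lemma arc_sign:
  assumes "i < j" "j \<le> n" "pth en (vt i) P X (vt j)" "P \<subseteq> E" "P \<inter> C = {}" "X \<inter> verts en C = {vt i, vt j}"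
  shows "sg P = - sg (seg i j)"
proof -
  have "sg P * sg (cseg i j) = - (sg (seg i j) * sg (cseg i j))"
    using battery[OF arc_circle(1-3)[OF assms]] arc_circle(4)[OF assms] sg_C[of i j] assms by simp
  moreover have "cseg i j \<subseteq> E" using C_split[of i j] C_sub assms by auto
  ultimately show ?thesis using sg_unit[of "cseg i j"] by auto
qed

lemma bridge_arc_sign:
  assumes "i < j" "j \<le> n" "pth en (vt i) P X (vt j)" "D \<in> bridges V E en C" "P \<subseteq> D" "X \<inter> verts en C = {vt i, vt j}"
  shows "sg P = - sg (seg i j)"
  using arc_sign[OF assms(1-3) _ _ assms(6)] bridge_sub[OF assms(4)] bridge_disjoint[OF assms(4)] assms(5) by blast

text \<open>With three attachments, any two arms of a tripod form a detour. In the product of the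
  three sign equations every arm occurs twice, and the arcs cancel because \<open>seg i k\<close> is
  composed of the other two; what remains is 1 = -1.\<close>

lemma two_att_if_battery: "two_att"
  unfolding two_att_def
proof (rule ballI, rule ccontr)
  fix D assume D: "D \<in> bridges V E en C" and c: "card (att en C D) \<noteq> 2"
  obtain x y where xy: "x \<noteq> y" "x \<in> att en C D" "y \<in> att en C D"
    using bridge_two_att[OF C_sub _ D] C_eq by blast
  have "att en C D \<noteq> {x, y}" using c xy(1) by auto
  then obtain z where z: "z \<in> att en C D" "z \<noteq> x" "z \<noteq> y" using xy by blast
  have "att en C D \<subseteq> vt ` {..n}" using verts_C by (auto simp: att_def)
  then obtain a b c where abc: "x = vt a" "y = vt b" "z = vt c" "a \<le> n" "b \<le> n" "c \<le> n" using xy z by blast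
  then have "a \<noteq> b" "a \<noteq> c" "b \<noteq> c" using xy z by auto
  then have "\<exists>i j k. i < j \<and> j < k \<and> {i, j, k} = {a, b, c}"
    by (metis insert_commute linorder_neqE_nat)
  then obtain i j k where ijk: "i < j" "j < k" "{i, j, k} = {a, b, c}" by blast
  have "i \<in> {a, b, c}" "j \<in> {a, b, c}" "k \<in> {a, b, c}" using ijk(3) by blast+
  then have at: "vt i \<in> att en C D" "vt j \<in> att en C D" "vt k \<in> att en C D" "k \<le> n" using abc xy z by auto
  have "distinct [vt i, vt j, vt k]" using ijk at by auto
  then obtain m A XA B XB G XG where t: "m \<notin> verts en C" "pth en (vt i) A XA m" "pth en (vt j) B XB m" "pth en (vt k) G XG m"
    "A \<union> B \<union> G \<subseteq> D" "XA \<inter> XB = {m}" "XA \<inter> XG = {m}" "XB \<inter> XG = {m}"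
    "XA \<inter> verts en C = {vt i}" "XB \<inter> verts en C = {vt j}" "XG \<inter> verts en C = {vt k}"
    by (rule bridge_tripod[OF D at(1-3)])
  have arm: "sg P * sg Q = - sg (seg a b)"
    if h: "a < b" "b \<le> n" "pth en (vt a) P X m" "pth en (vt b) Q Y m" "P \<union> Q \<subseteq> D" "X \<inter> Y = {m}"
      "X \<inter> verts en C = {vt a}" "Y \<inter> verts en C = {vt b}" for a b P Q X Y
  proof -
    have "pth en (vt a) (P \<union> Q) (X \<union> Y) (vt b)" using pth_append[OF h(3) pth_rev[OF h(4)]] h(6) by simp
    moreover have "(X \<union> Y) \<inter> verts en C = {vt a, vt b}" unfolding Int_Un_distrib2 h(7,8) by auto
    ultimately have "sg (P \<union> Q) = - sg (seg a b)" using bridge_arc_sign[OF h(1,2) _ D h(5)] by blast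
    moreover have "P \<inter> Q = {}" using pth_disjoint[OF h(3,4)] h(6) by simp
    ultimately show ?thesis using sgn_of_Un[of P Q \<sigma>] pth_finite[OF h(3)] pth_finite[OF h(4)] by simp
  qed
  have 1: "sg A * sg B = - sg (seg i j)" using arm[OF ijk(1) _ t(2,3)] t ijk at by auto
  have 2: "sg B * sg G = - sg (seg j k)" using arm[OF ijk(2) _ t(3,4)] t at by auto
  have 3: "sg A * sg G = - sg (seg i k)" using arm[OF _ _ t(2,4)] t ijk at by auto
  have 4: "sg (seg i k) = sg (seg i j) * sg (seg j k)" using sg_seg_split ijk at by simp
  have "A \<subseteq> E" "B \<subseteq> E" "G \<subseteq> E" using t(5) bridge_sub[OF D] by auto
  then show False using sg_unit[of A] sg_unit[of B] sg_unit[of G] 1 2 3 4 by auto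
qed

text \<open>
  One circle settles both ways of not being nested: leave \<open>C\<close> at \<open>i\<close> for \<open>j\<close>, follow \<open>C\<close>
  from \<open>j\<close> to \<open>k\<close> (backwards if the chords cross), leave again for \<open>l\<close>. Both detours
  reverse the sign, so this circle has the sign of \<open>C\<close>.
\<close>

lemma no_overlap:
  assumes ij: "(i, j) \<in> ivals" and kl: "(k, l) \<in> ivals" and o: "i < k" "j < l"
  shows False
proof -
  obtain D P X where P: "D \<in> bridges V E en C" "att en C D = {vt i, vt j}" "pth en (vt i) P X (vt j)" "P \<subseteq> D"
    "X \<inter> verts en C = {vt i, vt j}" using ival_path[OF ij] .
  obtain D' P' X' where P': "D' \<in> bridges V E en C" "att en C D' = {vt k, vt l}" "pth en (vt k) P' X' (vt l)" "P' \<subseteq> D'"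
    "X' \<inter> verts en C = {vt k, vt l}" using ival_path[OF kl] .
  note d = ivalsD[OF ij] ivalsD[OF kl]
  have ne: "vt i \<noteq> vt j" "vt k \<noteq> vt l" using d by auto
  \<comment> \<open>Different attachments mean different bridges, so the detours can meet only on
    \<open>C\<close>, and there only in case \<open>j = k\<close>.\<close>
  have "vt i \<notin> {vt k, vt l}" using d o by auto
  then have "D \<noteq> D'" using P(2) P'(2) by auto
  then have "X \<inter> X' \<subseteq> verts en C"
    using bridges_meet[OF P(1) P'(1)] verts_mono[OF P(4), of en] verts_mono[OF P'(4), of en]
      pth_verts[OF P(3) ne(1)] pth_verts[OF P'(3) ne(2)] by blast
  then have "X \<inter> X' \<subseteq> {vt i, vt j} \<inter> {vt k, vt l}" using P(5) P'(5) by blast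
  then have XX: "X \<inter> X' \<subseteq> {vt k}" using d o by auto
  \<comment> \<open>The ends of the stretch of \<open>C\<close> between \<open>j\<close> and
    \<open>k\<close> in increasing order, whichever of the two comes first.\<close>
  define p q where "p = min j k" and "q = max j k"
  have pq: "i < p" "p \<le> q" "q < l" "q \<le> n" "j \<in> {p..q}" "k \<in> {p..q}" using d o by (auto simp: p_def q_def)
  have M: "pth en (vt j) (seg p q) (vt ` {p..q}) (vt k)"
    using pth_seg[OF pq(2,4)] pth_rev[OF pth_seg[OF pq(2,4)]] by (auto simp: p_def q_def min_def max_def)
  have XK: "vt ` K \<inter> X \<subseteq> vt ` (K \<inter> {i, j})" if "K \<subseteq> {..n}" for K
  proof
    fix v assume v: "v \<in> vt ` K \<inter> X"
    then have "v \<in> verts en C" using that verts_C by auto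
    then have "v \<in> vt ` {i, j}" using v P(5) by auto
    then show "v \<in> vt ` (K \<inter> {i, j})" using v inj_on_image_Int[OF inj_vt that, of "{i, j}"] d by auto
  qed
  have XK': "vt ` K \<inter> X' \<subseteq> vt ` (K \<inter> {k, l})" if "K \<subseteq> {..n}" for K
  proof
    fix v assume v: "v \<in> vt ` K \<inter> X'"
    then have "v \<in> verts en C" using that verts_C by auto
    then have "v \<in> vt ` {k, l}" using v P'(5) by auto
    then show "v \<in> vt ` (K \<inter> {k, l})" using v inj_on_image_Int[OF inj_vt that, of "{k, l}"] d by auto
  qed
  have VV: "vt ` K \<inter> vt ` L = vt ` (K \<inter> L)" if "K \<subseteq> {..n}" "L \<subseteq> {..n}" for K L
    using inj_on_image_Int[OF inj_vt that] by simp
  have S: "pth en (vt 0) (seg 0 i) (vt ` {0..i}) (vt i)" using pth_seg d by simp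
  have T: "pth en (vt l) (seg l n) (vt ` {l..n}) (vt n)" using pth_seg d by simp
  have sP: "vt ` {0..i} \<inter> X \<subseteq> {vt i}"
  proof -
    have "{0..i} \<inter> {i, j} = {i}" using d by auto
    then show ?thesis using XK[of "{0..i}"] d by auto
  qed
  have sM: "vt ` {0..i} \<inter> vt ` {p..q} = {}" "vt ` {0..i} \<inter> vt ` {l..n} = {}" "vt ` {p..q} \<inter> vt ` {l..n} = {}"
    using VV[of "{0..i}" "{p..q}"] VV[of "{0..i}" "{l..n}"] VV[of "{p..q}" "{l..n}"] pq d o by auto
  have PM: "X \<inter> vt ` {p..q} \<subseteq> {vt j}"
  proof -
    have "{p..q} \<inter> {i, j} = {j}" using pq by auto
    then show ?thesis using XK[of "{p..q}"] pq by auto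
  qed
  have PT: "X \<inter> vt ` {l..n} = {}"
  proof -
    have "{l..n} \<inter> {i, j} = {}" using d o by auto
    then show ?thesis using XK[of "{l..n}"] by auto
  qed
  have sP': "vt ` {0..i} \<inter> X' = {}"
  proof -
    have "{0..i} \<inter> {k, l} = {}" using d o by auto
    then show ?thesis using XK'[of "{0..i}"] d by auto
  qed
  have MP': "vt ` {p..q} \<inter> X' \<subseteq> {vt k}"
  proof -
    have "{p..q} \<inter> {k, l} = {k}" using pq by auto
    then show ?thesis using XK'[of "{p..q}"] pq by auto
  qed
  have P'T: "X' \<inter> vt ` {l..n} \<subseteq> {vt l}"
  proof -
    have "{l..n} \<inter> {k, l} = {l}" using d by auto
    then show ?thesis using XK'[of "{l..n}"] by auto
  qed
  have 2: "pth en (vt 0) (seg 0 i \<union> P) (vt ` {0..i} \<union> X) (vt j)" using pth_append[OF S P(3) sP] .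
  have 3: "pth en (vt 0) (seg 0 i \<union> P \<union> seg p q) (vt ` {0..i} \<union> X \<union> vt ` {p..q}) (vt k)"
    by (rule pth_append[OF 2 M]) (simp add: Int_Un_distrib2 sM PM)
  have 4: "pth en (vt 0) (seg 0 i \<union> P \<union> seg p q \<union> P') (vt ` {0..i} \<union> X \<union> vt ` {p..q} \<union> X') (vt l)"
    by (rule pth_append[OF 3 P'(3)]) (simp add: Int_Un_distrib2 sP' XX MP')
  let ?R = "seg 0 i \<union> P \<union> seg p q \<union> P' \<union> seg l n"
  have 5: "pth en (vt 0) ?R (vt ` {0..i} \<union> X \<union> vt ` {p..q} \<union> X' \<union> vt ` {l..n}) (vt n)"
    by (rule pth_append[OF 4 T]) (simp add: Int_Un_distrib2 sM PT P'T)
  have PC: "P \<inter> C = {}" "P' \<inter> C = {}" "P \<subseteq> E" "P' \<subseteq> E"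
    using bridge_disjoint[OF P(1)] bridge_disjoint[OF P'(1)] bridge_sub[OF P(1)] bridge_sub[OF P'(1)] P(4) P'(4) by blast+
  have sC: "seg 0 i \<subseteq> C" "seg p q \<subseteq> C" "seg l n \<subseteq> C" using seg_sub d pq by auto
  have eC: "e \<in> C" using C_eq by auto
  have eR: "e \<notin> ?R" using PC eC e_notin_seg[of i 0] e_notin_seg[of q p] e_notin_seg[of n l] d pq by auto
  have RE: "insert e ?R \<subseteq> E" using PC sC C_sub eC by blast
  have circ: "is_circle en E (insert e ?R)"
    by (rule is_circle_if_pth[OF 5 _ e_joins eR RE]) (use n_pos in auto)
  have "P \<noteq> {}" using pth_eq_iff[OF P(3)] ne by auto
  then have "insert e ?R \<noteq> C" using PC(1) by blast
  then have neg: "sg (insert e ?R) = - sg C" using battery circ by blast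
  have fn: "finite P" "finite P'" using pth_finite[OF P(3)] pth_finite[OF P'(3)] by auto
  have dj: "seg 0 i \<inter> P = {}" "(seg 0 i \<union> P) \<inter> seg p q = {}" "(seg 0 i \<union> P \<union> seg p q) \<inter> P' = {}"
     "(seg 0 i \<union> P \<union> seg p q \<union> P') \<inter> seg l n = {}"
  proof -
    have PP: "P \<inter> P' = {}" using pth_disjoint[OF P(3) P'(3) XX] .
    have ss: "seg 0 i \<inter> seg p q = {}" "seg 0 i \<inter> seg l n = {}" "seg p q \<inter> seg l n = {}"
      using seg_disjoint d o pq by auto
    show "seg 0 i \<inter> P = {}" "(seg 0 i \<union> P) \<inter> seg p q = {}" "(seg 0 i \<union> P \<union> seg p q) \<inter> P' = {}"
      "(seg 0 i \<union> P \<union> seg p q \<union> P') \<inter> seg l n = {}" using PP ss PC sC by blast+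
  qed
  have "sg (insert e ?R) = \<sigma> e * sg ?R" by (rule sgn_of_insert) (use fn eR in auto)
  also have "sg ?R = sg (seg 0 i) * sg P * sg (seg p q) * sg P' * sg (seg l n)"
    using fn dj by (simp add: sgn_of_Un)
  finally have sR: "sg (insert e ?R) = \<sigma> e * (sg (seg 0 i) * sg P * sg (seg p q) * sg P' * sg (seg l n))" .
  have aP: "sg P = - sg (seg i j)" using bridge_arc_sign[OF _ _ P(3,1,4,5)] d by simp
  have aP': "sg P' = - sg (seg k l)" using bridge_arc_sign[OF _ _ P'(3,1,4,5)] d by simp
  have "sg C = \<sigma> e * sg (seg 0 n)" unfolding C_seg by (rule sgn_of_insert) (auto simp: e_notin_seg)
  also have "sg (seg 0 n) = sg (seg 0 i) * sg (seg i p) * sg (seg p q) * sg (seg q l) * sg (seg l n)"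
    using sg_seg_split[of 0 i n] sg_seg_split[of i p n] sg_seg_split[of p q n] sg_seg_split[of q l n] d pq by simp
  finally have sgC: "sg C = \<sigma> e * (sg (seg 0 i) * sg (seg i p) * sg (seg p q) * sg (seg q l) * sg (seg l n))" .
  \<comment> \<open>If the chords cross, both arcs contain the stretch from \<open>p\<close> to
    \<open>q\<close>, whose sign squares to 1; otherwise the arcs are the two outer stretches
    themselves.\<close>
  have jk: "sg (seg i j) * sg (seg k l) = sg (seg i p) * sg (seg q l)"
  proof (cases "j \<le> k")
    case True
    then show ?thesis by (simp add: p_def q_def)
  next
    case False
    then have e: "p = k" "q = j" by (auto simp: p_def q_def)
    have "sg (seg i j) = sg (seg i p) * sg (seg p q)" "sg (seg k l) = sg (seg p q) * sg (seg q l)"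
      using sg_seg_split[of i k j] sg_seg_split[of k j l] e d o False by auto
    then show ?thesis using sg_sq[OF seg_E[of q p]] pq by simp
  qed
  have "sg (insert e ?R) = \<sigma> e * (sg (seg 0 i) * (sg (seg i j) * sg (seg k l)) * sg (seg p q) * sg (seg l n))"
    unfolding sR aP aP' by (simp add: mult_ac)
  also have "\<dots> = sg C" unfolding jk sgC by (simp add: mult_ac)
  finally show False using neg sg_unit[OF C_sub] by auto
qed

text \<open>If neither of two intervals contains the other, then, up to exchanging them, both the
  left ends and the right ends are in strictly increasing order.\<close>

lemma nested_if_battery: "nested"
  unfolding nested_def using no_overlap by (meson linorder_not_le nat_less_le)

end

section \<open>The two cases of the characterization\<close>

text \<open>For the arc without \<open>e\<close> this is \<open>bridge_arc_sign\<close>. The other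
  arc has the same sign, because the two arcs multiply to the positive sign of
  \<open>C\<close>.\<close>

lemma pos_cond_if_battery:
  assumes "pos_battery E en \<sigma> e C" "D \<in> bridges V E en C" "P \<subseteq> D" "u \<in> att en C D" "w \<in> att en C D"
    "is_path en P u w" "Q \<subseteq> C" "is_path en Q u w"
  shows "sg (P \<union> Q) = -1"
proof -
  have sgC: "sg C = 1" using assms(1) by (simp add: pos_battery_def)
  have bat: "sg Z = - sg C" if "is_circle en E Z" "e \<in> Z" "Z \<noteq> C" for Z
  proof -
    have "sg Z \<noteq> 1" using assms(1) that by (auto simp: pos_battery_def)
    then show ?thesis using sg_unit[of Z] that(1) sgC by (auto simp: is_circle_def)
  qed
  have two: "two_att" by (rule two_att_if_battery[OF bat])
  have uw: "u \<noteq> w" "{u, w} \<subseteq> verts en C" using assms(4-6) by (auto simp: is_path_def att_def)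
  obtain i j where ij: "i < j" "j \<le> n" "{u, w} = {vt i, vt j}" using pair_ordered[OF uw(2,1)] .
  then have "u = vt i \<and> w = vt j \<or> u = vt j \<and> w = vt i" by (auto simp: doubleton_eq_iff)
  then have p: "is_path en P (vt i) (vt j)" "is_path en Q (vt i) (vt j)" using assms(6,8) is_path_sym by metis+
  have pp: "pth en (vt i) P (verts en P) (vt j)" using pth_if_is_path[OF p(1)] .
  have "card (att en C D) = 2" using two assms(2) by (auto simp: two_att_def)
  then have "att en C D = {u, w}" using assms(4,5) uw(1) by (metis card_2_iff doubleton_eq_iff insertE singletonD)
  then have "verts en P \<inter> verts en C \<subseteq> {vt i, vt j}" using verts_mono[OF assms(3), of en] ij(3) by (auto simp: att_def)
  then have X: "verts en P \<inter> verts en C = {vt i, vt j}" using pth_ends[OF pp] vt_in_C ij by auto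
  have sP: "sg P = - sg (seg i j)" by (rule bridge_arc_sign[OF bat ij(1,2) pp assms(2,3) X])
  have "P \<inter> Q = {}" using bridge_disjoint[OF assms(2)] assms(3,7) by blast
  moreover have "finite P" "finite Q" using p by (auto simp: is_path_def)
  ultimately have PQ: "sg (P \<union> Q) = sg P * sg Q" using sgn_of_Un by blast
  have "Q = seg i j \<or> Q = cseg i j" using paths_in_C[OF ij(1,2) assms(7) p(2)] .
  then show ?thesis
  proof
    assume "Q = seg i j"
    then show ?thesis using PQ sP sg_sq[OF seg_E[OF ij(2)], of i] by simp
  next
    assume "Q = cseg i j"
    then show ?thesis using PQ sP sg_C[of i j] sgC ij by simp
  qed
qed

lemma balancing_edge_if_battery:
  assumes "neg_battery E en \<sigma> e C"
  shows "two_att" "nested" "\<exists>H. is_handle V E en C H \<and> e \<notin> H \<and> (\<exists>b\<in>H. balancing_edge V E en \<sigma> b)"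
proof -
  have sgC: "sg C = -1" using assms(1) by (simp add: neg_battery_def)
  have bat: "sg Z = - sg C" if "is_circle en E Z" "e \<in> Z" "Z \<noteq> C" for Z
  proof -
    have "sg Z \<noteq> -1" using assms(1) that by (auto simp: neg_battery_def)
    then show ?thesis using sg_unit[of Z] that(1) sgC by (auto simp: is_circle_def)
  qed
  show two: "two_att" by (rule two_att_if_battery[OF bat])
  show nest: "nested" by (rule nested_if_battery[OF bat])
  obtain i j where ij: "(i, j) \<in> ivals" "\<And>k l. (k, l) \<in> ivals \<Longrightarrow> k \<le> i \<and> j \<le> l" using nested_min[OF two nest] by metis
  obtain k l where kl: "(k, l) \<in> ivals" "\<And>a b. (a, b) \<in> ivals \<Longrightarrow> k \<le> a \<and> b \<le> l" using nested_max[OF two nest] by metis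
  have h: "is_handle V E en C (seg i j)" using nested_handles[OF two nest ij kl] by blast
  note d = ivalsD[OF ij(1)]
  define b where "b = ed i"
  have b: "b \<in> seg i j" using d ed_in_seg[of i j i] by (simp add: b_def)
  have bC: "b \<in> C" "b \<in> E" using b seg_sub C_sub d by blast+
  let ?s = "\<sigma>(b := - \<sigma> b)"
  note fl = sgn_of_flip[where \<sigma> = \<sigma> and b = b]
  have pos: "sgn_of ?s Z = 1" if Z: "is_circle en E Z" "e \<in> Z" for Z
  proof (cases "Z = C")
    case True
    then show ?thesis using fl[of C] bC sgC fin C_sub finite_subset by auto
  next
    case False
    obtain D a c P where h: "(a, c) \<in> ivals" "D \<in> bridges V E en C" "P \<subseteq> D" "Z = P \<union> cseg a c"
      using circle_through_root[OF two nest Z False] by metis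
    \<comment> \<open>Every interval contains the inner handle, so every circle through
      \<open>e\<close> other than \<open>C\<close> bypasses the flipped edge.\<close>
    have "a \<le> i" "j \<le> c" "c \<le> n" using ij(2)[OF h(1)] ivalsD[OF h(1)] by auto
    then have "b \<in> seg a c" using d ed_in_seg[of i c a] by (simp add: b_def)
    then have "b \<notin> cseg a c" using seg_cseg_disjoint[of a c] ivalsD[OF h(1)] by auto
    moreover have "b \<notin> P" using bridge_disjoint[OF h(2)] h(3) bC by blast
    ultimately have "b \<notin> Z" using h(4) by simp
    moreover have "finite Z" using Z(1) fin finite_subset by (auto simp: is_circle_def)
    ultimately show ?thesis using fl[of Z] bat[OF Z False] sgC by simp
  qed
  have "?s f = 1 \<or> ?s f = -1" if "f \<in> E" for f using sig[OF that] by auto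
  then obtain \<zeta> where z: "good_edges en ?s \<zeta> E" using balanced_if_root_circles_positive[of ?s] pos by metis
  have "balancing_edge V E en \<sigma> b"
    unfolding balancing_edge_def
  proof (intro conjI exI[of _ \<zeta>] ballI)
    show "b \<in> E" by fact
    show "\<zeta> v = 1 \<or> \<zeta> v = -1" for v using z by (auto simp: good_edges_def)
    fix f assume f: "f \<in> E"
    have "\<zeta> (fst (en f)) * ?s f * \<zeta> (snd (en f)) = 1" using z f by (auto simp: good_edges_def)
    \<comment> \<open>Undoing the flip makes \<open>b\<close> negative and leaves all other edges
      positive.\<close>
    then show "(\<zeta> (fst (en f)) * \<sigma> f * \<zeta> (snd (en f)) = - 1) = (f = b)" by (cases "f = b") auto
  qed
  moreover have "e \<notin> seg i j" using e_notin_seg d by auto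
  ultimately show "\<exists>H. is_handle V E en C H \<and> e \<notin> H \<and> (\<exists>b\<in>H. balancing_edge V E en \<sigma> b)" using h b by blast
qed

lemma layered_if_pos_battery:
  assumes "pos_battery E en \<sigma> e C"
  shows "two_att" "nested"
proof -
  have bat: "sg Z = - sg C" if "is_circle en E Z" "e \<in> Z" "Z \<noteq> C" for Z
  proof -
    have "sg Z \<noteq> 1" "sg C = 1" using assms(1) that by (auto simp: pos_battery_def)
    then show ?thesis using sg_unit[of Z] that(1) by (auto simp: is_circle_def)
  qed
  show "two_att" by (rule two_att_if_battery[OF bat])
  show "nested" by (rule nested_if_battery[OF bat])
qed

lemma circle_C: "is_circle en E C"
  unfolding C_seg
  by (rule is_circle_if_pth[OF pth_seg _ e_joins]) (use n_pos C_sub C_seg e_notin_seg in auto)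

text \<open>With the sign of \<open>b\<close> reversed all circles through \<open>e\<close> are
  positive, so originally such a circle is negative exactly if it contains \<open>b\<close>. As
  \<open>b\<close> is in the inner handle, only \<open>C\<close> does.\<close>

lemma neg_battery_if_balancing_edge:
  assumes "two_att" "nested" "is_handle V E en C H" "e \<notin> H" "b \<in> H" "balancing_edge V E en \<sigma> b"
  shows "neg_battery E en \<sigma> e C"
proof -
  obtain i j where ij: "H = seg i j" "(i, j) \<in> ivals" "\<And>k l. (k, l) \<in> ivals \<Longrightarrow> k \<le> i \<and> j \<le> l"
    using inner_handle[OF assms(1-4)] by metis
  obtain \<zeta> :: "'v \<Rightarrow> int" where z: "\<forall>v\<in>V. \<zeta> v = 1 \<or> \<zeta> v = -1"
    "\<forall>f\<in>E. (\<zeta> (fst (en f)) * \<sigma> f * \<zeta> (snd (en f)) = -1) \<longleftrightarrow> f = b" and bE: "b \<in> E"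
    using assms(6) unfolding balancing_edge_def by blast
  \<comment> \<open>\<open>good_edges\<close> asks for values 1 or -1 on the whole type, so \<zeta>
    is replaced by 1 outside \<open>V\<close>.\<close>
  define z' where "z' v = (if v \<in> V then \<zeta> v else 1)" for v
  let ?s = "\<sigma>(b := - \<sigma> b)"
  have good: "good_edges en ?s z' E"
    unfolding good_edges_def
  proof (intro conjI allI ballI)
    show "z' v = 1 \<or> z' v = -1" for v using z(1) by (auto simp: z'_def)
    fix f assume f: "f \<in> E"
    have V: "fst (en f) \<in> V" "snd (en f) \<in> V" using inc[OF f joins_ends] inc[OF f joins_sym[OF joins_ends]] by auto
    have "\<zeta> (fst (en f)) = 1 \<or> \<zeta> (fst (en f)) = -1" "\<zeta> (snd (en f)) = 1 \<or> \<zeta> (snd (en f)) = -1" using z(1) V by auto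
    moreover have "(\<zeta> (fst (en f)) * \<sigma> f * \<zeta> (snd (en f)) = -1) \<longleftrightarrow> f = b" using z(2) f by blast
    ultimately show "z' (fst (en f)) * ?s f * z' (snd (en f)) = 1" using V sig[OF f] by (auto simp: z'_def)
  qed
  have pos: "sgn_of ?s Z = 1" if Z: "is_circle en E Z" "e \<in> Z" for Z
  proof -
    obtain R X where R: "pth en (vt 0) R X (vt n)" "Z = insert e R" "e \<notin> R"
      using pth_if_is_circle[OF Z(1) fin Z(2) e_joins] n_pos by auto
    have "R \<subseteq> E" using R(2) Z(1) by (auto simp: is_circle_def)
    then have "sgn_of ?s R = z' (vt 0) * z' (vt n)" using pth_sgn[OF R(1)] good_edges_mono[OF good] by blast
    moreover have "?s e = z' (vt 0) * z' (vt n)" using good_edges_joins[OF good e_in_E e_joins] .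
    moreover have "sgn_of ?s Z = ?s e * sgn_of ?s R" using sgn_of_insert R pth_finite[OF R(1)] by metis
    moreover have "z' v = 1 \<or> z' v = -1" for v using good by (auto simp: good_edges_def)
    then have "z' (vt 0) = 1 \<or> z' (vt 0) = -1" "z' (vt n) = 1 \<or> z' (vt n) = -1" by blast+
    ultimately show ?thesis by auto
  qed
  note fl = sgn_of_flip[where \<sigma> = \<sigma> and b = b]
  have fC: "finite C" using fin C_sub finite_subset by blast
  note d = ivalsD[OF ij(2)]
  have bC: "b \<in> C" using assms(5) ij(1) seg_sub d by blast
  have eC: "e \<in> C" using C_eq by auto
  have "sg C = -1" using pos[OF circle_C eC] fl[OF fC] bC by simp
  moreover have "Z = C" if Z: "is_circle en E Z" "e \<in> Z" "sg Z = -1" for Z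
  proof (rule ccontr)
    assume ne: "Z \<noteq> C"
    obtain D a c P where h: "(a, c) \<in> ivals" "D \<in> bridges V E en C" "P \<subseteq> D" "Z = P \<union> cseg a c"
      using circle_through_root[OF assms(1,2) Z(1,2) ne] by metis
    have ac: "a \<le> i" "j \<le> c" "c \<le> n" using ij(3)[OF h(1)] ivalsD[OF h(1)] by auto
    then have "b \<in> seg a c" using assms(5) ij(1) unfolding seg_def by auto
    then have "b \<notin> cseg a c" using seg_cseg_disjoint[of a c] ivalsD[OF h(1)] by auto
    moreover have "b \<notin> P" using bridge_disjoint[OF h(2)] h(3) bC by blast
    ultimately have "b \<notin> Z" using h(4) by simp
    moreover have "finite Z" using Z(1) fin finite_subset by (auto simp: is_circle_def)
    ultimately show False using fl[of Z] pos[OF Z(1,2)] Z(3) by simp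
  qed
  ultimately show ?thesis unfolding neg_battery_def using circle_C eC by blast
qed

text \<open>A single bridge settles the sign of \<open>C\<close>: it is the product of the two
  negative circles through a path of the bridge, since the path counts twice. Every other circle
  through \<open>e\<close> is itself a path of a bridge closed by an arc.\<close>

lemma pos_battery_if_paths_negative:
  assumes "two_att" "nested"
    and neg: "\<And>D P u w Q. D \<in> bridges V E en C \<Longrightarrow> P \<subseteq> D \<Longrightarrow> u \<in> att en C D \<Longrightarrow> w \<in> att en C D \<Longrightarrow>
      is_path en P u w \<Longrightarrow> Q \<subseteq> C \<Longrightarrow> is_path en Q u w \<Longrightarrow> sg (P \<union> Q) = -1"
  shows "pos_battery E en \<sigma> e C"
proof -
  obtain i j where ij: "(i, j) \<in> ivals" using ivals_nonempty[OF assms(1)] by auto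
  note d = ivalsD[OF ij]
  obtain D P X where D: "D \<in> bridges V E en C" "att en C D = {vt i, vt j}"
      and P: "pth en (vt i) P X (vt j)" "P \<subseteq> D"
    using ival_path[OF ij] .
  have ne: "vt i \<noteq> vt j" using d by simp
  have p: "is_path en P (vt i) (vt j)" using is_path_if_pth[OF P(1) ne] .
  have sub: "seg i j \<subseteq> C" "cseg i j \<subseteq> C" using C_split[of i j] d by auto
  have n1: "sg (P \<union> seg i j) = -1" using neg[OF D(1) P(2) _ _ p sub(1)] D(2) is_path_seg d by blast
  have n2: "sg (P \<union> cseg i j) = -1" using neg[OF D(1) P(2) _ _ p sub(2)] D(2) is_path_cseg d by blast
  have dj: "P \<inter> seg i j = {}" "P \<inter> cseg i j = {}" using bridge_disjoint[OF D(1)] P(2) sub by blast+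
  have fP: "finite P" using pth_finite[OF P(1)] by simp
  have "sg P * sg (seg i j) = -1" "sg P * sg (cseg i j) = -1"
    using n1 n2 sgn_of_Un[OF fP _ dj(1)] sgn_of_Un[OF fP _ dj(2)] by auto
  moreover have "P \<subseteq> E" "seg i j \<subseteq> E" "cseg i j \<subseteq> E" using P(2) bridge_sub[OF D(1)] sub C_sub by auto
  then have "sg P = 1 \<or> sg P = -1" using sg_unit by blast
  ultimately have "sg C = 1" using sg_C[of i j] d by auto
  moreover have "Z = C" if Z: "is_circle en E Z" "e \<in> Z" "sg Z = 1" for Z
  proof (rule ccontr)
    assume ne: "Z \<noteq> C"
    obtain D a c P where h: "(a, c) \<in> ivals" "D \<in> bridges V E en C" "P \<subseteq> D" "att en C D = {vt a, vt c}"
        "is_path en P (vt a) (vt c)" "Z = P \<union> cseg a c"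
      using circle_through_root[OF assms(1,2) Z(1,2) ne] by metis
    have "cseg a c \<subseteq> C" using C_split[of a c] ivalsD[OF h(1)] by auto
    then have "sg Z = -1" unfolding h(6) using neg[OF h(2,3) _ _ h(5)] h(4) is_path_cseg ivalsD[OF h(1)] by blast
    then show False using Z(3) by simp
  qed
  moreover have "e \<in> C" using C_eq by auto
  ultimately show ?thesis unfolding pos_battery_def using circle_C by blast
qed

end

text \<open>Connectivity forces another edge at the vertex of the loop, which then separates the
  loop from the remaining edges.\<close>

lemma block_no_loop:
  assumes sg: "signed_graph V E en \<sigma>" and blk: "is_block V E en" and not_edge: "\<not> (\<exists>f. E = {f})" and f: "f \<in> E"
  shows "fst (en f) \<noteq> snd (en f)"
proof
  assume loop: "fst (en f) = snd (en f)"
  define v where "v = fst (en f)"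
  have j: "joins en f v v" using loop by (simp add: joins_def v_def prod_eq_iff)
  have vf: "verts en {f} = {v}" using verts_insert[OF j, of "{}"] by simp
  have E2: "E - {f} \<noteq> {}" using not_edge f by blast
  have "v \<in> verts en (E - {f})"
  proof (rule ccontr)
    assume v: "v \<notin> verts en (E - {f})"
    obtain g where g: "g \<in> E - {f}" using E2 by blast
    have V: "v \<in> V" "fst (en g) \<in> V" using sg f g by (auto simp: signed_graph_def v_def)
    then have "(v, fst (en g)) \<in> (adj en E)\<^sup>*" using blk by (auto simp: is_block_def connected_graph_def)
    then have "fst (en g) \<in> {v}"
    proof (rule verts_closed)
      fix h x y assume h: "h \<in> E" "joins en h x y" "x \<in> {v}"
      have "h = f" using v in_vertsI[of h "E - {f}" en x y] h by auto
      then show "y \<in> {v}" using joins_unique[OF j] h(2) by auto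
    qed simp
    then show False using v in_vertsI[OF g joins_ends] by auto
  qed
  then have "verts en {f} \<inter> verts en (E - {f}) = {v}" using vf by auto
  then have "has_cutpoint E en" unfolding has_cutpoint_def using E2 f
    by (intro exI[of _ "{f}"] exI[of _ "E - {f}"] exI[of _ v]) auto
  then show False using blk by (simp add: is_block_def)
qed

theorem mainTheorem3:
  fixes V :: "'v set" and E :: "'e set" and en :: "'e \<Rightarrow> 'v \<times> 'v"
    and \<sigma> :: "'e \<Rightarrow> int" and e :: 'e and C :: "'e set"
  assumes sg: "signed_graph V E en \<sigma>"
    and blk: "is_block V E en"
    and not_edge: "\<not> (\<exists>f. E = {f})"
    and not_circle: "\<not> is_circle en E E"
    and eE: "e \<in> E"
    and circC: "is_circle en E C"
    and eC: "e \<in> C"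
  shows "((neg_battery E en \<sigma> e C \<or> pos_battery E en \<sigma> e C) \<longleftrightarrow>
          (layered V E en C \<and> (\<exists>H. is_handle V E en C H \<and> e \<in> H) \<and>
           ((\<exists>H'. is_handle V E en C H' \<and> e \<notin> H' \<and> (\<exists>b\<in>H'. balancing_edge V E en \<sigma> b)) \<or>
            (\<forall>D\<in>bridges V E en C. \<forall>P u w. P \<subseteq> D \<and> u \<in> att en C D \<and> w \<in> att en C D \<and>
                is_path en P u w \<longrightarrow>
                (\<forall>Q. Q \<subseteq> C \<and> is_path en Q u w \<longrightarrow> sgn_of \<sigma> (P \<union> Q) = -1)))))
     \<and> ((layered V E en C \<and> (\<exists>H. is_handle V E en C H \<and> e \<in> H) \<and>
          (\<exists>H'. is_handle V E en C H' \<and> e \<notin> H' \<and> (\<exists>b\<in>H'. balancing_edge V E en \<sigma> b)))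
         \<longrightarrow> neg_battery E en \<sigma> e C)
     \<and> ((layered V E en C \<and> (\<exists>H. is_handle V E en C H \<and> e \<in> H) \<and>
          (\<forall>D\<in>bridges V E en C. \<forall>P u w. P \<subseteq> D \<and> u \<in> att en C D \<and> w \<in> att en C D \<and>
                is_path en P u w \<longrightarrow>
                (\<forall>Q. Q \<subseteq> C \<and> is_path en Q u w \<longrightarrow> sgn_of \<sigma> (P \<union> Q) = -1)))
         \<longrightarrow> pos_battery E en \<sigma> e C)"
proof -
  have fE: "finite E" using sg by (simp add: signed_graph_def)
  interpret block V E en
  proof
    show "finite E" by (fact fE)
    show "u \<in> V" if "f \<in> E" "joins en f u v" for f u v
      using sg joins_components[OF that(2)] that(1) by (auto simp: signed_graph_def)
    show "(x, y) \<in> (adj en E)\<^sup>*" if "x \<in> V" "y \<in> V" for x y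
      using blk that by (auto simp: is_block_def connected_graph_def)
    show "\<not> has_cutpoint E en" using blk by (simp add: is_block_def)
    show "fst (en f) \<noteq> snd (en f)" if "f \<in> E" for f using block_no_loop[OF sg blk not_edge that] .
  qed
  obtain P X where P: "pth en (fst (en e)) P X (snd (en e))" "C = insert e P" "e \<notin> P"
    using pth_if_is_circle[OF circC fE eC joins_ends noloop[OF eE]] .
  obtain vt ed n where f: "vt 0 = fst (en e)" "vt n = snd (en e)" "inj_on vt {..n}"
    "\<And>i. i < n \<Longrightarrow> joins en (ed i) (vt i) (vt (Suc i))" "P = ed ` {..<n}" "X = vt ` {..n}"
    by (rule pth_enumerate[OF P(1)]) blast
  interpret signed_frame V E en e vt ed n C \<sigma>
  proof
    show "0 < n" using f(1,2) noloop[OF eE] by (cases n) auto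
    show "inj_on vt {..n}" "\<And>i. i < n \<Longrightarrow> joins en (ed i) (vt i) (vt (Suc i))" by (fact f)+
    show "joins en e (vt 0) (vt n)" using f(1,2) joins_ends by metis
    show "e \<notin> ed ` {..<n}" "C = insert e (ed ` {..<n})" using P f(5) by auto
    show "C \<subseteq> E" using circC by (simp add: is_circle_def)
    show "C \<noteq> E" using circC not_circle by auto
    show "\<sigma> f = 1 \<or> \<sigma> f = -1" if "f \<in> E" for f using sg that by (auto simp: signed_graph_def)
  qed
  let ?L = "layered V E en C" and ?H = "\<exists>H. is_handle V E en C H \<and> e \<in> H"
  let ?B = "\<exists>H'. is_handle V E en C H' \<and> e \<notin> H' \<and> (\<exists>b\<in>H'. balancing_edge V E en \<sigma> b)"
  let ?N = "\<forall>D\<in>bridges V E en C. \<forall>P u w. P \<subseteq> D \<and> u \<in> att en C D \<and> w \<in> att en C D \<and>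
    is_path en P u w \<longrightarrow> (\<forall>Q. Q \<subseteq> C \<and> is_path en Q u w \<longrightarrow> sgn_of \<sigma> (P \<union> Q) = -1)"
  have neg: "neg_battery E en \<sigma> e C" if "?L" "?H" "?B"
  proof -
    have "two_att" "nested" using layered_iff_nested that(1,2) by blast+
    then show ?thesis using neg_battery_if_balancing_edge that(3) by blast
  qed
  have pos: "pos_battery E en \<sigma> e C" if h: "?L" "?H" "?N"
  proof -
    have "two_att" "nested" using layered_iff_nested h(1,2) by blast+
    then show ?thesis
    proof (rule pos_battery_if_paths_negative)
      show "sg (P \<union> Q) = -1" if "D \<in> bridges V E en C" "P \<subseteq> D" "u \<in> att en C D" "w \<in> att en C D"
        "is_path en P u w" "Q \<subseteq> C" "is_path en Q u w" for D P u w Q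
        using h(3) that by blast
    qed
  qed
  have fneg: "?L \<and> ?H \<and> ?B" if "neg_battery E en \<sigma> e C"
    using balancing_edge_if_battery[OF that] layered_iff_nested by blast
  have fpos: "?L \<and> ?H \<and> ?N" if "pos_battery E en \<sigma> e C"
  proof -
    have ?N
    proof (intro ballI allI impI)
      fix D P u w Q
      assume "D \<in> bridges V E en C" "P \<subseteq> D \<and> u \<in> att en C D \<and> w \<in> att en C D \<and> is_path en P u w"
        "Q \<subseteq> C \<and> is_path en Q u w"
      then show "sgn_of \<sigma> (P \<union> Q) = -1" using pos_cond_if_battery[OF that] by blast
    qed
    then show ?thesis using layered_if_pos_battery[OF that] layered_iff_nested by blast
  qed
  \<comment> \<open>The propositional skeleton of the theorem, in variables, so that the long
    conditions stay opaque to the automation.\<close>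
  have "(nb \<or> pb \<longleftrightarrow> l \<and> h \<and> (b \<or> m)) \<and> (l \<and> h \<and> b \<longrightarrow> nb) \<and> (l \<and> h \<and> m \<longrightarrow> pb)"
    if "l \<Longrightarrow> h \<Longrightarrow> b \<Longrightarrow> nb" "l \<Longrightarrow> h \<Longrightarrow> m \<Longrightarrow> pb" "nb \<Longrightarrow> l \<and> h \<and> b" "pb \<Longrightarrow> l \<and> h \<and> m" for nb pb l h b m
    using that by blast
  from this[OF neg pos fneg fpos] show ?thesis .
qed

end
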